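(* For all $v\in A^+$ there is an isomorphism of directed graphs $$\mathbf{G}(v)\cong\mathbf{Alc}.$$ Hence for all $\delta,\delta'\in\mathbb{Z}$ and all $\lambda,\lambda'\in X^+$, $$\mathbf{MBS}_{\delta}(\lambda)\cong\mathbf{MBS}_{\delta'}(\lambda').$$
   Context: $\mathbb{E}^\infty$ is the space of real sequences $(v_1,v_2,\ldots)$; $W_a$ is the group generated by the reflections $(ij)$ (swap coordinates $i,j$) and $(ij)_-$ (replace $v_i,v_j$ by $-v_j,-v_i$), $i\neq j$. $A^+\subset\mathbb{E}^\infty$ is the set of strictly decreasing sequences. $X^+$ is the set of partitions, regarded as weakly decreasing sequences of non-negative integers with finitely many non-zero entries. For $v\in A^+$ let $V(v)=W_av\cap A^+$. For $x,y\in A^+$ write $x\le y$ if $y-x$ has finitely many non-zero entries, all entries being non-negative. $\mathbf{G}(v)$ is the directed graph with vertex set $V(v)$ and an arrow $x\to y$ if and only if $x<y$ and there is no $z\in V(v)$ with $x<z<y$. Alcoves are the chambers (connected components of the complement) of the arrangement of all reflection hyperplanes of $W_a$. For $v,v'\in A^+$ each having no two coordinates of equal modulus, $v$ and $v'$ lie in the same alcove if and only if $|v'_i|>|v'_j|$ whenever $|v_i|>|v_j|$. $A_0$ is the alcove consisting of all $v\in A^+$ with $|v_1|<|v_2|$ and $v_2<0$. $\mathbf{Alc}$ is the directed graph whose vertices are the alcoves for $W_a$ in $A^+$, with an edge $A\to B$ if the closures of $A$ and $B$ meet in a hyperplane (which corresponds to $B=(ij)_-A$ for some reflection $(ij)_-$)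 and this hyperplane separates $A_0$ and $B$. The content of the box in row $i$ and column $j$ of a Young diagram is $j-i$. A pair of partitions $\mu\subset\lambda$ is $\delta$-balanced if (1) the boxes of the skew partition $\lambda/\mu$ can be paired so that the contents of each pair sum to $1-\delta$, and (2) if $\lambda/\mu$ contains boxes of contents $1-\frac{\delta}{2},-\frac{\delta}{2}$ and there is only one such box in the bottom row, then the number of pairs of such boxes is even. Two general partitions $\lambda,\mu$ are $\delta$-balanced if both $\lambda\cap\mu\subset\lambda$ and $\lambda\cap\mu\subset\mu$ are $\delta$-balanced. (It is known that $\lambda,\mu$ are $\delta$-balanced if and only if $\mu^T+\rho_\delta\in W_a(\lambda^T+\rho_\delta)$, where $T$ denotes transposition and $\rho_\delta=(-\frac\delta2,-\frac\delta2-1,-\frac\delta2-2,\ldots)$.) $V_\delta(\lambda)$ is the set of partitions $\mu$ such that $\mu$ and $\lambda$ are $\delta$-balanced. A partition $\mu\subsetneq\tau$ is a maximal $\delta$-balanced subpartition of $\tau$ if $\mu\in V_\delta(\tau)$ and there is no $\sigma\in V_\delta(\tau)$ with $\mu\subsetneq\sigma\subsetneq\tau$. $\mathbf{MBS}_\delta(\lambda)$ is the directed graph with vertex set $V_\delta(\lambda)$ and an edge $\mu\to\tau$ if $\mu$ is a maximal $\delta$-balanced subpartition of $\tau$.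
   Formalization: The first claim is proved for v with at least one negative entry (otherwise V(v)={v} while Alc is infinite), and the vertices of Alc are the alcoves in A⁺ lying in the W_a-orbit of A_0 (other chambers, such as that of (1,1/2,1/3,…), would be isolated vertices). *)

theory Defs
  imports
    "HOL-Analysis.Analysis"
    "HOL-Library.Function_Algebras"
    "Graph_Theory.Digraph_Isomorphism"
    "Graph_Theory.Pair_Digraph"
begin

section \<open>Sequences and the reflection group\<close>

text \<open>Sequences, rows and columns are indexed from 0. The type \<^typ>\<open>nat \<Rightarrow> real\<close> carries the
  library's product topology.\<close>

type_synonym rseq = "nat \<Rightarrow> real"

interpretation rseq: vector_space "\<lambda>(c::real) (v::rseq) i. c * v i"
  by unfold_locales (auto simp: fun_eq_iff algebra_simps)

definition refl_pos :: "nat \<Rightarrow> nat \<Rightarrow> rseq \<Rightarrow> rseq" where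
  "refl_pos i j v = v(i := v j, j := v i)"

definition refl_neg :: "nat \<Rightarrow> nat \<Rightarrow> rseq \<Rightarrow> rseq" where
  "refl_neg i j v = v(i := - v j, j := - v i)"

definition reflections :: "(rseq \<Rightarrow> rseq) set" where
  "reflections = {s. \<exists>i j. i \<noteq> j \<and> (s = refl_pos i j \<or> s = refl_neg i j)}"

inductive_set W_a :: "(rseq \<Rightarrow> rseq) set" where
  one: "id \<in> W_a"
| gen: "s \<in> reflections \<Longrightarrow> s \<in> W_a"
| mult: "w \<in> W_a \<Longrightarrow> w' \<in> W_a \<Longrightarrow> w \<circ> w' \<in> W_a"
| inverse: "w \<in> W_a \<Longrightarrow> inv w \<in> W_a"

definition A_plus :: "rseq set" where
  "A_plus = {v. \<forall>i j. i < j \<longrightarrow> v j < v i}"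


section \<open>The graph of an orbit\<close>

definition V :: "rseq \<Rightarrow> rseq set" where
  "V v = {w v | w. w \<in> W_a} \<inter> A_plus"

definition seq_le :: "rseq \<Rightarrow> rseq \<Rightarrow> bool" where
  "seq_le x y \<longleftrightarrow> finite {i. y i - x i \<noteq> 0} \<and> (\<forall>i. 0 \<le> y i - x i)"

definition seq_less :: "rseq \<Rightarrow> rseq \<Rightarrow> bool" where
  "seq_less x y \<longleftrightarrow> seq_le x y \<and> x \<noteq> y"

definition G_graph :: "rseq \<Rightarrow> rseq pair_pre_digraph" where
  "G_graph v =
     \<lparr>pverts = V v,
      parcs = {(x, y). x \<in> V v \<and> y \<in> V v \<and> seq_less x y \<and>
                       \<not> (\<exists>z\<in>V v. seq_less x z \<and> seq_less z y)}\<rparr>"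


section \<open>The graph of alcoves\<close>

text \<open>The generators are all the reflections that \<^const>\<open>W_a\<close> contains, so their fixed spaces are
  all the reflection hyperplanes.\<close>

definition hyperplanes :: "rseq set set" where
  "hyperplanes = {{v. s v = v} | s. s \<in> reflections}"

definition alcoves :: "rseq set set" where
  "alcoves = components (- \<Union> hyperplanes)"

definition A0 :: "rseq set" where
  "A0 = {v \<in> A_plus. \<bar>v 0\<bar> < \<bar>v 1\<bar> \<and> v 1 < 0}"

definition separates :: "rseq set \<Rightarrow> rseq set \<Rightarrow> rseq set \<Rightarrow> bool" where
  "separates H X Y \<longleftrightarrow>
     (\<exists>C\<in>components (- H). \<exists>D\<in>components (- H). C \<noteq> D \<and> X \<subseteq> C \<and> Y \<subseteq> D)"

text \<open>In finite rank \<^const>\<open>W_a\<close> permutes the chambers transitively. Here it does not: a bounded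
  sequence such as \<open>(5, -1, -3/2, -7/4, \<dots>)\<close> lies in a chamber inside \<^const>\<open>A_plus\<close> that is
  separated from \<^const>\<open>A0\<close> by infinitely many hyperplanes. The alcoves ``for'' \<^const>\<open>W_a\<close> are
  therefore read as the chambers in the \<^const>\<open>W_a\<close>-orbit of \<^const>\<open>A0\<close>.

  Two closures meet in a hyperplane \<open>H\<close> when their intersection is a common facet, that is, a
  subset of \<open>H\<close> that spans \<open>H\<close>.\<close>

definition Alc_verts :: "rseq set set" where
  "Alc_verts = {A \<in> alcoves. A \<subseteq> A_plus \<and> (\<exists>w\<in>W_a. A = w ` A0)}"

definition Alc :: "rseq set pair_pre_digraph" where
  "Alc =
     \<lparr>pverts = Alc_verts,
      parcs = {(A, B). A \<in> Alc_verts \<and> B \<in> Alc_verts \<and>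
                       (\<exists>H\<in>hyperplanes. rseq.span (closure A \<inter> closure B) = H \<and>
                                         separates H A0 B)}\<rparr>"


section \<open>Balanced partitions\<close>

definition X_plus :: "(nat \<Rightarrow> nat) set" where
  "X_plus = {lam. (\<forall>i j. i \<le> j \<longrightarrow> lam j \<le> lam i) \<and> finite {i. lam i \<noteq> 0}}"

text \<open>A box is a pair (row, column).\<close>

definition boxes :: "(nat \<Rightarrow> nat) \<Rightarrow> (nat \<times> nat) set" where
  "boxes lam = {(i, j). j < lam i}"

definition content :: "nat \<times> nat \<Rightarrow> int" where
  "content b = int (snd b) - int (fst b)"

definition pairable :: "int \<Rightarrow> (nat \<times> nat) set \<Rightarrow> bool" where
  "pairable \<delta> D \<longleftrightarrow>
     (\<exists>p. \<forall>b\<in>D. p b \<in> D \<and> p b \<noteq> b \<and> p (p b) = b \<and> content b + content (p b) = 1 - \<delta>)"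

text \<open>The boxes of content \<open>-\<delta>/2\<close> or \<open>1 - \<delta>/2\<close>; there are none if \<open>\<delta>\<close> is odd.\<close>

definition middle_boxes :: "int \<Rightarrow> (nat \<times> nat) set \<Rightarrow> (nat \<times> nat) set" where
  "middle_boxes \<delta> D = {b \<in> D. 2 * content b = - \<delta> \<or> 2 * content b = 2 - \<delta>}"

text \<open>In the second condition the bottom row is the lowest row that meets the middle boxes, not the
  lowest row of the whole skew diagram. With the latter reading the known description of balanced
  pairs by \<^const>\<open>W_a\<close>-orbits fails, for example for \<open>\<delta> = 2\<close>, \<open>(2,2,2,2)\<close> and \<open>(1,1,1,1)\<close>.
  A pair of middle boxes contains exactly one box of content \<open>-\<delta>/2\<close>.\<close>

definition balanced_sub :: "int \<Rightarrow> (nat \<Rightarrow> nat) \<Rightarrow> (nat \<Rightarrow> nat) \<Rightarrow> bool" where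
  "balanced_sub \<delta> mu lam \<longleftrightarrow>
     mu \<in> X_plus \<and> lam \<in> X_plus \<and> boxes mu \<subseteq> boxes lam \<and>
     (let D = boxes lam - boxes mu; M = middle_boxes \<delta> D
      in pairable \<delta> D \<and>
         (M \<noteq> {} \<and> card {b \<in> M. fst b = Max (fst ` M)} = 1 \<longrightarrow>
            even (card {b \<in> D. 2 * content b = - \<delta>})))"

definition balanced :: "int \<Rightarrow> (nat \<Rightarrow> nat) \<Rightarrow> (nat \<Rightarrow> nat) \<Rightarrow> bool" where
  "balanced \<delta> lam mu \<longleftrightarrow>
     (let nu = (\<lambda>i. min (lam i) (mu i)) in balanced_sub \<delta> nu lam \<and> balanced_sub \<delta> nu mu)"

definition V_bal :: "int \<Rightarrow> (nat \<Rightarrow> nat) \<Rightarrow> (nat \<Rightarrow> nat) set" where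
  "V_bal \<delta> lam = {mu \<in> X_plus. balanced \<delta> mu lam}"

definition maximal_balanced_sub :: "int \<Rightarrow> (nat \<Rightarrow> nat) \<Rightarrow> (nat \<Rightarrow> nat) \<Rightarrow> bool" where
  "maximal_balanced_sub \<delta> mu tau \<longleftrightarrow>
     mu \<in> V_bal \<delta> tau \<and> boxes mu \<subset> boxes tau \<and>
     \<not> (\<exists>sigma\<in>V_bal \<delta> tau. boxes mu \<subset> boxes sigma \<and> boxes sigma \<subset> boxes tau)"

definition MBS :: "int \<Rightarrow> (nat \<Rightarrow> nat) \<Rightarrow> (nat \<Rightarrow> nat) pair_pre_digraph" where
  "MBS \<delta> lam =
     \<lparr>pverts = V_bal \<delta> lam,
      parcs = {(mu, tau). mu \<in> V_bal \<delta> lam \<and> tau \<in> V_bal \<delta> lam \<and> maximal_balanced_sub \<delta> mu tau}\<rparr>"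

end

theory Submission
  imports Defs
begin

text \<open>
  \<^const>\<open>W_a\<close> consists of the finitely supported signed permutations with an even number of signs
  (\<open>W_a_eq\<close>), so a dominant sequence in the orbit of \<open>v\<close> is a choice of signs for the moduli of
  \<open>v\<close>, sorted. Not every modulus has a choice. If both \<open>p\<close> and \<open>- p\<close> are entries then they stay
  entries, because a strictly decreasing sequence has no repetitions; and a positive entry \<open>p\<close> such
  that \<open>- p\<close> lies below all of \<open>v\<close> stays positive, because \<open>- p\<close> could not be followed by the tail
  of \<open>v\<close>. The remaining moduli are called free. As \<open>v\<close> has a negative entry, they form an increasing
  sequence \<open>f 0 < f 1 < \<dots>\<close>. The sign of \<open>f 0\<close> is determined by the others through parity, or
  meaningless if \<open>f 0 = 0\<close>; hence a vertex of \<open>G_graph v\<close> is the same as the finite set of those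
  \<open>k\<close> for which \<open>f (k + 1)\<close> occurs with a positive sign.

  For decreasing sequences, \<open>x \<le> y\<close> means that \<open>y\<close> has at least as many entries above each
  threshold. Inside an orbit it is enough to test positive thresholds, since the number of entries of
  modulus at most \<open>q\<close> is the same for all members and this reflects the threshold \<open>- q\<close> into \<open>q\<close>.
  So the order becomes the dominance order on finite sets of natural numbers, which does not
  depend on \<open>v\<close> any more (\<open>G_graph_iso\<close>), and it remains to recognise the two other graphs as
  \<open>G_graph v\<close> for one \<open>v\<close> each.

  For the alcoves take \<open>v = (0, -1, -2, \<dots>)\<close>, a point of \<^const>\<open>A0\<close> whose orbit has exactly one point in
  each alcove considered. In this orbit \<open>x\<close> is covered by \<open>y\<close> if and only if \<open>y\<close> arises from \<open>x\<close> by
  a reflection \<open>(ij)\<^sub>-\<close> that raises two entries \<open>x i\<close>, \<open>x j\<close> with sum \<open>- 1\<close> by one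
  (\<open>G_graph_base_arc_iff\<close>). On the other side, two alcoves share a facet if and only if exactly one
  hyperplane separates them. The moduli of the entries can be recovered from the signs of all sums and
  differences, as ranks, and a change of a single sign exchanges two consecutive moduli, which is the
  same move (\<open>arc_imp_step\<close>, \<open>step_imp_arc\<close>).

  For the partitions, let \<open>x\<close> and \<open>z\<close> be the shifted transposes of \<open>\<lambda>\<close> and of a subpartition. The
  boxes of content \<open>c\<close> in the skew diagram are counted by the difference of the numbers of entries of
  \<open>x\<close> and of \<open>z\<close> above \<open>- c - \<delta>/2\<close> (\<open>card_content\<close>). The symmetry of the contents around
  \<open>(1 - \<delta>)/2\<close> therefore says that \<open>x\<close> and \<open>z\<close> have the same moduli, and the two parity conditions say
  that the number of positive entries changes by an even number unless \<open>0\<close> is an entry. This is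
  membership in the orbit (\<open>balanced_sub_iff\<close>). Orbits of these sequences are closed under
  componentwise minimum (\<open>V_meet\<close>), so that the definition of a balanced pair through the intersection
  of the two partitions amounts to the same orbit condition (\<open>balanced_iff\<close>).
\<close>

section \<open>Isomorphisms of directed graphs given by pairs\<close>

lemma digraph_iso_pairI:
  assumes f: "bij_betw f (pverts G) (pverts H)"
    and G: "parcs G \<subseteq> pverts G \<times> pverts G" and H: "parcs H \<subseteq> pverts H \<times> pverts H"
    and arcs: "\<And>x y. x \<in> pverts G \<Longrightarrow> y \<in> pverts G \<Longrightarrow> (x, y) \<in> parcs G \<longleftrightarrow> (f x, f y) \<in> parcs H"
  shows "digraph_iso (with_proj G) (with_proj H)"
proof -
  let ?h = "\<lparr>iso_verts = f, iso_arcs = map_prod f f, iso_head = snd, iso_tail = fst\<rparr>"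
  have inj: "inj_on f (pverts G)" and img: "f ` pverts G = pverts H"
    using f by (auto simp: bij_betw_def)
  have "wf_digraph (with_proj G)"
    using G by unfold_locales auto
  moreover have "inj_on (map_prod f f) (parcs G)"
    using map_prod_inj_on[OF inj inj] G by (rule inj_on_subset)
  ultimately have iso: "pre_digraph.digraph_isomorphism (with_proj G) ?h"
    using inj by (auto simp: pre_digraph.digraph_isomorphism_def)
  have "parcs H \<subseteq> map_prod f f ` parcs G"
  proof
    fix e assume e: "e \<in> parcs H"
    then obtain x y where "x \<in> pverts G" "y \<in> pverts G" "e = (f x, f y)"
      using H img by (cases e) blast
    then show "e \<in> map_prod f f ` parcs G"
      using arcs e by force
  qed
  moreover have "map_prod f f ` parcs G \<subseteq> parcs H"
    using arcs G by fastforce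
  ultimately have "with_proj H = app_iso ?h (with_proj G)"
    using img by (auto simp: app_iso_def with_proj_def)
  then show ?thesis
    using iso unfolding digraph_iso_def by blast
qed

text \<open>Both \<^const>\<open>G_graph\<close> and \<^const>\<open>MBS\<close> are of this form, so that isomorphisms between
  them reduce to order isomorphisms of their vertex sets.\<close>

definition hasse :: "'a set \<Rightarrow> ('a \<Rightarrow> 'a \<Rightarrow> bool) \<Rightarrow> 'a pair_pre_digraph" where
  "hasse P le =
     \<lparr>pverts = P,
      parcs = {(x, y). x \<in> P \<and> y \<in> P \<and> (le x y \<and> x \<noteq> y) \<and>
                       \<not> (\<exists>z\<in>P. (le x z \<and> x \<noteq> z) \<and> (le z y \<and> z \<noteq> y))}\<rparr>"

lemma digraph_iso_hasseI:
  assumes f: "bij_betw f P Q"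
    and le: "\<And>x y. x \<in> P \<Longrightarrow> y \<in> P \<Longrightarrow> le x y \<longleftrightarrow> le' (f x) (f y)"
  shows "digraph_iso (with_proj (hasse P le)) (with_proj (hasse Q le'))"
proof (rule digraph_iso_pairI)
  show "bij_betw f (pverts (hasse P le)) (pverts (hasse Q le'))"
    using f by (simp add: hasse_def)
  have inj: "\<And>x y. x \<in> P \<Longrightarrow> y \<in> P \<Longrightarrow> f x = f y \<longleftrightarrow> x = y" and img: "Q = f ` P"
    using f by (auto simp: bij_betw_def inj_on_def)
  fix x y assume "x \<in> pverts (hasse P le)" "y \<in> pverts (hasse P le)"
  then have xy: "x \<in> P" "y \<in> P" by (auto simp: hasse_def)
  then show "(x, y) \<in> parcs (hasse P le) \<longleftrightarrow> (f x, f y) \<in> parcs (hasse Q le')"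
    unfolding hasse_def img by (simp add: inj le)
qed (auto simp: hasse_def)

lemma digraph_iso_sym_hasse:
  assumes "digraph_iso (with_proj (hasse P le)) H"
  shows "digraph_iso H (with_proj (hasse P le))"
proof (rule digraph_iso_swap[OF _ assms])
  show "wf_digraph (with_proj (hasse P le))"
    by unfold_locales (auto simp: hasse_def)
qed

lemma G_graph_eq_hasse: "G_graph v = hasse (V v) seq_le"
  by (auto simp: G_graph_def hasse_def seq_less_def)


section \<open>The reflection group as a group of signed permutations\<close>

definition signed_perm :: "(nat \<Rightarrow> nat) \<Rightarrow> nat set \<Rightarrow> rseq \<Rightarrow> rseq" where
  "signed_perm p F v = (\<lambda>i. if i \<in> F then - v (p i) else v (p i))"

definition even_signed_perms :: "(rseq \<Rightarrow> rseq) set" where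
  "even_signed_perms =
     {signed_perm p F | p F. (\<exists>N. p permutes {..<N::nat}) \<and> finite F \<and> even (card F)}"

lemma even_card_sym_diff:
  assumes "finite A" "finite B"
  shows "even (card (sym_diff A B)) \<longleftrightarrow> even (card A + card B)"
proof -
  have "card A = card (A - B) + card (A \<inter> B)" "card B = card (B - A) + card (A \<inter> B)"
    using card_Int_Diff[OF assms(1), of B] card_Int_Diff[OF assms(2), of A]
    by (simp_all add: Int_commute)
  moreover have "card (sym_diff A B) = card (A - B) + card (B - A)"
    using assms by (intro card_Un_disjoint) auto
  ultimately show ?thesis by presburger
qed

lemma signed_perm_comp:
  assumes "bij p"
  shows "signed_perm p F \<circ> signed_perm q G = signed_perm (q \<circ> p) (sym_diff F (inv p ` G))"
proof -
  have "i \<in> inv p ` G \<longleftrightarrow> p i \<in> G" for i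
    using assms by (auto simp: image_iff bij_inv_eq_iff bij_is_inj intro: bexI[of _ "p i"])
  then show ?thesis
    by (auto simp: signed_perm_def fun_eq_iff)
qed

lemma even_signed_perms_comp:
  assumes "w \<in> even_signed_perms" "w' \<in> even_signed_perms"
  shows "w \<circ> w' \<in> even_signed_perms"
proof -
  obtain p F N where w: "w = signed_perm p F" "p permutes {..<N::nat}" "finite F" "even (card F)"
    using assms(1) by (auto simp: even_signed_perms_def)
  obtain q G M where w': "w' = signed_perm q G" "q permutes {..<M::nat}" "finite G" "even (card G)"
    using assms(2) by (auto simp: even_signed_perms_def)
  have bij: "bij p" using w(2) by (rule permutes_bij)
  have "q \<circ> p permutes {..<max N M}"
    using w(2) w'(2) by (intro permutes_compose) (auto elim!: permutes_subset)
  moreover have "card (inv p ` G) = card G"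
    using bij by (intro card_image) (meson bij_betw_def bij_imp_bij_inv inj_on_subset subset_UNIV)
  then have "even (card (sym_diff F (inv p ` G)))"
    using w w' by (subst even_card_sym_diff) auto
  moreover have "finite (sym_diff F (inv p ` G))" using w w' by auto
  ultimately show ?thesis
    unfolding even_signed_perms_def w(1) w'(1) signed_perm_comp[OF bij] by blast
qed

lemma even_signed_perms_inv:
  assumes "w \<in> even_signed_perms"
  shows "inv w \<in> even_signed_perms"
proof -
  obtain p F N where w: "w = signed_perm p F" "p permutes {..<N::nat}" "finite F" "even (card F)"
    using assms by (auto simp: even_signed_perms_def)
  have inj: "inj p" and bij: "bij p" using w(2) by (auto simp: permutes_inj permutes_bij)
  have inv: "p (inv p i) = i" "inv p (p i) = i" for i
    using w(2) by (auto simp: permutes_inverses)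
  have mem: "i \<in> p ` F \<longleftrightarrow> inv p i \<in> F" for i
    by (metis image_iff inv)
  have "inv w = signed_perm (inv p) (p ` F)"
    unfolding w(1)
    by (rule inv_unique_comp) (auto simp: fun_eq_iff signed_perm_def mem inv)
  moreover have "card (p ` F) = card F"
    using inj by (intro card_image) (rule inj_on_subset, auto)
  ultimately show ?thesis
    using w permutes_inv[OF w(2)] unfolding even_signed_perms_def by fastforce
qed

lemma reflections_even_signed_perms:
  assumes "s \<in> reflections"
  shows "s \<in> even_signed_perms"
proof -
  obtain i j where ij: "i \<noteq> j" and s: "s = refl_pos i j \<or> s = refl_neg i j"
    using assms by (auto simp: reflections_def)
  have perm: "Transposition.transpose i j permutes {..<Suc (max i j)}"
    by (rule permutes_swap_id) auto
  have pos: "refl_pos i j = signed_perm (Transposition.transpose i j) {}"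
    and neg: "refl_neg i j = signed_perm (Transposition.transpose i j) {i, j}"
    using ij by (auto simp: fun_eq_iff refl_pos_def refl_neg_def signed_perm_def
        Transposition.transpose_def)
  show ?thesis
    using s
  proof
    assume "s = refl_pos i j"
    then show ?thesis
      using perm unfolding pos even_signed_perms_def by fastforce
  next
    assume "s = refl_neg i j"
    moreover have "even (card {i, j})" using ij by simp
    ultimately show ?thesis
      using perm unfolding neg even_signed_perms_def by blast
  qed
qed

lemma W_a_perm:
  assumes "finite S" "p permutes S"
  shows "signed_perm p {} \<in> W_a"
  using assms
proof (induction rule: permutes_rev_induct)
  case id
  have "signed_perm id {} = id" by (auto simp: signed_perm_def)
  then show ?case using W_a.one by metis
next
  case (swap a b p)
  have "signed_perm (p \<circ> Transposition.transpose a b) {} = refl_pos a b \<circ> signed_perm p {}"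
    by (auto simp: fun_eq_iff refl_pos_def signed_perm_def Transposition.transpose_def)
  moreover have "refl_pos a b \<in> W_a"
    using swap by (intro W_a.gen) (auto simp: reflections_def)
  ultimately show ?case
    using swap W_a.mult by metis
qed

lemma W_a_signs:
  assumes "finite F" "even (card F)"
  shows "signed_perm id F \<in> W_a"
  using assms
proof (induction "card F" arbitrary: F rule: less_induct)
  case less
  show ?case
  proof (cases "F = {}")
    case True
    then have "signed_perm id F = id" by (auto simp: signed_perm_def)
    then show ?thesis using W_a.one by simp
  next
    case False
    then obtain a where a: "a \<in> F" by blast
    have "F \<noteq> {a}"
      using less.prems by auto
    then obtain b where b: "b \<in> F" "b \<noteq> a"
      using a by blast
    let ?F = "F - {a, b}"
    have card: "card F = Suc (Suc (card ?F))"
      using a b less.prems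
      by (metis Diff_insert2 Diff_iff card_Suc_Diff1 finite_Diff insert_iff singletonD)
    \<comment> \<open>Two signs are removed at a time: \<open>(ab)\<^sub>-\<close> after \<open>(ab)\<close> changes just the signs at \<open>a\<close> and \<open>b\<close>.\<close>
    have "signed_perm id F = refl_neg a b \<circ> (refl_pos a b \<circ> signed_perm id ?F)"
      using a b by (auto simp: fun_eq_iff refl_pos_def refl_neg_def signed_perm_def)
    moreover have "signed_perm id ?F \<in> W_a"
      using less card by auto
    moreover have "refl_pos a b \<in> W_a" "refl_neg a b \<in> W_a"
      using b(2) by (auto intro!: W_a.gen simp: reflections_def, metis, metis)
    ultimately show ?thesis
      by (metis W_a.mult)
  qed
qed

text \<open>Each generator changes an even number of signs, whence one inclusion. For the other, a signed
  permutation is a permutation followed by sign changes; transpositions generate the former, and the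
  latter are products of simultaneous sign changes \<open>(ij)\<^sub>- (ij)\<close> of two entries.\<close>

lemma W_a_eq: "W_a = even_signed_perms"
proof
  show "W_a \<subseteq> even_signed_perms"
  proof
    fix w assume "w \<in> W_a"
    then show "w \<in> even_signed_perms"
    proof induction
      case one
      have "id = signed_perm id {}" by (auto simp: signed_perm_def)
      then show ?case
        unfolding even_signed_perms_def using permutes_id by fastforce
    next
      case (gen s)
      then show ?case by (rule reflections_even_signed_perms)
    next
      case (mult w w')
      then show ?case by (intro even_signed_perms_comp)
    next
      case (inverse w)
      then show ?case by (intro even_signed_perms_inv)
    qed
  qed
  show "even_signed_perms \<subseteq> W_a"
  proof
    fix w assume "w \<in> even_signed_perms"
    then obtain p F N where w: "w = signed_perm p F" "p permutes {..<N::nat}" "finite F" "even (card F)"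
      by (auto simp: even_signed_perms_def)
    have "w = signed_perm id F \<circ> signed_perm p {}"
      unfolding w(1) by (auto simp: signed_perm_def fun_eq_iff)
    then show "w \<in> W_a"
      using W_a_perm[OF _ w(2)] W_a_signs[OF w(3,4)] W_a.mult by auto
  qed
qed

lemma W_a_cases:
  assumes "w \<in> W_a"
  obtains p F N where "w = signed_perm p F" "p permutes {..<N::nat}" "finite F" "even (card F)"
  using assms unfolding W_a_eq even_signed_perms_def by blast

lemma signed_perm_in_W_a:
  assumes "p permutes {..<N::nat}" "finite F" "even (card F)"
  shows "signed_perm p F \<in> W_a"
  using assms unfolding W_a_eq even_signed_perms_def by blast

lemma W_a_bij:
  assumes "w \<in> W_a"
  shows "bij w"
proof -
  obtain p F N where w: "w = signed_perm p F" "p permutes {..<N::nat}"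
    using assms by (rule W_a_cases)
  have inv: "p (inv p i) = i" "inv p (p i) = i" for i
    using w(2) by (auto simp: permutes_inverses)
  have mem: "i \<in> p ` F \<longleftrightarrow> inv p i \<in> F" for i
    by (metis image_iff inv)
  show ?thesis
    unfolding w(1)
    by (rule o_bij[where g = "signed_perm (inv p) (p ` F)"])
      (auto simp: fun_eq_iff signed_perm_def mem inv)
qed


section \<open>Orbits in the dominant cone\<close>

lemma A_plus_less_iff: "v \<in> A_plus \<Longrightarrow> v i < v j \<longleftrightarrow> j < i"
  unfolding A_plus_def by (metis (mono_tags, lifting) mem_Collect_eq not_less_iff_gr_or_eq order_less_asym)

lemma A_plus_le_iff: "v \<in> A_plus \<Longrightarrow> v i \<le> v j \<longleftrightarrow> j \<le> i"
  using A_plus_less_iff by (metis linorder_not_less)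

lemma A_plus_eq_iff: "v \<in> A_plus \<Longrightarrow> v i = v j \<longleftrightarrow> i = j"
  by (metis A_plus_le_iff order_antisym order_refl)

lemma A_plus_inj: "v \<in> A_plus \<Longrightarrow> inj v"
  by (simp add: A_plus_eq_iff inj_on_def)

lemma A_plusI: "(\<And>i j. i < j \<Longrightarrow> v j < v i) \<Longrightarrow> v \<in> A_plus"
  by (simp add: A_plus_def)

lemma in_V_self: "v \<in> A_plus \<Longrightarrow> v \<in> V v"
  using W_a.one by (auto simp: V_def intro!: exI[of _ id])

lemma V_eq:
  assumes "x \<in> V v"
  shows "V x = V v"
proof -
  obtain w where w: "w \<in> W_a" "x = w v"
    using assms by (auto simp: V_def)
  then have inv: "inv w \<in> W_a" "v = inv w x"
    using W_a.inverse W_a_bij by (auto simp: bij_is_inj)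
  have sub: "V (u a) \<subseteq> V a" if "u \<in> W_a" for u a
  proof
    fix y assume "y \<in> V (u a)"
    then obtain u' where "u' \<in> W_a" "y = (u' \<circ> u) a" "y \<in> A_plus"
      by (auto simp: V_def)
    then show "y \<in> V a"
      using W_a.mult[OF _ that] unfolding V_def by blast
  qed
  have "V x \<subseteq> V v" using sub[OF w(1), of v] unfolding w(2) .
  moreover have "V v \<subseteq> V x" using sub[OF inv(1), of x] unfolding inv(2)[symmetric] .
  ultimately show ?thesis by (rule equalityI)
qed

lemma V_A_plus: "x \<in> V v \<Longrightarrow> x \<in> A_plus"
  by (simp add: V_def)

lemma V_finite_diff:
  assumes "x \<in> V v"
  shows "finite {i. x i \<noteq> v i}"
proof -
  obtain w where "w \<in> W_a" and x: "x = w v"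
    using assms by (auto simp: V_def)
  then obtain p F N where w: "w = signed_perm p F" "p permutes {..<N::nat}" "finite F"
    by (auto elim: W_a_cases)
  have "{i. x i \<noteq> v i} \<subseteq> {..<N} \<union> F"
    using w(2) by (auto simp: x w(1) signed_perm_def permutes_def)
  then show ?thesis using w(3) finite_subset by blast
qed

lemma V_moduli_bij:
  assumes "x \<in> V v"
  obtains p where "bij p" "\<And>i. \<bar>x i\<bar> = \<bar>v (p i)\<bar>"
proof -
  obtain w where "w \<in> W_a" and x: "x = w v"
    using assms by (auto simp: V_def)
  then obtain p F N where w: "w = signed_perm p F" "p permutes {..<N::nat}"
    by (auto elim: W_a_cases)
  show thesis
    using that[of p] permutes_bij[OF w(2)] by (auto simp: x w(1) signed_perm_def)
qed

lemma card_vimage_bij: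
  assumes "bij p"
  shows "card {i. P (p i)} = card {i. P i}"
proof (rule bij_betw_same_card[of p])
  show "bij_betw p {i. P (p i)} {i. P i}"
    using assms by (intro bij_betw_byWitness[where f' = "inv p"])
      (auto simp: bij_is_inj bij_is_surj surj_f_inv_f)
qed

lemma V_card_moduli:
  assumes "x \<in> V v"
  shows "card {i. P \<bar>x i\<bar>} = card {i. P \<bar>v i\<bar>}"
proof -
  obtain p where p: "bij p" "\<And>i. \<bar>x i\<bar> = \<bar>v (p i)\<bar>"
    using V_moduli_bij[OF assms] by blast
  show ?thesis
    using card_vimage_bij[OF p(1), of "\<lambda>i. P \<bar>v i\<bar>"] by (simp add: p(2))
qed

lemma finite_ge:
  assumes v: "v \<in> A_plus" and neg: "v i < t"
  shows "finite {j. v j \<ge> t}"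
proof (rule finite_subset)
  show "{j. v j \<ge> t} \<subseteq> {..<i}"
    using A_plus_le_iff[OF v] neg by (auto simp: not_le[symmetric]) (meson dual_order.trans not_le)
qed simp

text \<open>Applying the signs of a signed permutation toggles the positivity of exactly the entries at the
  changed positions, provided that no entry vanishes.\<close>

lemma V_parity:
  assumes x: "x \<in> V v" and v: "v \<in> A_plus" and neg: "v n < 0" and zero: "0 \<notin> range v"
  shows "even (card {i. 0 < x i} + card {i. 0 < v i})"
proof -
  obtain w where "w \<in> W_a" and xw: "x = w v"
    using x by (auto simp: V_def)
  then obtain p F N where w: "w = signed_perm p F" "p permutes {..<N::nat}" "finite F" "even (card F)"
    by (auto elim: W_a_cases)
  have bij: "bij p" using w(2) by (rule permutes_bij)
  have nz: "v i \<noteq> 0" for i using zero by (metis rangeI)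
  have fin: "finite {i. 0 < v i}"
    using finite_ge[OF v neg] by (rule finite_subset[rotated]) auto
  have card: "card {i. 0 < v (p i)} = card {i. 0 < v i}"
    using card_vimage_bij[OF bij, of "\<lambda>i. 0 < v i"] .
  have fin': "finite {i. 0 < v (p i)}"
    using finite_vimageI[OF fin, of p] bij by (simp add: vimage_def bij_is_inj)
  have "{i. 0 < x i} = sym_diff {i. 0 < v (p i)} F"
    using nz by (auto simp: xw w(1) signed_perm_def not_less order_le_less)
  then show ?thesis
    using even_card_sym_diff[OF fin' w(3)] w(4) card by simp
qed

lemma finite_same_modulus:
  assumes "v \<in> A_plus"
  shows "finite {i. \<bar>v i\<bar> = p}"
proof -
  have "v ` {i. \<bar>v i\<bar> = p} \<subseteq> {p, - p}" by auto
  then show ?thesis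
    using A_plus_inj[OF assms] by (metis finite_imageD finite_insert finite.emptyI finite_subset inj_on_subset subset_UNIV)
qed

text \<open>Equal multisets of moduli give a permutation matching moduli, and the signs are then forced up
  to the freedom of choosing the sign of a zero entry. That freedom is why the parity of the number
  of positive entries only matters if no entry vanishes.\<close>

lemma V_memI:
  assumes x: "x \<in> A_plus" and y: "y \<in> A_plus" and neg: "x n < 0"
    and fin: "finite {i. y i \<noteq> x i}"
    and moduli: "\<And>p. card {i. \<bar>y i\<bar> = p} = card {i. \<bar>x i\<bar> = p}"
    and parity: "0 \<notin> range x \<Longrightarrow> even (card {i. 0 < y i} + card {i. 0 < x i})"
  shows "y \<in> V x"
proof -
  obtain N where N: "\<And>i. i \<ge> N \<Longrightarrow> y i = x i"
    using fin finite_nat_set_iff_bounded by (metis (mono_tags, lifting) linorder_not_less mem_Collect_eq)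
  have "card {i\<in>{..<N}. \<bar>y i\<bar> = p} = card {i\<in>{..<N}. \<bar>x i\<bar> = p}" for p
  proof -
    have *: "card {i. \<bar>z i\<bar> = p} = card {i\<in>{..<N}. \<bar>z i\<bar> = p} + card {i\<in>{N..}. \<bar>z i\<bar> = p}"
      if "z \<in> A_plus" for z
      using finite_same_modulus[OF that]
      by (subst card_Un_disjoint[symmetric]) (auto intro!: arg_cong[where f = card])
    have "{i\<in>{N..}. \<bar>y i\<bar> = p} = {i\<in>{N..}. \<bar>x i\<bar> = p}" using N by auto
    then show ?thesis using *[OF x] *[OF y] moduli[of p] by simp
  qed
  moreover have "count (image_mset (\<lambda>i. \<bar>z i\<bar>) (mset_set {..<N})) p = card {i\<in>{..<N}. \<bar>z i\<bar> = p}"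
    for z :: rseq and p
    by (rule count_image_mset_eq_card_vimage) simp
  ultimately have "image_mset (\<lambda>i. \<bar>y i\<bar>) (mset_set {..<N}) = image_mset (\<lambda>i. \<bar>x i\<bar>) (mset_set {..<N})"
    by (intro multiset_eqI) simp
  then obtain p where p: "p permutes {..<N}" and eq: "\<And>i. i < N \<Longrightarrow> \<bar>y i\<bar> = \<bar>x (p i)\<bar>"
    by (auto elim!: image_mset_eq_implies_permutes[rotated])
  have bij: "bij p" using p by (rule permutes_bij)
  have eq: "\<bar>y i\<bar> = \<bar>x (p i)\<bar>" for i
    using eq[of i] N[of i] p by (cases "i < N") (auto simp: permutes_def)
  have out: "y i = x (p i)" if "i \<ge> N" for i
    using N[OF that] p that by (auto simp: permutes_def)
  define F0 where "F0 = {i. y i \<noteq> x (p i)}"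
  have F0: "F0 \<subseteq> {..<N}" using out by (auto simp: F0_def not_less[symmetric])
  have fin0: "finite F0" using F0 finite_subset by blast
  have y0: "signed_perm p F0 x = y"
  proof
    fix i
    show "signed_perm p F0 x i = y i"
      using eq[of i] by (auto simp: signed_perm_def F0_def abs_eq_iff)
  qed
  have "\<exists>F. finite F \<and> even (card F) \<and> signed_perm p F x = y"
  proof (cases "even (card F0)")
    case True
    then show ?thesis using fin0 y0 by blast
  next
    case odd: False
    \<comment> \<open>The set of forced signs has the parity of the change in the number of positive entries.\<close>
    have "0 \<in> range x"
    proof (rule ccontr)
      assume z: "0 \<notin> range x"
      then have nz: "x i \<noteq> 0" for i by (metis rangeI)
      have fin: "finite {i. 0 < x i}"
        using finite_ge[OF x neg] by (rule finite_subset[rotated]) auto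
      have card: "card {i. 0 < x (p i)} = card {i. 0 < x i}"
        using card_vimage_bij[OF bij, of "\<lambda>i. 0 < x i"] .
      have fin': "finite {i. 0 < x (p i)}"
        using finite_vimageI[OF fin, of p] bij by (simp add: vimage_def bij_is_inj)
      have "{i. 0 < y i} = sym_diff {i. 0 < x (p i)} F0"
        using nz unfolding y0[symmetric]
        by (auto simp: signed_perm_def not_less order_le_less)
      then show False
        using even_card_sym_diff[OF fin' fin0] parity[OF z] card odd by simp
    qed
    then obtain m where "x m = 0" by auto
    then obtain k where k: "x (p k) = 0" using bij by (metis bij_pointE)
    then have "k \<notin> F0" using eq[of k] by (auto simp: F0_def)
    then have "even (card (insert k F0))" using odd fin0 by simp
    moreover have "signed_perm p (insert k F0) x = y"
    proof
      fix i
      have "y k = 0" using k eq[of k] by simp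
      then show "signed_perm p (insert k F0) x i = y i"
        using k fun_cong[OF y0, of i] by (cases "i = k") (simp_all add: signed_perm_def)
    qed
    ultimately show ?thesis using fin0 by blast
  qed
  then obtain F where "finite F" "even (card F)" "signed_perm p F x = y" by blast
  then have "\<exists>w\<in>W_a. w x = y" using signed_perm_in_W_a[OF p] by blast
  then show ?thesis using y by (auto simp: V_def)
qed


section \<open>Counting entries above a threshold\<close>

lemma card_image_inj: "inj f \<Longrightarrow> card (f ` A) = card A"
  by (rule card_image) (erule inj_on_subset, simp)

lemma finite_image_inj: "inj f \<Longrightarrow> finite (f ` A) \<longleftrightarrow> finite A"
  by (rule finite_image_iff) (erule inj_on_subset, simp)

text \<open>This reflects the threshold \<open>- q\<close> into \<open>q\<close>: the correction term depends on the moduli only, so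
  it is constant on orbits.\<close>

lemma card_ge_neg:
  fixes x :: rseq
  assumes fin: "finite {i. x i \<ge> - q}" and q: "0 \<le> q"
  shows "card {i. x i \<ge> - q} = card {i. \<bar>x i\<bar> \<le> q} + card {i. x i > q}"
proof -
  have "{i. x i \<ge> - q} = {i. \<bar>x i\<bar> \<le> q} \<union> {i. x i > q}"
    using q by auto
  moreover have "finite {i. \<bar>x i\<bar> \<le> q}" "finite {i. x i > q}"
    using q by (auto intro: finite_subset[OF _ fin])
  moreover have "{i. \<bar>x i\<bar> \<le> q} \<inter> {i. x i > q} = {}"
    by auto
  ultimately show ?thesis
    by (simp add: card_Un_disjoint)
qed

lemma card_modulus:
  assumes "z \<in> A_plus" "0 < p"
  shows "card {i. \<bar>z i\<bar> = p} = of_bool (p \<in> range z) + of_bool (- p \<in> range z)"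
proof -
  have "card {i. \<bar>z i\<bar> = p} = card (z ` {i. \<bar>z i\<bar> = p})"
    by (rule card_image_inj[OF A_plus_inj[OF assms(1)], symmetric])
  also have "z ` {i. \<bar>z i\<bar> = p} = (if p \<in> range z then {p} else {}) \<union> (if - p \<in> range z then {- p} else {})"
    using assms(2) by (auto simp: abs_eq_iff' image_iff) (metis rangeI)+
  finally show ?thesis using assms(2) by auto
qed

lemma A_plus_neg_tail: "v \<in> A_plus \<Longrightarrow> v n < t \<Longrightarrow> n \<le> i \<Longrightarrow> v i < t"
  using A_plus_le_iff by (metis order_le_less_trans)

text \<open>The enumeration is the inverse of the rank function, which sends an element to the number of
  smaller ones. It is onto because the least element of rank at least \<open>n\<close> has rank \<open>n\<close>.\<close>

lemma ex_strict_mono_enumeration: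
  fixes S :: "real set"
  assumes inf: "infinite S" and fin: "\<And>s. s \<in> S \<Longrightarrow> finite {t\<in>S. t \<le> s}"
  shows "\<exists>e::nat \<Rightarrow> real. strict_mono e \<and> range e = S"
proof -
  define r where "r s = card {t\<in>S. t < s}" for s
  have fin': "finite {t\<in>S. t < s}" if "s \<in> S" for s
    using fin[OF that] by (rule finite_subset[rotated]) auto
  have mono: "r s < r t" if "s \<in> S" "t \<in> S" "s < t" for s t
    unfolding r_def using that fin' by (intro psubset_card_mono) auto
  have inj: "inj_on r S"
    using mono by (intro inj_onI) (metis less_irrefl linorder_neqE_linordered_idom)
  have "\<exists>s\<in>S. r s = n" for n
  proof -
    have "finite {s\<in>S. r s < n}"
      by (rule inj_on_finite[of r _ "{..<n}"]) (auto intro: inj_on_subset[OF inj])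
    then have "infinite (S - {s\<in>S. r s < n})"
      using inf by simp
    then obtain s0 where s0: "s0 \<in> S" "r s0 \<ge> n"
      by (metis (mono_tags, lifting) Diff_iff finite.emptyI ex_in_conv mem_Collect_eq not_less)
    define T where "T = {t\<in>S. t \<le> s0 \<and> r t \<ge> n}"
    have T: "finite T" "s0 \<in> T"
      using s0 by (auto simp: T_def intro: finite_subset[OF _ fin[OF s0(1)]])
    define s where "s = Min T"
    have sT: "s \<in> T" unfolding s_def using T by (intro Min_in) auto
    have least: "r t < n" if "t \<in> S" "t < s" for t
    proof (rule ccontr)
      assume "\<not> r t < n"
      then have "t \<in> T" using that sT by (auto simp: T_def)
      then show False using Min_le[OF T(1)] that(2) by (fastforce simp: s_def)
    qed
    have "r s \<le> n"
    proof -
      have "r ` {t\<in>S. t < s} \<subseteq> {..<n}" using least by auto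
      then have "card (r ` {t\<in>S. t < s}) \<le> n" using card_mono[of "{..<n}"] by simp
      moreover have "card (r ` {t\<in>S. t < s}) = card {t\<in>S. t < s}"
        by (rule card_image) (auto intro: inj_on_subset[OF inj])
      ultimately show ?thesis by (simp add: r_def)
    qed
    then show ?thesis using sT by (auto simp: T_def)
  qed
  then have img: "r ` S = UNIV" by (auto simp: image_iff) metis
  define e where "e = inv_into S r"
  have e: "e k \<in> S" "r (e k) = k" for k
    using img by (auto simp: e_def inv_into_into f_inv_into_f)
  have "strict_mono e"
  proof (rule strict_monoI)
    fix k l :: nat assume kl: "k < l"
    show "e k < e l"
      using mono[OF e(1) e(1), of l k] e(2) kl by (metis less_asym less_irrefl linorder_neqE_linordered_idom)
  qed
  moreover have "range e = S"
    using e inj by (auto simp: e_def image_iff) (metis inv_into_f_f)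
  ultimately show ?thesis by blast
qed

lemma ex_decreasing_rearrangement:
  fixes u :: "nat \<Rightarrow> real"
  assumes inj: "inj_on u {..<N}"
  shows "\<exists>p. p permutes {..<N} \<and> (\<forall>i j. i < j \<longrightarrow> j < N \<longrightarrow> u (p j) < u (p i))"
proof -
  define xs where "xs = rev (sort (map u [0..<N]))"
  have "mset xs = mset (map u [0..<N])" by (simp add: xs_def)
  then obtain p where p: "p permutes {..<length (map u [0..<N])}" "permute_list p (map u [0..<N]) = xs"
    by (rule mset_eq_permutation)
  have pN: "p permutes {..<N}" using p(1) by simp
  have nth: "xs ! i = u (p i)" if "i < N" for i
  proof -
    have "p i < N" using pN that by (metis lessThan_iff permutes_in_image)
    then show ?thesis using that p by (auto simp: permute_list_nth p(2)[symmetric])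
  qed
  have len: "length xs = N" by (simp add: xs_def)
  have "u (p j) < u (p i)" if "i < j" "j < N" for i j
  proof -
    have "sorted_wrt (\<ge>) xs"
      unfolding xs_def by (simp add: sorted_wrt_rev)
    then have "u (p j) \<le> u (p i)"
      using that nth len by (metis (no_types, lifting) order_less_trans sorted_wrt_nth_less)
    moreover have "p i \<noteq> p j" using permutes_inj[OF pN] that by (metis injD less_irrefl)
    then have "u (p i) \<noteq> u (p j)"
      using inj pN that by (metis inj_onD lessThan_iff order_less_trans permutes_in_image)
    ultimately show ?thesis by simp
  qed
  then show ?thesis using pN by blast
qed


section \<open>An orbit as the poset of finite sets of natural numbers\<close>

text \<open>The dominance order. Listing a finite set in decreasing order, it is the containment order of
  partitions with distinct parts.\<close>

definition dominated :: "nat set \<Rightarrow> nat set \<Rightarrow> bool" where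
  "dominated K L \<longleftrightarrow> (\<forall>m. card {k\<in>K. m \<le> k} \<le> card {k\<in>L. m \<le> k})"

lemma seq_le_antisym: "seq_le x y \<Longrightarrow> seq_le y x \<Longrightarrow> x = y"
  by (auto simp: seq_le_def fun_eq_iff order_antisym)

locale orbit =
  fixes v :: rseq and n :: nat
  assumes v: "v \<in> A_plus" and neg: "v n < 0"
begin

text \<open>A modulus is free if it occurs with one sign only and its negative could be inserted before some
  entry of \<open>v\<close>. Zero is its own negative and counts as free if it occurs.\<close>

definition free :: "real set" where
  "free = {p. 0 \<le> p \<and> (p \<in> range v \<or> - p \<in> range v) \<and> \<not> (p \<noteq> 0 \<and> p \<in> range v \<and> - p \<in> range v) \<and>
           (\<exists>j. v j < - p)}"

lemma free_index_ex: "p \<in> free \<Longrightarrow> \<exists>i. \<bar>v i\<bar> = p"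
  by (auto simp: free_def) (metis abs_minus_cancel abs_of_nonneg minus_minus)+

lemma free_index_unique:
  assumes "\<bar>v i\<bar> \<in> free" "\<bar>v j\<bar> = \<bar>v i\<bar>"
  shows "i = j"
proof (rule ccontr)
  assume "i \<noteq> j"
  then have "v i \<noteq> v j" using A_plus_eq_iff[OF v] by simp
  then have "v j = - v i" "v i \<noteq> 0" using assms(2) by (auto simp: abs_eq_iff)
  then show False using assms(1) unfolding free_def by (auto simp: abs_if split: if_splits) (metis rangeI minus_minus)+
qed

lemma finite_free_le:
  assumes "s \<in> free"
  shows "finite {t\<in>free. t \<le> s}"
proof (rule finite_subset)
  obtain j where "v j < - s" using assms by (auto simp: free_def)
  then have "finite {i. v i \<ge> - s}" by (rule finite_ge[OF v])
  then show "finite ((\<lambda>i. \<bar>v i\<bar>) ` {i. v i \<ge> - s})" by simp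
  show "{t\<in>free. t \<le> s} \<subseteq> (\<lambda>i. \<bar>v i\<bar>) ` {i. v i \<ge> - s}"
  proof
    fix t assume "t \<in> {t\<in>free. t \<le> s}"
    then obtain i where "\<bar>v i\<bar> = t" "t \<le> s" using free_index_ex by auto
    then show "t \<in> (\<lambda>i. \<bar>v i\<bar>) ` {i. v i \<ge> - s}" by (auto intro!: image_eqI[of _ _ i])
  qed
qed

lemma finite_pos: "x \<in> V v \<Longrightarrow> finite {i. 0 < x i}"
proof -
  assume x: "x \<in> V v"
  have "finite {i. 0 < v i}"
    using finite_ge[OF v neg] by (rule finite_subset[rotated]) auto
  then have "finite ({i. 0 < v i} \<union> {i. x i \<noteq> v i})"
    using V_finite_diff[OF x] by simp
  then show ?thesis by (rule finite_subset[rotated]) auto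
qed

lemma infinite_free: "infinite free"
proof
  assume fin: "finite free"
  define D where "D = {i. n \<le> i \<and> - v i \<in> range v}"
  have neg': "v i < 0" if "n \<le> i" for i
    using A_plus_neg_tail[OF v neg that] .
  have inj: "inj (\<lambda>i. - v i)" using A_plus_inj[OF v] by (simp add: inj_on_def)
  have "(\<lambda>i. - v i) ` D \<subseteq> v ` {i. 0 < v i}"
    using neg' by (auto simp: D_def) (metis (mono_tags, lifting) image_eqI mem_Collect_eq neg_0_less_iff_less)
  moreover have "finite (v ` {i. 0 < v i})" using finite_pos[OF in_V_self[OF v]] by simp
  ultimately have "finite D"
    using finite_image_inj[OF inj, of D] finite_subset by blast
  have "(\<lambda>i. - v i) ` ({n..} - D) \<subseteq> free"
  proof
    fix s assume "s \<in> (\<lambda>i. - v i) ` ({n..} - D)"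
    then obtain i where i: "n \<le> i" "i \<notin> D" "s = - v i" by auto
    moreover have "v (Suc i) < v i" using A_plus_less_iff[OF v] by simp
    ultimately show "s \<in> free"
      using neg'[of i] by (auto simp: free_def D_def intro!: exI[of _ "Suc i"])
  qed
  then have "finite ({n..} - D)"
    using finite_image_inj[OF inj, of "{n..} - D"] fin finite_subset by blast
  then show False using \<open>finite D\<close> infinite_Ici[of n] by (metis finite_Diff2)
qed

definition nth_free :: "nat \<Rightarrow> real" where
  "nth_free = (SOME f. strict_mono f \<and> range f = free)"

lemma nth_free_strict_mono: "strict_mono nth_free" and range_nth_free: "range nth_free = free"
  using someI_ex[OF ex_strict_mono_enumeration[OF infinite_free finite_free_le]] by (auto simp: nth_free_def)

lemma nth_free_in_free: "nth_free k \<in> free"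
  using range_nth_free by auto

lemma nth_free_less_iff: "nth_free k < nth_free l \<longleftrightarrow> k < l"
  by (rule strict_mono_less[OF nth_free_strict_mono])

lemma nth_free_le_iff: "nth_free k \<le> nth_free l \<longleftrightarrow> k \<le> l"
  by (rule strict_mono_less_eq[OF nth_free_strict_mono])

lemma nth_free_eq_iff: "nth_free k = nth_free l \<longleftrightarrow> k = l"
  by (rule strict_mono_eq[OF nth_free_strict_mono])

lemma nth_free_nonneg: "0 \<le> nth_free k"
  using nth_free_in_free[of k] by (simp add: free_def)

lemma nth_free_Suc_pos: "0 < nth_free (Suc k)"
  using nth_free_nonneg[of 0] nth_free_less_iff[of 0 "Suc k"] by simp

text \<open>A modulus that is not free occurs in \<open>v\<close> with both signs, or not at all, or with a positive sign
  and its negative below all entries. In the first two cases the multiplicity of the modulus decides.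
  In the last case the negative would have to precede the unchanged tail of \<open>v\<close>, which is above it.\<close>

lemma mem_range_outside_free:
  assumes x: "x \<in> V v" and p: "0 < p" "p \<notin> free"
  shows "p \<in> range x \<longleftrightarrow> p \<in> range v"
proof -
  have xA: "x \<in> A_plus" using x by (rule V_A_plus)
  have card: "of_bool (p \<in> range x) + of_bool (- p \<in> range x) =
      (of_bool (p \<in> range v) + of_bool (- p \<in> range v) :: nat)"
    using V_card_moduli[OF x, of "\<lambda>t. t = p"] card_modulus[OF xA p(1)] card_modulus[OF v p(1)] by simp
  show ?thesis
  proof (cases "\<exists>j. v j < - p")
    case True
    then have "(p \<in> range v \<and> - p \<in> range v) \<or> (p \<notin> range v \<and> - p \<notin> range v)"
      using p by (auto simp: free_def)
    then show ?thesis using card by (auto split: if_splits simp: of_bool_def)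
  next
    case False
    then have ge: "v j \<ge> - p" for j by (simp add: not_less)
    have notin: "- p \<notin> range z" if z: "z \<in> V v" for z
    proof
      assume "- p \<in> range z"
      then obtain i where i: "z i = - p" by auto
      obtain N where N: "\<And>j. j \<ge> N \<Longrightarrow> z j = v j"
        using V_finite_diff[OF z] finite_nat_set_iff_bounded
        by (metis (mono_tags, lifting) linorder_not_less mem_Collect_eq)
      have "z (max (Suc i) N) < z i"
        using A_plus_less_iff[OF V_A_plus[OF z]] by simp
      then show False using N[of "max (Suc i) N"] ge[of "max (Suc i) N"] i by simp
    qed
    show ?thesis
      using card notin[OF x] notin[OF in_V_self[OF v]] by (auto split: if_splits simp: of_bool_def)
  qed
qed

text \<open>Up to a contribution of the moduli that are not free, which is the same for the whole orbit, the
  positive entries are counted by positions in the enumeration of the free moduli.\<close>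

lemma card_entries:
  assumes x: "x \<in> V v" and U: "U \<subseteq> {0<..}"
  shows "finite {k. nth_free k \<in> range x \<and> nth_free k \<in> U}"
    and "card {i. x i \<in> U} = card {k. nth_free k \<in> range x \<and> nth_free k \<in> U} + card (range v \<inter> (U - free))"
proof -
  have inj: "inj x" using A_plus_inj[OF V_A_plus[OF x]] .
  have finx: "finite {i. x i \<in> U}"
    using finite_pos[OF x] U by (auto elim: finite_subset[rotated])
  have img: "x ` {i. x i \<in> U} = range x \<inter> U" by auto
  have fin: "finite (range x \<inter> U)" using finx img by (metis finite_imageI)
  have "nth_free ` {k. nth_free k \<in> range x \<and> nth_free k \<in> U} = range nth_free \<inter> (range x \<inter> U)"
    by auto
  then have eimg: "nth_free ` {k. nth_free k \<in> range x \<and> nth_free k \<in> U} = range x \<inter> (U \<inter> free)"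
    unfolding range_nth_free by auto
  have einj: "inj nth_free" by (simp add: nth_free_eq_iff inj_on_def)
  have "finite (nth_free ` {k. nth_free k \<in> range x \<and> nth_free k \<in> U})"
    unfolding eimg using fin by (rule finite_subset[rotated]) auto
  then show "finite {k. nth_free k \<in> range x \<and> nth_free k \<in> U}"
    using finite_image_inj[OF einj] by blast
  have "card {i. x i \<in> U} = card (range x \<inter> U)"
    using card_image_inj[OF inj, of "{i. x i \<in> U}"] img by simp
  also have "range x \<inter> U = (range x \<inter> (U \<inter> free)) \<union> (range x \<inter> (U - free))" by auto
  also have "card \<dots> = card (range x \<inter> (U \<inter> free)) + card (range x \<inter> (U - free))"
    using fin by (intro card_Un_disjoint) (auto elim: finite_subset[rotated])
  also have "card (range x \<inter> (U \<inter> free)) = card {k. nth_free k \<in> range x \<and> nth_free k \<in> U}"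
    using card_image_inj[OF einj, of "{k. nth_free k \<in> range x \<and> nth_free k \<in> U}"] unfolding eimg .
  also have "range x \<inter> (U - free) = range v \<inter> (U - free)"
    using mem_range_outside_free[OF x] U by auto
  finally show "card {i. x i \<in> U} = card {k. nth_free k \<in> range x \<and> nth_free k \<in> U} + card (range v \<inter> (U - free))" .
qed

text \<open>The least free modulus is left out: its sign is determined by parity, or has no meaning if it is
  zero.\<close>

definition code :: "rseq \<Rightarrow> nat set" where
  "code x = {k. nth_free (Suc k) \<in> range x}"

lemma finite_code:
  assumes "x \<in> V v"
  shows "finite (code x)"
proof -
  have "Suc ` code x \<subseteq> {k. nth_free k \<in> range x \<and> nth_free k \<in> {0<..}}"
    using nth_free_Suc_pos by (auto simp: code_def)
  then have "finite (Suc ` code x)" using card_entries(1)[OF assms] finite_subset by blast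
  then show ?thesis by (simp add: finite_image_iff)
qed

lemma card_entries_code:
  assumes x: "x \<in> V v"
  shows "card {i. nth_free (Suc m) \<le> x i} =
    card {k\<in>code x. m \<le> k} + card (range v \<inter> ({nth_free (Suc m)..} - free))"
proof -
  have "{k. nth_free k \<in> range x \<and> nth_free k \<in> {nth_free (Suc m)..}} = Suc ` {k\<in>code x. m \<le> k}"
    by (auto simp: code_def nth_free_le_iff image_iff Suc_le_eq) (metis Suc_pred less_Suc_eq_le gr_implies_not0 not_gr_zero)
  then have "card {k. nth_free k \<in> range x \<and> nth_free k \<in> {nth_free (Suc m)..}} = card {k\<in>code x. m \<le> k}"
    by (simp add: card_image)
  then show ?thesis
    using card_entries(2)[OF x, of "{nth_free (Suc m)..}"] less_le_trans[OF nth_free_Suc_pos[of m]]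
    by (simp add: subset_iff)
qed

lemma code_mono:
  assumes x: "x \<in> V v" and y: "y \<in> V v" and le: "seq_le x y"
  shows "dominated (code x) (code y)"
  unfolding dominated_def
proof
  fix m
  have "finite {i. nth_free (Suc m) \<le> y i}"
    using finite_pos[OF y] nth_free_Suc_pos[of m] by (auto elim!: finite_subset[rotated])
  moreover have "{i. nth_free (Suc m) \<le> x i} \<subseteq> {i. nth_free (Suc m) \<le> y i}"
    using le by (auto simp: seq_le_def) (meson order_trans)
  ultimately have "card {i. nth_free (Suc m) \<le> x i} \<le> card {i. nth_free (Suc m) \<le> y i}"
    by (rule card_mono)
  then show "card {k\<in>code x. m \<le> k} \<le> card {k\<in>code y. m \<le> k}"
    using card_entries_code[OF x] card_entries_code[OF y] by simp
qed

text \<open>Dominance of the codes compares numbers of entries above the free moduli other than the least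
  one. An arbitrary positive threshold may be moved up to the next free modulus. If that is the least
  one, all free moduli count; the two numbers then have the same parity, so that the code, which
  misses at most one of them, still detects a strict inequality.\<close>

lemma dominated_card_le:
  assumes x: "x \<in> V v" and y: "y \<in> V v" and dom: "dominated (code x) (code y)"
    and U: "U \<subseteq> {0<..}" and up: "\<And>a b. a \<in> U \<Longrightarrow> a \<le> b \<Longrightarrow> b \<in> U"
  shows "card {i. x i \<in> U} \<le> card {i. y i \<in> U}"
proof (rule ccontr)
  define A where "A z = {k. nth_free k \<in> range z \<and> nth_free k \<in> U}" for z :: rseq
  define A' where "A' z = {k. Suc k \<in> A z}" for z
  assume "\<not> ?thesis"
  then have less: "card (A y) < card (A x)"
    using card_entries(2)[OF x U] card_entries(2)[OF y U] by (simp add: A_def)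
  have fin: "finite (A z)" if "z \<in> V v" for z
    using card_entries(1)[OF that U] by (simp add: A_def)
  have fin': "finite (A' z)" if "z \<in> V v" for z
    using fin[OF that] finite_imageD[of Suc "A' z"] by (auto simp: A'_def intro: finite_subset[of _ "A z"])
  have card: "card (A z) = card (A' z) + of_bool (0 \<in> A z)" if z: "z \<in> V v" for z
  proof -
    have "A z = Suc ` A' z \<union> (if 0 \<in> A z then {0} else {})"
      by (auto simp: A'_def image_iff) (metis not0_implies_Suc)+
    moreover have "card (Suc ` A' z \<union> (if 0 \<in> A z then {0} else {})) = card (A' z) + of_bool (0 \<in> A z)"
      using fin'[OF z] by (subst card_Un_disjoint) (auto simp: card_image)
    ultimately show ?thesis by simp
  qed
  \<comment> \<open>Forgetting the position \<open>0\<close> keeps the inequality strict, because of parity.\<close>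
  have less': "card (A' y) < card (A' x)"
  proof (rule ccontr)
    assume "\<not> card (A' y) < card (A' x)"
    then have eq: "card (A' x) = card (A' y)" "0 \<in> A x" "0 \<notin> A y"
      using less card[OF x] card[OF y] by (auto simp: of_bool_def split: if_splits)
    then have e0: "nth_free 0 \<in> U" by (simp add: A_def)
    then have eU: "nth_free k \<in> U" for k using up[OF e0] nth_free_le_iff by simp
    have pos: "0 < nth_free k" for k using eU U by auto
    have zero: "0 \<notin> range v"
    proof
      assume "0 \<in> range v"
      then have "0 \<in> free" using neg by (auto simp: free_def)
      then show False using range_nth_free pos by (metis imageE less_irrefl)
    qed
    have "card {i. z i \<in> {0<..}} = card (A z) + card (range v \<inter> ({0<..} - free))" if "z \<in> V v" for z
      using card_entries(2)[OF that, of "{0<..}"] eU pos by (simp add: A_def)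
    moreover have "even (card {i. 0 < x i} + card {i. 0 < y i})"
      using V_parity[OF x v neg zero] V_parity[OF y v neg zero] by presburger
    ultimately have "even (card (A x) + card (A y))"
      using x y by (simp del: even_add) presburger
    then show False using eq card[OF x] card[OF y] by simp
  qed
  then have ne: "A' x \<noteq> {}" by auto
  \<comment> \<open>The threshold is moved up to the smallest free modulus that counts for \<open>x\<close>.\<close>
  define m where "m = Min (A' x)"
  have m: "m \<in> A' x" "\<And>k. k \<in> A' x \<Longrightarrow> m \<le> k"
    using fin'[OF x] ne by (auto simp: m_def)
  then have "nth_free (Suc m) \<in> U" by (simp add: A'_def A_def)
  then have eU: "nth_free (Suc k) \<in> U" if "m \<le> k" for k
    using up that nth_free_le_iff by simp
  have "{k\<in>code x. m \<le> k} = A' x"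
  proof (rule set_eqI)
    fix k
    show "k \<in> {k\<in>code x. m \<le> k} \<longleftrightarrow> k \<in> A' x"
      using m(2)[of k] eU[of k] by (auto simp: code_def A'_def A_def)
  qed
  moreover have "{k\<in>code y. m \<le> k} \<subseteq> A' y"
    using eU by (auto simp: code_def A'_def A_def)
  then have "card {k\<in>code y. m \<le> k} \<le> card (A' y)"
    using fin'[OF y] card_mono by blast
  ultimately show False
    using dom less' by (auto simp: dominated_def) (metis less_le_not_le order_trans)
qed

text \<open>If \<open>y i < x i\<close> then \<open>x\<close> has \<open>i + 1\<close> entries that are at least \<open>x i\<close>, but \<open>y\<close> has at most \<open>i\<close>.
  This contradicts the comparison of counts at the threshold \<open>x i\<close> if that is positive, and at its
  reflection \<open>- x i\<close> otherwise.\<close>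

lemma code_reflects:
  assumes x: "x \<in> V v" and y: "y \<in> V v" and dom: "dominated (code x) (code y)"
  shows "seq_le x y"
proof -
  have xA: "x \<in> A_plus" and yA: "y \<in> A_plus" using x y by (auto dest: V_A_plus)
  have "finite ({i. x i \<noteq> v i} \<union> {i. y i \<noteq> v i})"
    using V_finite_diff x y by simp
  then have fin: "finite {i. y i - x i \<noteq> 0}" by (rule finite_subset[rotated]) auto
  have "x i \<le> y i" for i
  proof (rule ccontr)
    assume "\<not> x i \<le> y i"
    then have less: "y i < x i" by simp
    have xset: "{j. x j \<ge> x i} = {..i}" using A_plus_le_iff[OF xA] by auto
    have yset: "{j. y j \<ge> x i} \<subseteq> {..<i}"
    proof
      fix j assume "j \<in> {j. y j \<ge> x i}"
      then have "y i < y j" using less by simp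
      then show "j \<in> {..<i}" using A_plus_less_iff[OF yA] by simp
    qed
    have cx: "card {j. x j \<ge> x i} = Suc i" unfolding xset by simp
    have cy: "card {j. y j \<ge> x i} \<le> i" using card_mono[OF _ yset] by simp
    show False
    proof (cases "0 < x i")
      case True
      have "card {j. x j \<in> {x i..}} \<le> card {j. y j \<in> {x i..}}"
        by (rule dominated_card_le[OF x y dom]) (use True in auto)
      then show False using cx cy by simp
    next
      case False
      then have q: "0 \<le> - x i" by simp
      have fins: "finite {j. x j \<ge> - (- x i)}" "finite {j. y j \<ge> - (- x i)}"
        using xset yset finite_subset by auto
      have "card {j. \<bar>x j\<bar> \<le> - x i} = card {j. \<bar>y j\<bar> \<le> - x i}"
        using V_card_moduli[OF x, of "\<lambda>t. t \<le> - x i"] V_card_moduli[OF y, of "\<lambda>t. t \<le> - x i"] by simp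
      moreover have "card {j. x j \<in> {- x i<..}} \<le> card {j. y j \<in> {- x i<..}}"
        by (rule dominated_card_le[OF x y dom]) (use False in auto)
      ultimately show False
        using card_ge_neg[OF fins(1) q] card_ge_neg[OF fins(2) q] cx cy by simp
    qed
  qed
  then show ?thesis using fin by (simp add: seq_le_def)
qed

text \<open>Starting from \<open>v\<close>, change the signs of the free moduli that have the wrong sign, correct the
  parity with the least free modulus, and sort. Sorting needs a finite permutation only, since each
  changed entry stays above some entry of \<open>v\<close>.\<close>

lemma code_surj:
  assumes K: "finite K"
  shows "\<exists>y\<in>V v. code y = K"
proof -
  define ix where "ix k = (SOME i. \<bar>v i\<bar> = nth_free k)" for k
  have ix: "\<bar>v (ix k)\<bar> = nth_free k" for k
    unfolding ix_def using free_index_ex[OF nth_free_in_free] by (rule someI_ex)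
  have ix_unique: "i = ix k" if "\<bar>v i\<bar> = nth_free k" for i k
    using free_index_unique[of i "ix k"] that ix nth_free_in_free by simp
  have ix_inj: "inj ix" by (metis nth_free_eq_iff injI ix)
  define Fl where "Fl = {k. (k \<in> K) \<noteq> (k \<in> code v)}"
  have "Fl \<subseteq> K \<union> code v" by (auto simp: Fl_def)
  then have "finite Fl" using K finite_code[OF in_V_self[OF v]] finite_subset by blast
  \<comment> \<open>The position \<open>0\<close> repairs the parity unnoticed: the code does not see it.\<close>
  define G where "G = Suc ` Fl \<union> (if even (card Fl) then {} else {0})"
  have G: "finite G" using \<open>finite Fl\<close> by (simp add: G_def)
  have "card G = card Fl + (if even (card Fl) then 0 else 1)"
    unfolding G_def using \<open>finite Fl\<close> by (subst card_Un_disjoint) (auto simp: card_image)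
  then have evenG: "even (card G)" by simp
  define I where "I = ix ` G"
  have I: "finite I" "even (card I)"
    using G evenG ix_inj by (auto simp: I_def card_image inj_on_subset)
  have I_iff: "ix k \<in> I \<longleftrightarrow> k \<in> G" for k
    using ix_inj by (auto simp: I_def inj_image_mem_iff)
  have I_free: "\<bar>v i\<bar> \<in> free" if "i \<in> I" for i
    using that ix nth_free_in_free by (auto simp: I_def)
  define u where "u = signed_perm id I v"
  have u: "u i = (if i \<in> I then - v i else v i)" for i by (simp add: u_def signed_perm_def)
  have abs_u: "\<bar>u i\<bar> = \<bar>v i\<bar>" for i by (simp add: u)
  have inj_u: "inj u"
  proof (rule injI, rule ccontr)
    fix i j assume ij: "u i = u j" "i \<noteq> j"
    then have eq: "\<bar>v i\<bar> = \<bar>v j\<bar>" using abs_u by metis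
    then have "i \<notin> I" "j \<notin> I" using free_index_unique ij(2) I_free by metis+
    then show False using ij A_plus_eq_iff[OF v] by (simp add: u)
  qed
  have "\<forall>i\<in>I. \<exists>j. v j < - \<bar>v i\<bar>" using I_free by (auto simp: free_def)
  then obtain J where J: "\<And>i. i \<in> I \<Longrightarrow> v (J i) < - \<bar>v i\<bar>" by metis
  \<comment> \<open>From \<open>N\<close> on nothing is changed, and all changed entries are above \<open>v N\<close>.\<close>
  obtain N where N: "\<And>i. i \<in> I \<union> J ` I \<Longrightarrow> i < N"
    using I(1) finite_nat_set_iff_bounded by (metis finite_UnI finite_imageI)
  have vN: "v N < u i" if "i < N" for i
  proof (cases "i \<in> I")
    case True
    have "v N \<le> v (J i)" using N[of "J i"] True A_plus_le_iff[OF v] by simp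
    then show ?thesis using J[OF True] by (simp add: u True)
  next
    case False
    then show ?thesis using that A_plus_less_iff[OF v] by (simp add: u)
  qed
  have tail: "u i = v i" if "N \<le> i" for i using N that u by (metis UnCI linorder_not_less)
  obtain p where p: "p permutes {..<N}" "\<And>i j. i < j \<Longrightarrow> j < N \<Longrightarrow> u (p j) < u (p i)"
    using ex_decreasing_rearrangement[of u N] inj_u by (meson inj_on_subset subset_UNIV)
  define y where "y = signed_perm p {} u"
  have y: "y i = u (p i)" for i by (simp add: y_def signed_perm_def)
  have out: "p i = i" if "N \<le> i" for i using p(1) that by (auto simp: permutes_def)
  have inside: "p i < N" if "i < N" for i using p(1) that by (metis lessThan_iff permutes_in_image)
  have "y \<in> A_plus"
  proof (rule A_plusI)
    fix i j :: nat assume ij: "i < j"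
    consider "j < N" | "i < N" "N \<le> j" | "N \<le> i" by linarith
    then show "y j < y i"
    proof cases
      case 1
      then show ?thesis using p(2) ij by (simp add: y)
    next
      case 2
      then have "y j \<le> v N" using A_plus_le_iff[OF v] by (simp add: y out tail)
      also have "v N < y i" using vN[OF inside[OF 2(1)]] by (simp add: y)
      finally show ?thesis .
    next
      case 3
      then show ?thesis using ij A_plus_less_iff[OF v] by (simp add: y out tail)
    qed
  qed
  moreover have "y = (signed_perm p {} \<circ> signed_perm id I) v" by (simp add: y_def u_def)
  moreover have "signed_perm p {} \<in> W_a" "signed_perm id I \<in> W_a"
    using W_a_perm[OF _ p(1)] W_a_signs[OF I] by auto
  ultimately have yV: "y \<in> V v"
    unfolding V_def using W_a.mult by blast
  have "range y = range u"
    using permutes_surj[OF p(1)] by (auto simp: y image_iff) (metis surjD)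
  have "code y = K"
  proof (rule set_eqI)
    fix k
    let ?i = "ix (Suc k)"
    have pos: "0 < nth_free (Suc k)" by (rule nth_free_Suc_pos)
    have "nth_free (Suc k) \<in> range z \<longleftrightarrow> z ?i = nth_free (Suc k)" if "\<And>i. \<bar>z i\<bar> = \<bar>v i\<bar>" for z
      using ix_unique[of _ "Suc k"] pos that by (auto simp: image_iff) (metis abs_of_pos)+
    then have "k \<in> code y \<longleftrightarrow> u ?i = nth_free (Suc k)" "k \<in> code v \<longleftrightarrow> v ?i = nth_free (Suc k)"
      using abs_u by (auto simp: code_def \<open>range y = range u\<close>)
    moreover have "?i \<in> I \<longleftrightarrow> (k \<in> K) \<noteq> (k \<in> code v)"
      unfolding I_iff by (auto simp: G_def Fl_def)
    moreover have "- v ?i = nth_free (Suc k) \<longleftrightarrow> v ?i \<noteq> nth_free (Suc k)"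
      using ix[of "Suc k"] pos by linarith
    ultimately show "k \<in> code y \<longleftrightarrow> k \<in> K" by (auto simp: u split: if_splits)
  qed
  then show ?thesis using yV by blast
qed

lemma G_graph_iso_dominated:
  "digraph_iso (with_proj (G_graph v)) (with_proj (hasse {K. finite K} dominated))"
  unfolding G_graph_eq_hasse
proof (rule digraph_iso_hasseI)
  have "inj_on code (V v)"
  proof (rule inj_onI)
    fix x y assume xy: "x \<in> V v" "y \<in> V v" and eq: "code x = code y"
    have "dominated (code x) (code y)" "dominated (code y) (code x)"
      using eq by (simp_all add: dominated_def)
    then show "x = y" using code_reflects xy seq_le_antisym by blast
  qed
  moreover have "code ` V v = {K. finite K}"
    using finite_code code_surj by (auto simp: image_iff)
  ultimately show "bij_betw code (V v) {K. finite K}" by (simp add: bij_betw_def)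
qed (use code_mono code_reflects in blast)

end

lemma G_graph_iso:
  assumes "v \<in> A_plus" "v i < 0" "u \<in> A_plus" "u j < 0"
  shows "digraph_iso (with_proj (G_graph v)) (with_proj (G_graph u))"
proof -
  have "digraph_iso (with_proj (G_graph v)) (with_proj (hasse {K. finite K} dominated))"
    using assms by (intro orbit.G_graph_iso_dominated[of v i]) (simp add: orbit_def)
  moreover have "digraph_iso (with_proj (G_graph u)) (with_proj (hasse {K. finite K} dominated))"
    using assms by (intro orbit.G_graph_iso_dominated[of u j]) (simp add: orbit_def)
  then have "digraph_iso (with_proj (hasse {K. finite K} dominated)) (with_proj (G_graph u))"
    unfolding G_graph_eq_hasse by (rule digraph_iso_sym_hasse)
  ultimately show ?thesis by (rule digraph_iso_trans)
qed


section \<open>Pairings with prescribed sums\<close>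

lemma card_fibre_remove_pair:
  assumes "finite D" "b \<in> D" "b' \<in> D" "b \<noteq> b'"
  shows "card {a\<in>D. f a = c} =
    card {a\<in>D - {b, b'}. f a = c} + of_bool (f b = c) + of_bool (f b' = c)"
proof -
  have "{a\<in>D. f a = c} = {a\<in>D - {b, b'}. f a = c} \<union> {a\<in>{b, b'}. f a = c}"
    using assms by auto
  also have "card \<dots> = card {a\<in>D - {b, b'}. f a = c} + card {a\<in>{b, b'}. f a = c}"
    using assms by (intro card_Un_disjoint) auto
  also have "{a\<in>{b, b'}. f a = c} = (if f b = c then {b} else {}) \<union> (if f b' = c then {b'} else {})"
    by auto
  also have "card \<dots> = of_bool (f b = c) + of_bool (f b' = c)"
    using assms(4) by auto
  finally show ?thesis by simp
qed

text \<open>Removing two paired elements changes the counts at \<open>c\<close> and \<open>k - c\<close> alike, and the count at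
  \<open>c = k/2\<close> by an even number; so both sides are preserved and induction applies. Conversely the
  counts provide a partner for any element, the parity being used if its value is \<open>k/2\<close>.\<close>

lemma pairing_iff:
  fixes f :: "'a \<Rightarrow> int"
  assumes "finite D"
  shows "(\<exists>p. \<forall>b\<in>D. p b \<in> D \<and> p b \<noteq> b \<and> p (p b) = b \<and> f b + f (p b) = k) \<longleftrightarrow>
    (\<forall>c. card {b\<in>D. f b = c} = card {b\<in>D. f b = k - c}) \<and>
    (\<forall>c. 2 * c = k \<longrightarrow> even (card {b\<in>D. f b = c}))"
    (is "(\<exists>p. ?pairing p D) \<longleftrightarrow> ?counts D")
  using assms
proof (induction "card D" arbitrary: D rule: less_induct)
  case less
  show ?case
  proof (cases "D = {}")
    case True
    then show ?thesis by simp
  next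
    case False
    then obtain b where b: "b \<in> D" by blast
    have counts: "?counts D \<longleftrightarrow> ?counts (D - {b, b'})" if "b' \<in> D" "b' \<noteq> b" "f b' = k - f b" for b'
    proof -
      have eq: "card {a\<in>D. f a = c} =
          card {a\<in>D - {b, b'}. f a = c} + of_bool (f b = c) + of_bool (k - f b = c)" for c
        using card_fibre_remove_pair[OF less.prems b that(1), of f c] that by simp
      have "f b = k - c \<longleftrightarrow> k - f b = c" "k - f b = k - c \<longleftrightarrow> f b = c" for c by auto
      then have one: "card {a\<in>D. f a = c} = card {a\<in>D. f a = k - c} \<longleftrightarrow>
          card {a\<in>D - {b, b'}. f a = c} = card {a\<in>D - {b, b'}. f a = k - c}" for c
        unfolding eq[of c] eq[of "k - c"] by (simp add: add.assoc add.commute[of "of_bool (k - f b = c)"])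
      have "2 * c = k \<Longrightarrow> k - f b = c \<longleftrightarrow> f b = c" for c by auto
      then have two: "2 * c = k \<Longrightarrow>
          even (card {a\<in>D. f a = c}) \<longleftrightarrow> even (card {a\<in>D - {b, b'}. f a = c})" for c
        unfolding eq[of c] by simp
      show ?thesis by (simp only: one two cong: imp_cong)
    qed
    have smaller: "card (D - {b, b'}) < card D" for b'
      using b less.prems by (intro psubset_card_mono) auto
    have IH: "(\<exists>p. ?pairing p (D - {b, b'})) \<longleftrightarrow> ?counts (D - {b, b'})" for b'
      using less.hyps[OF smaller] less.prems by simp
    show ?thesis
    proof
      assume "\<exists>p. ?pairing p D"
      then obtain p where p: "?pairing p D" by blast
      have "?pairing p (D - {b, p b})"
      proof
        fix a assume a: "a \<in> D - {b, p b}"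
        then have "p a \<noteq> b" "p a \<noteq> p b" using p b by (metis Diff_iff insertCI)+
        then show "p a \<in> D - {b, p b} \<and> p a \<noteq> a \<and> p (p a) = a \<and> f a + f (p a) = k"
          using p a by blast
      qed
      then have "?counts (D - {b, p b})" using IH by blast
      moreover have "p b \<in> D" "p b \<noteq> b" "f (p b) = k - f b" using p b by force+
      ultimately show "?counts D" using counts by blast
    next
      assume c: "?counts D"
      have "\<exists>b'\<in>D. b' \<noteq> b \<and> f b' = k - f b"
      proof (cases "2 * f b = k")
        case True
        then have "even (card {a\<in>D. f a = f b})" using c by blast
        moreover have "b \<in> {a\<in>D. f a = f b}" using b by simp
        ultimately have "{a\<in>D. f a = f b} \<noteq> {b}" by auto
        then obtain b' where "b' \<in> D" "f b' = f b" "b' \<noteq> b" using b by blast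
        then show ?thesis using True by (intro bexI[of _ b']) auto
      next
        case False
        have "card {a\<in>D. f a = f b} \<noteq> 0" using b less.prems by auto
        then have "card {a\<in>D. f a = k - f b} \<noteq> 0" using c by metis
        then obtain b' where "b' \<in> D" "f b' = k - f b"
          by (metis (mono_tags, lifting) card.empty empty_Collect_eq)
        then show ?thesis using False by (intro bexI[of _ b']) auto
      qed
      then obtain b' where b': "b' \<in> D" "b' \<noteq> b" "f b' = k - f b" by blast
      then have "?counts (D - {b, b'})" using c counts by blast
      then obtain p where p: "?pairing p (D - {b, b'})" using IH by blast
      have "?pairing (p(b := b', b' := b)) D"
      proof
        fix a assume a: "a \<in> D"
        consider "a = b" | "a = b'" | "a \<in> D - {b, b'}" using a by blast
        then show "(p(b := b', b' := b)) a \<in> D \<and> (p(b := b', b' := b)) a \<noteq> a \<and>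
            (p(b := b', b' := b)) ((p(b := b', b' := b)) a) = a \<and> f a + f ((p(b := b', b' := b)) a) = k"
        proof cases
          case 3
          then have "p a \<in> D - {b, b'}" "p a \<noteq> a" "p (p a) = a" "f a + f (p a) = k" using p by blast+
          then show ?thesis using 3 by auto
        qed (use b b' in auto)
      qed
      then show "\<exists>p. ?pairing p D" by blast
    qed
  qed
qed


section \<open>Partitions as sequences in the dominant cone\<close>

definition conj_part :: "(nat \<Rightarrow> nat) \<Rightarrow> nat \<Rightarrow> nat" where
  "conj_part lam j = card {i. j < lam i}"

text \<open>This is \<open>\<lambda>\<^sup>T + \<rho>\<^sub>\<delta>\<close>. Writing it as an integer minus \<open>\<delta>/2\<close> displays that all entries lie in
  one coset of the integers, and so do their negatives.\<close>

definition shifted :: "int \<Rightarrow> (nat \<Rightarrow> nat) \<Rightarrow> rseq" where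
  "shifted \<delta> lam j = of_int (int (conj_part lam j) - int j) - of_int \<delta> / 2"

lemma initial_segment_eq:
  assumes "finite A" "\<And>i j::nat. i \<in> A \<Longrightarrow> j \<le> i \<Longrightarrow> j \<in> A"
  shows "A = {..<card A}"
proof -
  define m where "m = (LEAST i. i \<notin> A)"
  have "\<exists>i. i \<notin> A" using assms(1) by (metis ex_new_if_finite infinite_UNIV_nat)
  then have "m \<notin> A" unfolding m_def by (rule LeastI_ex)
  moreover have "i \<in> A" if "i < m" for i using that not_less_Least unfolding m_def by blast
  ultimately have "A = {..<m}" using assms(2) by (metis lessThan_iff linorder_not_less subsetI subset_antisym)
  then show ?thesis by simp
qed

lemma less_conj_part_iff:
  assumes "lam \<in> X_plus"
  shows "i < conj_part lam j \<longleftrightarrow> j < lam i"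
proof -
  have "{i. j < lam i} = {..<card {i. j < lam i}}"
  proof (rule initial_segment_eq)
    have "finite {i. lam i \<noteq> 0}" using assms by (simp add: X_plus_def)
    then show "finite {i. j < lam i}" by (rule finite_subset[rotated]) auto
    fix i k :: nat assume "i \<in> {i. j < lam i}" "k \<le> i"
    then show "k \<in> {i. j < lam i}" using assms by (auto simp: X_plus_def) (meson less_le_trans)
  qed
  then have "i \<in> {i. j < lam i} \<longleftrightarrow> i \<in> {..<card {i. j < lam i}}" by metis
  then show ?thesis by (simp add: conj_part_def)
qed

lemma conj_part_X_plus:
  assumes "lam \<in> X_plus"
  shows "conj_part lam \<in> X_plus"
proof -
  have "conj_part lam k \<le> conj_part lam j" if "j \<le> k" for j k
  proof (rule ccontr)
    assume "\<not> ?thesis"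
    then have "conj_part lam j < conj_part lam k" by simp
    then have "k < lam (conj_part lam j)" "\<not> j < lam (conj_part lam j)"
      using less_conj_part_iff[OF assms] by (blast, metis less_irrefl)
    then show False using that by simp
  qed
  moreover have "{j. conj_part lam j \<noteq> 0} \<subseteq> {..<lam 0}"
    using less_conj_part_iff[OF assms, of 0] by auto
  then have "finite {j. conj_part lam j \<noteq> 0}" using finite_subset by blast
  ultimately show ?thesis by (simp add: X_plus_def)
qed

lemma conj_part_conj_part:
  assumes "lam \<in> X_plus"
  shows "conj_part (conj_part lam) = lam"
proof
  fix i
  have "j < conj_part (conj_part lam) i \<longleftrightarrow> j < lam i" for j
    using less_conj_part_iff[OF conj_part_X_plus[OF assms]] less_conj_part_iff[OF assms] by simp
  then show "conj_part (conj_part lam) i = lam i" by (metis linorder_neqE_nat less_irrefl)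
qed

lemma mem_boxes_iff: "lam \<in> X_plus \<Longrightarrow> (i, j) \<in> boxes lam \<longleftrightarrow> i < conj_part lam j"
  by (simp add: boxes_def less_conj_part_iff)

lemma boxes_subset_iff:
  assumes "nu \<in> X_plus" "lam \<in> X_plus"
  shows "boxes nu \<subseteq> boxes lam \<longleftrightarrow> (\<forall>j. conj_part nu j \<le> conj_part lam j)"
proof
  assume sub: "boxes nu \<subseteq> boxes lam"
  show "\<forall>j. conj_part nu j \<le> conj_part lam j"
  proof (intro allI, rule ccontr)
    fix j assume "\<not> conj_part nu j \<le> conj_part lam j"
    then have "(conj_part lam j, j) \<in> boxes nu" using mem_boxes_iff[OF assms(1)] by simp
    then have "(conj_part lam j, j) \<in> boxes lam" using sub by blast
    then show False using mem_boxes_iff[OF assms(2)] by simp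
  qed
next
  assume le: "\<forall>j. conj_part nu j \<le> conj_part lam j"
  show "boxes nu \<subseteq> boxes lam"
  proof (rule subrelI)
    fix i j assume "(i, j) \<in> boxes nu"
    then have "i < conj_part lam j" using mem_boxes_iff[OF assms(1)] le less_le_trans by blast
    then show "(i, j) \<in> boxes lam" using mem_boxes_iff[OF assms(2)] by simp
  qed
qed

lemma boxes_inject: "boxes nu = boxes lam \<longleftrightarrow> nu = lam"
proof
  assume eq: "boxes nu = boxes lam"
  show "nu = lam"
  proof
    fix i
    have "j < nu i \<longleftrightarrow> j < lam i" for j using eq by (auto simp: boxes_def set_eq_iff)
    then show "nu i = lam i" by (metis linorder_neqE_nat less_irrefl)
  qed
qed simp

lemma finite_boxes:
  assumes "lam \<in> X_plus"
  shows "finite (boxes lam)"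
proof (rule finite_subset)
  show "boxes lam \<subseteq> {..<conj_part lam 0} \<times> {..<lam 0}"
  proof
    fix b assume b: "b \<in> boxes lam"
    obtain i j where ij: "b = (i, j)" by (cases b)
    have "lam i \<le> lam 0" "conj_part lam j \<le> conj_part lam 0"
      using assms conj_part_X_plus[OF assms] by (auto simp: X_plus_def)
    then show "b \<in> {..<conj_part lam 0} \<times> {..<lam 0}"
      using b mem_boxes_iff[OF assms, of i j] by (auto simp: ij boxes_def)
  qed
qed simp

lemma shifted_A_plus:
  assumes "lam \<in> X_plus"
  shows "shifted \<delta> lam \<in> A_plus"
proof (rule A_plusI)
  fix i j :: nat assume "i < j"
  moreover then have "conj_part lam j \<le> conj_part lam i"
    using conj_part_X_plus[OF assms] by (simp add: X_plus_def)
  ultimately show "shifted \<delta> lam j < shifted \<delta> lam i" by (simp add: shifted_def)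
qed

lemma conj_part_eventually_0:
  assumes "lam \<in> X_plus" "lam 0 \<le> j"
  shows "conj_part lam j = 0"
  using less_conj_part_iff[OF assms(1), of 0 j] assms(2) by simp

lemma shifted_neg:
  assumes "lam \<in> X_plus"
  shows "\<exists>j. shifted \<delta> lam j < t"
proof -
  define j where "j = max (lam 0) (Suc (nat \<lceil>- t - of_int \<delta> / 2\<rceil>))"
  have "conj_part lam j = 0" using assms by (intro conj_part_eventually_0) (simp_all add: j_def)
  moreover have "- t - of_int \<delta> / 2 < real j" unfolding j_def by linarith
  ultimately have "shifted \<delta> lam j < t" by (simp add: shifted_def)
  then show ?thesis by blast
qed

lemma shifted_finite_ge: "lam \<in> X_plus \<Longrightarrow> finite {j. shifted \<delta> lam j \<ge> t}"
  using finite_ge[OF shifted_A_plus] shifted_neg by blast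

lemma shifted_finite_gt: "lam \<in> X_plus \<Longrightarrow> finite {j. t < shifted \<delta> lam j}"
  using shifted_finite_ge[of lam t \<delta>] by (rule finite_subset[rotated]) auto

lemma shifted_le_iff:
  "(\<forall>j. shifted \<delta> nu j \<le> shifted \<delta> lam j) \<longleftrightarrow> (\<forall>j. conj_part nu j \<le> conj_part lam j)"
  by (simp add: shifted_def)

lemma shifted_finite_diff:
  assumes "lam \<in> X_plus" "nu \<in> X_plus"
  shows "finite {j. shifted \<delta> nu j \<noteq> shifted \<delta> lam j}"
proof (rule finite_subset)
  show "{j. shifted \<delta> nu j \<noteq> shifted \<delta> lam j} \<subseteq> {..<max (lam 0) (nu 0)}"
  proof
    fix j assume j: "j \<in> {j. shifted \<delta> nu j \<noteq> shifted \<delta> lam j}"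
    show "j \<in> {..<max (lam 0) (nu 0)}"
    proof (rule ccontr)
      assume "\<not> ?thesis"
      then have "conj_part lam j = 0" "conj_part nu j = 0"
        using conj_part_eventually_0 assms by auto
      then show False using j by (simp add: shifted_def)
    qed
  qed
qed simp

lemma seq_le_shifted_iff:
  assumes "nu \<in> X_plus" "lam \<in> X_plus"
  shows "seq_le (shifted \<delta> nu) (shifted \<delta> lam) \<longleftrightarrow> boxes nu \<subseteq> boxes lam"
proof -
  have "{j. shifted \<delta> lam j - shifted \<delta> nu j \<noteq> 0} = {j. shifted \<delta> lam j \<noteq> shifted \<delta> nu j}" by auto
  then show ?thesis
    using shifted_finite_diff[OF assms] boxes_subset_iff[OF assms] shifted_le_iff[of \<delta> nu lam]
    by (simp add: seq_le_def)
qed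

text \<open>Read a partition as beads dropped on a runner: each box is one step of a bead.\<close>

text \<open>Think of the entries of a shifted transpose as beads on a line. Adding a box to column \<open>j\<close> moves
  the bead \<open>j\<close> up by one, and the box has content \<open>c\<close> if the step starts at \<open>- c - \<delta>/2\<close>. So the boxes of
  content \<open>c\<close> in the skew diagram are the beads that cross this place.\<close>

lemma card_content:
  assumes nu: "nu \<in> X_plus" and lam: "lam \<in> X_plus" and sub: "boxes nu \<subseteq> boxes lam"
  shows "card {b\<in>boxes lam - boxes nu. content b = c} + card {j. - of_int c - of_int \<delta> / 2 < shifted \<delta> nu j} =
    card {j. - of_int c - of_int \<delta> / 2 < shifted \<delta> lam j}"
proof -
  have iff: "- of_int c - of_int \<delta> / 2 < shifted \<delta> mu j \<longleftrightarrow> - c < int (conj_part mu j) - int j" for mu j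
  proof -
    have "- of_int c - of_int \<delta> / 2 < shifted \<delta> mu j \<longleftrightarrow>
        of_int (- c) < (of_int (int (conj_part mu j) - int j) :: real)"
      unfolding shifted_def by simp
    then show ?thesis by (simp only: of_int_less_iff)
  qed
  let ?A = "\<lambda>mu. {j. - c < int (conj_part mu j) - int j}"
  \<comment> \<open>A box of given content is determined by its column.\<close>
  have "bij_betw snd {b\<in>boxes lam - boxes nu. content b = c} (?A lam - ?A nu)"
    unfolding bij_betw_def
  proof
    show "inj_on snd {b\<in>boxes lam - boxes nu. content b = c}"
      by (rule inj_onI) (auto simp: content_def)
    show "snd ` {b\<in>boxes lam - boxes nu. content b = c} = ?A lam - ?A nu"
    proof (intro set_eqI iffI)
      fix j assume "j \<in> snd ` {b\<in>boxes lam - boxes nu. content b = c}"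
      then obtain i where "i < conj_part lam j" "\<not> i < conj_part nu j" "int j - int i = c"
        using mem_boxes_iff[OF lam] mem_boxes_iff[OF nu] by (auto simp: content_def)
      then show "j \<in> ?A lam - ?A nu" by auto
    next
      fix j assume j: "j \<in> ?A lam - ?A nu"
      define i where "i = nat (int j - c)"
      have i: "int i = int j - c" using j by (auto simp: i_def)
      then have "(i, j) \<in> {b\<in>boxes lam - boxes nu. content b = c}"
        using j mem_boxes_iff[OF lam, of i j] mem_boxes_iff[OF nu, of i j] by (auto simp: content_def)
      then show "j \<in> snd ` {b\<in>boxes lam - boxes nu. content b = c}" by force
    qed
  qed
  then have "card {b\<in>boxes lam - boxes nu. content b = c} = card (?A lam - ?A nu)"
    by (rule bij_betw_same_card)
  moreover have A: "?A nu \<subseteq> ?A lam"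
  proof
    fix j assume j: "j \<in> ?A nu"
    have "conj_part nu j \<le> conj_part lam j" using sub boxes_subset_iff[OF nu lam] by blast
    then show "j \<in> ?A lam" using j by simp
  qed
  moreover have fin: "finite (?A lam)"
    using shifted_finite_gt[OF lam, of "- of_int c - of_int \<delta> / 2" \<delta>] unfolding iff .
  moreover have "card (?A lam - ?A nu) = card (?A lam) - card (?A nu)"
    by (rule card_Diff_subset[OF finite_subset[OF A fin] A])
  moreover have "card (?A nu) \<le> card (?A lam)" by (rule card_mono[OF fin A])
  ultimately show ?thesis unfolding iff by linarith
qed


section \<open>The bottom row of the middle boxes\<close>

text \<open>The last row \<open>r\<close> with middle boxes contains the box of content \<open>- m\<close>: if it contained only its
  right neighbour then, as some box of content \<open>- m\<close> exists higher up, skewness would force the left box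
  to be there as well. Hence the row has a single middle box if and only if \<open>\<lambda>\<close> ends on the diagonal
  \<open>- m\<close> strictly below the diagonal \<open>1 - m\<close>. Otherwise the box of content \<open>1 - m\<close> in row \<open>r\<close> is the
  last one of its column, and that column has the bead at \<open>0\<close>.\<close>

lemma bottom_row_single_iff:
  assumes nu: "nu \<in> X_plus" and lam: "lam \<in> X_plus"
    and D: "D = boxes lam - boxes nu" and M: "M = middle_boxes (2 * m) D" "M \<noteq> {}"
    and counts: "card {b\<in>D. content b = - m} = card {b\<in>D. content b = 1 - m}"
  shows "card {b\<in>M. fst b = Max (fst ` M)} = 1 \<longleftrightarrow> 0 \<notin> range (shifted (2 * m) lam)"
proof -
  have fin: "finite D" using finite_boxes[OF lam] by (simp add: D)
  have M_iff: "b \<in> M \<longleftrightarrow> b \<in> D \<and> (content b = - m \<or> content b = 1 - m)" for b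
    by (auto simp: M(1) middle_boxes_def)
  have finM: "finite (fst ` M)" using fin by (auto simp: M(1) middle_boxes_def)
  define r where "r = Max (fst ` M)"
  have r_max: "fst b \<le> r" if "b \<in> M" for b using that finM by (simp add: r_def)
  have "r \<in> fst ` M" unfolding r_def using finM M(2) by (intro Max_in) auto
  then obtain b0 where b0: "b0 \<in> M" "fst b0 = r" by auto
  have zero_iff: "0 \<in> range (shifted (2 * m) lam) \<longleftrightarrow> (\<exists>j. int (conj_part lam j) = m + int j)"
  proof -
    have "shifted (2 * m) lam j = 0 \<longleftrightarrow> int (conj_part lam j) = m + int j" for j
    proof -
      have "shifted (2 * m) lam j = of_int (int (conj_part lam j) - int j - m)" by (simp add: shifted_def)
      then show ?thesis by (simp only: of_int_eq_0_iff) auto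
    qed
    then show ?thesis by (auto simp: image_iff eq_commute[of 0])
  qed
  have lam_anti: "lam j \<le> lam i" if "i \<le> j" for i j using lam that by (simp add: X_plus_def)
  have nu_anti: "nu j \<le> nu i" if "i \<le> j" for i j using nu that by (simp add: X_plus_def)
  have D_iff: "(i, j) \<in> D \<longleftrightarrow> nu i \<le> j \<and> j < lam i" for i j by (auto simp: D boxes_def)
  obtain c0 where left: "(r, c0) \<in> D" "int c0 = int r - m"
  proof (cases "content b0 = - m")
    case True
    then show thesis using that[of "snd b0"] b0 M_iff by (cases b0) (auto simp: content_def)
  next
    case False
    then have b0c: "content b0 = 1 - m" "b0 \<in> D" using b0 M_iff by auto
    then have "b0 \<in> {b\<in>D. content b = 1 - m}" by simp
    then have "card {b\<in>D. content b = 1 - m} \<noteq> 0" using fin by (subst card_0_eq) (simp, blast)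
    then have "card {b\<in>D. content b = - m} \<noteq> 0" using counts by simp
    then obtain b where "b \<in> D" "content b = - m"
      by (metis (mono_tags, lifting) card.empty empty_Collect_eq)
    then obtain i j where ij: "(i, j) \<in> D" "int j - int i = - m" by (cases b) (auto simp: content_def)
    then have "i \<le> r" using r_max[of "(i, j)"] M_iff by (simp add: content_def)
    define c where "c = nat (int r - m)"
    have c: "int c = int r - m" using ij \<open>i \<le> r\<close> by (simp add: c_def)
    have "j \<le> c" using ij c \<open>i \<le> r\<close> by linarith
    have "snd b0 = Suc c" using b0c(1) b0(2) c by (simp add: content_def)
    then have "(r, Suc c) \<in> D" using b0c(2) b0(2) by (metis prod.collapse)
    then have "(r, c) \<in> D"
      using ij(1) nu_anti[OF \<open>i \<le> r\<close>] \<open>j \<le> c\<close> by (simp add: D_iff)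
    then show thesis using that c by blast
  qed
  have row: "{b\<in>M. fst b = r} = (if (r, Suc c0) \<in> D then {(r, c0), (r, Suc c0)} else {(r, c0)})"
  proof (rule set_eqI)
    fix b :: "nat \<times> nat"
    obtain i j where b: "b = (i, j)" by (cases b)
    have "int j - int r = - m \<longleftrightarrow> j = c0" "int j - int r = 1 - m \<longleftrightarrow> j = Suc c0"
      using left(2) by auto
    then show "b \<in> {b\<in>M. fst b = r} \<longleftrightarrow>
        b \<in> (if (r, Suc c0) \<in> D then {(r, c0), (r, Suc c0)} else {(r, c0)})"
      using left(1) by (auto simp: b M_iff content_def)
  qed
  then have single: "card {b\<in>M. fst b = r} = 1 \<longleftrightarrow> (r, Suc c0) \<notin> D" by simp
  have "(r, Suc c0) \<in> D \<longleftrightarrow> 0 \<in> range (shifted (2 * m) lam)"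
  proof
    assume right: "(r, Suc c0) \<in> D"
    have "\<not> Suc r < conj_part lam (Suc c0)"
    proof
      assume "Suc r < conj_part lam (Suc c0)"
      then have "Suc c0 < lam (Suc r)" using less_conj_part_iff[OF lam] by simp
      then have "(Suc r, Suc c0) \<in> D"
        using left(1) nu_anti[of r "Suc r"] by (simp add: D_iff)
      then have "(Suc r, Suc c0) \<in> M" using left(2) by (simp add: M_iff content_def)
      then show False using r_max by fastforce
    qed
    moreover have "r < conj_part lam (Suc c0)"
      using right less_conj_part_iff[OF lam] by (simp add: D_iff)
    ultimately have "conj_part lam (Suc c0) = Suc r" by simp
    then show "0 \<in> range (shifted (2 * m) lam)"
      unfolding zero_iff using left(2) by (intro exI[of _ "Suc c0"]) simp
  next
    assume "0 \<in> range (shifted (2 * m) lam)"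
    then obtain j where j: "int (conj_part lam j) = m + int j" unfolding zero_iff by blast
    show "(r, Suc c0) \<in> D"
    proof (rule ccontr)
      assume "(r, Suc c0) \<notin> D"
      then have below: "conj_part lam (Suc c0) \<le> r"
        using left(1) less_conj_part_iff[OF lam, of r "Suc c0"] by (simp add: D_iff)
      have above: "r < conj_part lam c0"
        using left(1) less_conj_part_iff[OF lam] by (simp add: D_iff)
      have anti: "conj_part lam l \<le> conj_part lam k" if "k \<le> l" for k l
        using conj_part_X_plus[OF lam] that by (simp add: X_plus_def)
      show False
      proof (cases "j \<le> c0")
        case True
        then show ?thesis using anti[OF True] above j left(2) by linarith
      next
        case False
        then have "Suc c0 \<le> j" by simp
        then show ?thesis using anti[of "Suc c0" j] below j left(2) by linarith
      qed
    qed
  qed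
  then show ?thesis using single by (simp add: r_def)
qed


section \<open>Balanced pairs are orbits\<close>

lemma shifted_greater_iff:
  "- 1 - (- of_int c - of_int \<delta> / 2) < shifted \<delta> mu j \<longleftrightarrow>
    - (- of_int c - of_int \<delta> / 2) \<le> shifted \<delta> mu j"
proof -
  let ?k = "int (conj_part mu j) - int j"
  have thr: "- 1 - (- of_int c - of_int \<delta> / 2) = of_int (c + \<delta> - 1) - of_int \<delta> / (2::real)"
    "- (- of_int c - of_int \<delta> / 2) = of_int (c + \<delta>) - of_int \<delta> / (2::real)"
    by (simp_all add: field_simps)
  have "- 1 - (- of_int c - of_int \<delta> / 2) < shifted \<delta> mu j \<longleftrightarrow> of_int (c + \<delta> - 1) < (of_int ?k :: real)"
    unfolding shifted_def thr by (simp only: add_less_cancel_right diff_conv_add_uminus)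
  also have "\<dots> \<longleftrightarrow> c + \<delta> \<le> ?k" by (simp only: of_int_less_iff) auto
  also have "\<dots> \<longleftrightarrow> of_int (c + \<delta>) \<le> (of_int ?k :: real)" by (simp only: of_int_le_iff)
  also have "\<dots> \<longleftrightarrow> - (- of_int c - of_int \<delta> / 2) \<le> shifted \<delta> mu j"
    unfolding shifted_def thr by (simp only: add_le_cancel_right diff_conv_add_uminus)
  finally show ?thesis .
qed

text \<open>The contents \<open>c\<close> and \<open>1 - \<delta> - c\<close> belong to the places \<open>e\<close> and \<open>- 1 - e\<close>. Being above
  \<open>- 1 - e\<close> is the same as being at least \<open>- e\<close>, since no entry lies strictly in between, and the latter
  count exceeds that above \<open>e\<close> by the number of entries of modulus at most \<open>e\<close>.\<close>

lemma content_counts_eq_iff: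
  assumes nu: "nu \<in> X_plus" and lam: "lam \<in> X_plus" and sub: "boxes nu \<subseteq> boxes lam"
    and e: "e = - of_int c - of_int \<delta> / 2" "0 \<le> e"
  shows "card {b\<in>boxes lam - boxes nu. content b = c} = card {b\<in>boxes lam - boxes nu. content b = 1 - \<delta> - c} \<longleftrightarrow>
    card {j. \<bar>shifted \<delta> nu j\<bar> \<le> e} = card {j. \<bar>shifted \<delta> lam j\<bar> \<le> e}"
proof -
  have thr: "- of_int (1 - \<delta> - c) - of_int \<delta> / 2 = - 1 - e" by (simp add: e field_simps)
  have split: "card {j. - 1 - e < shifted \<delta> mu j} =
      card {j. \<bar>shifted \<delta> mu j\<bar> \<le> e} + card {j. e < shifted \<delta> mu j}" if "mu \<in> X_plus" for mu
    using card_ge_neg[OF shifted_finite_ge[OF that] e(2)] shifted_greater_iff[of c \<delta> mu]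
    by (simp add: e(1))
  show ?thesis
    using card_content[OF nu lam sub, of c \<delta>] card_content[OF nu lam sub, of "1 - \<delta> - c" \<delta>]
      split[OF nu] split[OF lam] unfolding thr e(1)[symmetric] by linarith
qed

lemma content_counts_iff:
  assumes nu: "nu \<in> X_plus" and lam: "lam \<in> X_plus" and sub: "boxes nu \<subseteq> boxes lam"
  shows "(\<forall>c. card {b\<in>boxes lam - boxes nu. content b = c} =
      card {b\<in>boxes lam - boxes nu. content b = 1 - \<delta> - c}) \<longleftrightarrow>
    (\<forall>c::int. 0 \<le> - of_int c - of_int \<delta> / (2::real) \<longrightarrow>
      card {j. \<bar>shifted \<delta> nu j\<bar> \<le> - of_int c - of_int \<delta> / 2} =
      card {j. \<bar>shifted \<delta> lam j\<bar> \<le> - of_int c - of_int \<delta> / 2})" (is "?l \<longleftrightarrow> ?r")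
proof
  assume ?l
  then show ?r using content_counts_eq_iff[OF nu lam sub refl] by blast
next
  assume r: ?r
  show ?l
  proof
    fix c
    define d where "d = 1 - \<delta> - c"
    have c: "1 - \<delta> - d = c" by (simp add: d_def)
    \<comment> \<open>One of the two places of a symmetric pair is non-negative, unless both are \<open>- 1/2\<close>.\<close>
    have "0 \<le> - 2 * c - \<delta> \<or> 0 \<le> - 2 * d - \<delta> \<or> c = d" unfolding d_def by presburger
    then consider "0 \<le> - 2 * c - \<delta>" | "0 \<le> - 2 * d - \<delta>" | "c = d" by blast
    then show "card {b\<in>boxes lam - boxes nu. content b = c} =
      card {b\<in>boxes lam - boxes nu. content b = 1 - \<delta> - c}"
    proof cases
      case 1
      then have "(0::real) \<le> of_int (- 2 * c - \<delta>)" by (simp only: of_int_0_le_iff)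
      then have "(0::real) \<le> - of_int c - of_int \<delta> / 2" by simp
      then show ?thesis using content_counts_eq_iff[OF nu lam sub refl] r by blast
    next
      case 2
      then have "(0::real) \<le> of_int (- 2 * d - \<delta>)" by (simp only: of_int_0_le_iff)
      then have "(0::real) \<le> - of_int d - of_int \<delta> / 2" by simp
      then have "card {b\<in>boxes lam - boxes nu. content b = d} =
        card {b\<in>boxes lam - boxes nu. content b = 1 - \<delta> - d}"
        using content_counts_eq_iff[OF nu lam sub refl] r by blast
      then show ?thesis unfolding c by (simp add: d_def)
    next
      case 3
      then show ?thesis unfolding d_def by metis
    qed
  qed
qed

lemma abs_shifted: "\<exists>c::int. \<bar>shifted \<delta> mu j\<bar> = - of_int c - of_int \<delta> / 2"
proof -
  let ?k = "int (conj_part mu j) - int j"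
  have "shifted \<delta> mu j = - of_int (- ?k) - of_int \<delta> / 2" by (simp add: shifted_def)
  moreover have "- shifted \<delta> mu j = - of_int (?k - \<delta>) - of_int \<delta> / 2"
    by (simp add: shifted_def field_simps)
  ultimately show ?thesis by (metis abs_real_def)
qed

text \<open>The moduli lie in one coset of the integers, so the entries of modulus \<open>p\<close> are those of modulus
  at most \<open>p\<close> without those of modulus at most \<open>p - 1\<close>.\<close>

lemma card_shifted_modulus:
  assumes nu: "nu \<in> X_plus" and lam: "lam \<in> X_plus"
    and le: "\<And>c::int. 0 \<le> - of_int c - of_int \<delta> / (2::real) \<Longrightarrow>
      card {j. \<bar>shifted \<delta> nu j\<bar> \<le> - of_int c - of_int \<delta> / 2} =
      card {j. \<bar>shifted \<delta> lam j\<bar> \<le> - of_int c - of_int \<delta> / 2}"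
  shows "card {j. \<bar>shifted \<delta> nu j\<bar> = p} = card {j. \<bar>shifted \<delta> lam j\<bar> = p}"
proof (cases "0 \<le> p \<and> (\<exists>c::int. p = - of_int c - of_int \<delta> / 2)")
  case False
  have "\<bar>shifted \<delta> mu j\<bar> \<noteq> p" for mu j using False abs_shifted[of \<delta> mu j] by auto
  then show ?thesis by simp
next
  case True
  then obtain c :: int where p: "0 \<le> p" "p = - of_int c - of_int \<delta> / 2" by blast
  have card: "card {j. \<bar>shifted \<delta> mu j\<bar> = p} + card {j. \<bar>shifted \<delta> mu j\<bar> \<le> p - 1} =
      card {j. \<bar>shifted \<delta> mu j\<bar> \<le> p}" if mu: "mu \<in> X_plus" for mu
  proof -
    have iff: "\<bar>shifted \<delta> mu j\<bar> \<le> p \<longleftrightarrow> \<bar>shifted \<delta> mu j\<bar> = p \<or> \<bar>shifted \<delta> mu j\<bar> \<le> p - 1" for j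
    proof -
      obtain d :: int where d: "\<bar>shifted \<delta> mu j\<bar> = - of_int d - of_int \<delta> / 2" using abs_shifted by blast
      have "c \<le> d \<longleftrightarrow> d = c \<or> c + 1 \<le> d" by linarith
      then have "of_int c \<le> (of_int d :: real) \<longleftrightarrow> of_int d = (of_int c :: real) \<or> of_int (c + 1) \<le> (of_int d :: real)"
        by (simp only: of_int_le_iff of_int_eq_iff)
      then show ?thesis unfolding d p(2) by auto
    qed
    then have "{j. \<bar>shifted \<delta> mu j\<bar> \<le> p} = {j. \<bar>shifted \<delta> mu j\<bar> = p} \<union> {j. \<bar>shifted \<delta> mu j\<bar> \<le> p - 1}"
      by auto
    moreover have "finite {j. \<bar>shifted \<delta> mu j\<bar> \<le> p}"
      using shifted_finite_ge[OF mu, of "- p" \<delta>] by (rule finite_subset[rotated]) auto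
    ultimately show ?thesis by (simp add: card_Un_disjoint disjoint_iff)
  qed
  have "card {j. \<bar>shifted \<delta> nu j\<bar> \<le> p - 1} = card {j. \<bar>shifted \<delta> lam j\<bar> \<le> p - 1}"
  proof (cases "0 \<le> p - 1")
    case True
    have eq: "p - 1 = - of_int (c + 1) - of_int \<delta> / 2" by (simp add: p(2))
    show ?thesis using le[of "c + 1"] True unfolding eq by blast
  next
    case False
    then have "\<not> \<bar>t\<bar> \<le> p - 1" for t :: real using abs_ge_zero[of t] by linarith
    then show ?thesis by simp
  qed
  moreover have "card {j. \<bar>shifted \<delta> nu j\<bar> \<le> p} = card {j. \<bar>shifted \<delta> lam j\<bar> \<le> p}"
    using le[of c] p by simp
  ultimately show ?thesis using card[OF nu] card[OF lam] by linarith
qed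

text \<open>If \<open>\<delta>\<close> is odd, then no entry is an integer, there are no middle boxes, and the boxes of central
  content, which are paired among themselves, are the beads that become positive. If \<open>\<delta> = 2 m\<close>,
  there is no central content; the beads that become positive are the boxes of content \<open>- m\<close>, and the
  condition on the bottom row is imposed exactly if no bead of \<open>\<lambda>\<close> lies at \<open>0\<close>.\<close>

lemma parity_condition_iff:
  assumes nu: "nu \<in> X_plus" and lam: "lam \<in> X_plus" and sub: "boxes nu \<subseteq> boxes lam"
    and D: "D = boxes lam - boxes nu" and M: "M = middle_boxes \<delta> D"
    and counts: "\<And>c. card {b\<in>D. content b = c} = card {b\<in>D. content b = 1 - \<delta> - c}"
  shows "(\<forall>c. 2 * c = 1 - \<delta> \<longrightarrow> even (card {b\<in>D. content b = c})) \<and>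
      (M \<noteq> {} \<and> card {b\<in>M. fst b = Max (fst ` M)} = 1 \<longrightarrow> even (card {b\<in>D. 2 * content b = - \<delta>})) \<longleftrightarrow>
    (0 \<notin> range (shifted \<delta> lam) \<longrightarrow>
      even (card {j. 0 < shifted \<delta> nu j} + card {j. 0 < shifted \<delta> lam j}))"
proof (cases "even \<delta>")
  case True
  then obtain m where m: "\<delta> = 2 * m" by blast
  have no_centre: "2 * c \<noteq> 1 - \<delta>" for c using m by presburger
  have diag: "{b\<in>D. 2 * content b = - \<delta>} = {b\<in>D. content b = - m}" using m by auto
  have card: "card {b\<in>D. content b = - m} + card {j. 0 < shifted \<delta> nu j} = card {j. 0 < shifted \<delta> lam j}"
    using card_content[OF nu lam sub, of "- m" \<delta>] by (simp add: m D)
  have even: "even (card {b\<in>D. content b = - m}) \<longleftrightarrow>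
      even (card {j. 0 < shifted \<delta> nu j} + card {j. 0 < shifted \<delta> lam j})"
    unfolding card[symmetric] by (simp, blast)
  have "(M \<noteq> {} \<and> card {b\<in>M. fst b = Max (fst ` M)} = 1 \<longrightarrow> even (card {b\<in>D. content b = - m})) \<longleftrightarrow>
    (0 \<notin> range (shifted \<delta> lam) \<longrightarrow> even (card {b\<in>D. content b = - m}))"
  proof (cases "M = {}")
    case True
    then have "{b\<in>D. content b = - m} = {}" using m by (auto simp: M middle_boxes_def)
    then have "card {b\<in>D. content b = - m} = 0" by (simp only: card.empty)
    then show ?thesis by (simp only: even_zero simp_thms)
  next
    case False
    have "card {b\<in>D. content b = - m} = card {b\<in>D. content b = 1 - m}"
      using counts[of "- m"] by (simp add: m)
    then show ?thesis
      using bottom_row_single_iff[OF nu lam D _ False, of m] False by (simp add: M m)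
  qed
  then show ?thesis unfolding diag even using no_centre by simp
next
  case False
  then obtain m where m: "\<delta> = 2 * m + 1" by (auto elim: oddE)
  have "M = {}" unfolding M middle_boxes_def m by auto presburger+
  have centre: "2 * c = 1 - \<delta> \<longleftrightarrow> c = - m" for c using m by auto
  have pos: "- of_int (- m) - of_int \<delta> / 2 < shifted \<delta> mu j \<longleftrightarrow> 0 < shifted \<delta> mu j"
    and nz: "shifted \<delta> mu j \<noteq> 0" for mu j
  proof -
    let ?k = "int (conj_part mu j) - int j - m"
    have eq: "shifted \<delta> mu j = of_int ?k - 1 / 2" by (simp add: shifted_def m field_simps)
    show "- of_int (- m) - of_int \<delta> / 2 < shifted \<delta> mu j \<longleftrightarrow> 0 < shifted \<delta> mu j"
    proof -
      have "- of_int (- m) - of_int \<delta> / 2 < shifted \<delta> mu j \<longleftrightarrow> of_int 0 < (of_int ?k :: real)"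
      proof -
        have "- of_int (- m) - of_int \<delta> / 2 = of_int 0 - 1 / (2::real)"
          by (simp add: m field_simps)
        then show ?thesis unfolding eq by linarith
      qed
      also have "\<dots> \<longleftrightarrow> of_int 1 \<le> (of_int ?k :: real)" by (simp only: of_int_less_iff of_int_le_iff) auto
      also have "\<dots> \<longleftrightarrow> 0 < shifted \<delta> mu j"
      proof -
        have "of_int 1 \<le> (of_int ?k :: real) \<longleftrightarrow> of_int 1 < (of_int (2 * ?k) :: real)"
          by (simp only: of_int_less_iff of_int_le_iff) auto
        also have "(of_int (2 * ?k) :: real) = 2 * of_int ?k" by simp
        also have "of_int 1 < 2 * a \<longleftrightarrow> 0 < a - 1 / 2" for a :: real by auto
        finally show ?thesis unfolding eq .
      qed
      finally show ?thesis .
    qed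
    show "shifted \<delta> mu j \<noteq> 0"
    proof
      assume "shifted \<delta> mu j = 0"
      then have "of_int (2 * ?k) = (of_int 1 :: real)" unfolding eq by simp
      then have "2 * ?k = 1" by (simp only: of_int_eq_iff)
      then show False by presburger
    qed
  qed
  have card: "card {b\<in>D. content b = - m} + card {j. 0 < shifted \<delta> nu j} = card {j. 0 < shifted \<delta> lam j}"
    using card_content[OF nu lam sub, of "- m" \<delta>] unfolding pos by (simp add: D)
  have "even (card {b\<in>D. content b = - m}) \<longleftrightarrow>
      even (card {j. 0 < shifted \<delta> nu j} + card {j. 0 < shifted \<delta> lam j})"
    unfolding card[symmetric] by (simp, blast)
  moreover have "0 \<notin> range (shifted \<delta> lam)" using nz by (auto simp: image_iff)
  ultimately show ?thesis using \<open>M = {}\<close> centre by simp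
qed

lemma shifted_V_iff:
  assumes nu: "nu \<in> X_plus" and lam: "lam \<in> X_plus"
  shows "shifted \<delta> nu \<in> V (shifted \<delta> lam) \<longleftrightarrow>
    (\<forall>c::int. 0 \<le> - of_int c - of_int \<delta> / (2::real) \<longrightarrow>
      card {j. \<bar>shifted \<delta> nu j\<bar> \<le> - of_int c - of_int \<delta> / 2} =
      card {j. \<bar>shifted \<delta> lam j\<bar> \<le> - of_int c - of_int \<delta> / 2}) \<and>
    (0 \<notin> range (shifted \<delta> lam) \<longrightarrow>
      even (card {j. 0 < shifted \<delta> nu j} + card {j. 0 < shifted \<delta> lam j}))"
    (is "?l \<longleftrightarrow> ?moduli \<and> ?parity")
proof
  obtain n where n: "shifted \<delta> lam n < 0" using shifted_neg[OF lam] by blast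
  show "?moduli \<and> ?parity" if ?l
    using V_card_moduli[OF that, of "\<lambda>t. t \<le> _"] V_parity[OF that shifted_A_plus[OF lam] n] by blast
  assume *: "?moduli \<and> ?parity"
  show ?l
  proof (rule V_memI[OF shifted_A_plus[OF lam] shifted_A_plus[OF nu] n shifted_finite_diff[OF lam nu]])
    show "card {i. \<bar>shifted \<delta> nu i\<bar> = p} = card {i. \<bar>shifted \<delta> lam i\<bar> = p}" for p
      by (rule card_shifted_modulus[OF nu lam]) (use * in blast)
  qed (use * in blast)
qed

lemma balanced_sub_iff:
  assumes nu: "nu \<in> X_plus" and lam: "lam \<in> X_plus" and sub: "boxes nu \<subseteq> boxes lam"
  shows "balanced_sub \<delta> nu lam \<longleftrightarrow> shifted \<delta> nu \<in> V (shifted \<delta> lam)"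
proof -
  define D where "D = boxes lam - boxes nu"
  define M where "M = middle_boxes \<delta> D"
  have fin: "finite D" using finite_boxes[OF lam] by (simp add: D_def)
  let ?counts = "\<forall>c. card {b\<in>D. content b = c} = card {b\<in>D. content b = 1 - \<delta> - c}"
  let ?centre = "\<forall>c. 2 * c = 1 - \<delta> \<longrightarrow> even (card {b\<in>D. content b = c})"
  let ?bottom = "M \<noteq> {} \<and> card {b\<in>M. fst b = Max (fst ` M)} = 1 \<longrightarrow>
    even (card {b\<in>D. 2 * content b = - \<delta>})"
  have "balanced_sub \<delta> nu lam \<longleftrightarrow> pairable \<delta> D \<and> ?bottom"
    using nu lam sub by (simp add: balanced_sub_def Let_def D_def M_def)
  also have "pairable \<delta> D \<longleftrightarrow> ?counts \<and> ?centre"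
    unfolding pairable_def by (rule pairing_iff[OF fin])
  finally have "balanced_sub \<delta> nu lam \<longleftrightarrow> ?counts \<and> (?centre \<and> ?bottom)" by blast
  then show ?thesis
    unfolding shifted_V_iff[OF nu lam]
    using content_counts_iff[OF nu lam sub, of \<delta>] parity_condition_iff[OF nu lam sub D_def M_def]
    unfolding D_def[symmetric] by blast
qed

lemma X_plus_min:
  assumes "lam \<in> X_plus" "mu \<in> X_plus"
  shows "(\<lambda>i. min (lam i) (mu i)) \<in> X_plus"
proof -
  have "finite {i. min (lam i) (mu i) \<noteq> 0}"
    using assms(1) by (auto simp: X_plus_def elim: finite_subset[rotated])
  moreover have "min (lam j) (mu j) \<le> min (lam i) (mu i)" if "i \<le> j" for i j
    using assms that by (intro min.mono) (simp_all add: X_plus_def)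
  ultimately show ?thesis by (simp add: X_plus_def)
qed

lemma conj_part_min:
  assumes "lam \<in> X_plus" "mu \<in> X_plus"
  shows "conj_part (\<lambda>i. min (lam i) (mu i)) j = min (conj_part lam j) (conj_part mu j)"
proof -
  have "i < conj_part (\<lambda>i. min (lam i) (mu i)) j \<longleftrightarrow> i < min (conj_part lam j) (conj_part mu j)" for i
    using less_conj_part_iff[OF X_plus_min[OF assms]] less_conj_part_iff[OF assms(1)]
      less_conj_part_iff[OF assms(2)] by simp
  then show ?thesis by (metis linorder_neqE_nat less_irrefl)
qed

lemma card_down_closed_Int:
  fixes A B :: "nat set"
  assumes "finite A" "finite B"
    and "\<And>i j. i \<in> A \<Longrightarrow> j \<le> i \<Longrightarrow> j \<in> A" "\<And>i j. i \<in> B \<Longrightarrow> j \<le> i \<Longrightarrow> j \<in> B"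
  shows "card (A \<inter> B) = min (card A) (card B)"
proof -
  have "A = {..<card A}" using assms(1,3) by (rule initial_segment_eq)
  moreover have "B = {..<card B}" using assms(2,4) by (rule initial_segment_eq)
  moreover have "card ({..<a} \<inter> {..<b}) = min a b" for a b :: nat
  proof -
    have "{..<a} \<inter> {..<b} = {..<min a b}" by auto
    then show ?thesis by simp
  qed
  ultimately show ?thesis by metis
qed

text \<open>For the decreasing sequences at hand the sets of indices with entries above a threshold are
  initial segments, so the counts for the componentwise minimum are the minima of the counts. In the
  orbit, the counts at \<open>- q\<close> and \<open>q\<close> differ by the same number for both sequences; hence also for
  their minimum.\<close>

lemma V_meet:
  assumes lam: "lam \<in> X_plus" and mu: "mu \<in> X_plus" and V: "shifted \<delta> mu \<in> V (shifted \<delta> lam)"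
  shows "shifted \<delta> (\<lambda>i. min (lam i) (mu i)) \<in> V (shifted \<delta> lam)"
proof -
  let ?nu = "\<lambda>i. min (lam i) (mu i)"
  have nu: "?nu \<in> X_plus" using lam mu by (rule X_plus_min)
  have z: "shifted \<delta> ?nu j = min (shifted \<delta> lam j) (shifted \<delta> mu j)" for j
    unfolding shifted_def conj_part_min[OF lam mu] by (simp add: min_def)
  have down: "i \<in> {j. shifted \<delta> ka j \<ge> t} \<Longrightarrow> j \<le> i \<Longrightarrow> j \<in> {j. shifted \<delta> ka j \<ge> t}"
    "i \<in> {j. t < shifted \<delta> ka j} \<Longrightarrow> j \<le> i \<Longrightarrow> j \<in> {j. t < shifted \<delta> ka j}"
    if "ka \<in> X_plus" for ka i j t
    using A_plus_le_iff[OF shifted_A_plus[OF that, of \<delta>], of i j] by auto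
  have ge: "card {j. shifted \<delta> ?nu j \<ge> t} =
      min (card {j. shifted \<delta> lam j \<ge> t}) (card {j. shifted \<delta> mu j \<ge> t})" for t
    using card_down_closed_Int[OF shifted_finite_ge[OF lam] shifted_finite_ge[OF mu] down(1)[OF lam] down(1)[OF mu]]
    by (simp add: z Collect_conj_eq)
  have gt: "card {j. t < shifted \<delta> ?nu j} =
      min (card {j. t < shifted \<delta> lam j}) (card {j. t < shifted \<delta> mu j})" for t
    using card_down_closed_Int[OF shifted_finite_gt[OF lam] shifted_finite_gt[OF mu] down(2)[OF lam] down(2)[OF mu]]
    by (simp add: z Collect_conj_eq)
  have moduli: "card {j. \<bar>shifted \<delta> ?nu j\<bar> \<le> q} = card {j. \<bar>shifted \<delta> lam j\<bar> \<le> q}" if q: "0 \<le> q" for q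
  proof -
    have "card {j. \<bar>shifted \<delta> mu j\<bar> \<le> q} = card {j. \<bar>shifted \<delta> lam j\<bar> \<le> q}"
      by (rule V_card_moduli[OF V])
    then show ?thesis
      using card_ge_neg[OF shifted_finite_ge[OF lam] q, of \<delta>] card_ge_neg[OF shifted_finite_ge[OF mu] q, of \<delta>]
        card_ge_neg[OF shifted_finite_ge[OF nu] q, of \<delta>] ge[of "- q"] gt[of q] by linarith
  qed
  moreover have "even (card {j. 0 < shifted \<delta> ?nu j} + card {j. 0 < shifted \<delta> lam j})"
    if "0 \<notin> range (shifted \<delta> lam)"
  proof -
    obtain n where "shifted \<delta> lam n < 0" using shifted_neg[OF lam] by blast
    then have "even (card {j. 0 < shifted \<delta> mu j} + card {j. 0 < shifted \<delta> lam j})"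
      using V_parity[OF V shifted_A_plus[OF lam] _ that] by blast
    then show ?thesis unfolding gt by (auto simp: min_def)
  qed
  ultimately show ?thesis unfolding shifted_V_iff[OF nu lam] by blast
qed

text \<open>The orbit relation is an equivalence, so orbit membership of both partitions relative to their
  intersection gives one direction; the other one is closure under the minimum.\<close>

lemma balanced_iff:
  assumes lam: "lam \<in> X_plus" and mu: "mu \<in> X_plus"
  shows "balanced \<delta> mu lam \<longleftrightarrow> shifted \<delta> mu \<in> V (shifted \<delta> lam)"
proof -
  let ?nu = "\<lambda>i. min (mu i) (lam i)"
  have nu: "?nu \<in> X_plus" using mu lam by (rule X_plus_min)
  have sub: "boxes ?nu \<subseteq> boxes lam" "boxes ?nu \<subseteq> boxes mu" by (auto simp: boxes_def)
  have iff: "balanced \<delta> mu lam \<longleftrightarrow>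
      shifted \<delta> ?nu \<in> V (shifted \<delta> mu) \<and> shifted \<delta> ?nu \<in> V (shifted \<delta> lam)"
    unfolding balanced_def Let_def using balanced_sub_iff[OF nu] lam mu sub by simp
  show ?thesis
  proof
    assume "balanced \<delta> mu lam"
    then have "shifted \<delta> ?nu \<in> V (shifted \<delta> mu)" "shifted \<delta> ?nu \<in> V (shifted \<delta> lam)"
      using iff by auto
    then have "V (shifted \<delta> mu) = V (shifted \<delta> lam)" using V_eq by metis
    then show "shifted \<delta> mu \<in> V (shifted \<delta> lam)"
      using in_V_self[OF shifted_A_plus[OF mu, of \<delta>]] by simp
  next
    assume V: "shifted \<delta> mu \<in> V (shifted \<delta> lam)"
    then have "shifted \<delta> (\<lambda>i. min (lam i) (mu i)) \<in> V (shifted \<delta> lam)" by (rule V_meet[OF lam mu])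
    then have "shifted \<delta> ?nu \<in> V (shifted \<delta> lam)" by (simp add: min.commute)
    then show "balanced \<delta> mu lam" using iff V_eq[OF V] by simp
  qed
qed

lemma V_bal_eq:
  assumes "lam \<in> X_plus"
  shows "V_bal \<delta> lam = {mu\<in>X_plus. shifted \<delta> mu \<in> V (shifted \<delta> lam)}"
  using balanced_iff[OF assms] by (auto simp: V_bal_def)


section \<open>The graph of a block as the graph of an orbit\<close>

text \<open>An element of the orbit is, up to \<open>\<rho>\<^sub>\<delta>\<close>, a weakly decreasing sequence of integers that is
  eventually zero.\<close>

lemma shifted_surj:
  assumes lam: "lam \<in> X_plus" and x: "x \<in> V (shifted \<delta> lam)"
  shows "\<exists>mu\<in>X_plus. shifted \<delta> mu = x"
proof -
  have xA: "x \<in> A_plus" using x by (rule V_A_plus)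
  obtain p where p: "\<And>i. \<bar>x i\<bar> = \<bar>shifted \<delta> lam (p i)\<bar>" using V_moduli_bij[OF x] by metis
  have "\<exists>k::int. x j = of_int (k - int j) - of_int \<delta> / 2" for j
  proof -
    let ?k = "int (conj_part lam (p j)) - int (p j)"
    have "x j = shifted \<delta> lam (p j) \<or> x j = - shifted \<delta> lam (p j)" using p[of j] by (simp add: abs_eq_iff)
    moreover have "shifted \<delta> lam (p j) = of_int ((?k + int j) - int j) - of_int \<delta> / 2"
      by (simp add: shifted_def)
    moreover have "- shifted \<delta> lam (p j) = of_int ((\<delta> - ?k + int j) - int j) - of_int \<delta> / 2"
      by (simp add: shifted_def field_simps)
    ultimately show ?thesis by metis
  qed
  then obtain k :: "nat \<Rightarrow> int" where k: "\<And>j. x j = of_int (k j - int j) - of_int \<delta> / 2" by metis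
  have step: "k (Suc j) \<le> k j" for j
  proof -
    have "x (Suc j) < x j" using A_plus_less_iff[OF xA] by simp
    then have "of_int (k (Suc j) - int (Suc j)) < (of_int (k j - int j) :: real)" unfolding k by linarith
    then have "k (Suc j) - int (Suc j) < k j - int j" by (simp only: of_int_less_iff)
    then show ?thesis by simp
  qed
  have anti: "k j \<le> k i" if "i \<le> j" for i j using lift_Suc_antimono_le[of k, OF step that] .
  have fin_union: "finite ({j. x j \<noteq> shifted \<delta> lam j} \<union> {j. conj_part lam j \<noteq> 0})"
    using V_finite_diff[OF x] conj_part_X_plus[OF lam] by (simp add: X_plus_def)
  have zero: "k j = 0" if "x j = shifted \<delta> lam j" "conj_part lam j = 0" for j
  proof -
    have "of_int (k j - int j) = (of_int (0 - int j) :: real)"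
      using that k[of j] by (simp add: shifted_def)
    then show ?thesis by simp
  qed
  have fin: "finite {j. k j \<noteq> 0}"
    by (rule finite_subset[OF _ fin_union]) (use zero in blast)
  have nonneg: "0 \<le> k i" for i
  proof -
    obtain N where "\<forall>j\<in>{j. k j \<noteq> 0}. j < N" using fin finite_nat_set_iff_bounded by metis
    then have "k (max i N) = 0" by (metis (mono_tags, lifting) max.cobounded2 linorder_not_less mem_Collect_eq)
    then show ?thesis using anti[of i "max i N"] by simp
  qed
  define mu' where "mu' j = nat (k j)" for j
  have "mu' \<in> X_plus"
    unfolding X_plus_def mem_Collect_eq
  proof
    show "\<forall>i j. i \<le> j \<longrightarrow> mu' j \<le> mu' i" using anti by (auto simp: mu'_def intro: nat_mono)
    show "finite {i. mu' i \<noteq> 0}" using fin by (rule finite_subset[rotated]) (auto simp: mu'_def)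
  qed
  then have "conj_part mu' \<in> X_plus" "conj_part (conj_part mu') = mu'"
    using conj_part_X_plus conj_part_conj_part by auto
  moreover have "shifted \<delta> (conj_part mu') = x"
  proof
    fix j show "shifted \<delta> (conj_part mu') j = x j"
      unfolding shifted_def calculation(2) k using nonneg[of j] by (simp add: mu'_def)
  qed
  ultimately show ?thesis by blast
qed

lemma MBS_eq_hasse:
  assumes lam: "lam \<in> X_plus"
  shows "MBS \<delta> lam = hasse (V_bal \<delta> lam) (\<lambda>mu tau. boxes mu \<subseteq> boxes tau)"
proof -
  have same: "V_bal \<delta> tau = V_bal \<delta> lam" if "tau \<in> V_bal \<delta> lam" for tau
    using that V_eq unfolding V_bal_eq[OF lam] by (auto simp: V_bal_eq)
  have psub: "boxes a \<subset> boxes b \<longleftrightarrow> boxes a \<subseteq> boxes b \<and> a \<noteq> b" for a b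
    using boxes_inject[of a b] by blast
  show ?thesis
    unfolding MBS_def hasse_def maximal_balanced_sub_def psub using same by auto
qed

lemma MBS_iso_G_graph:
  assumes lam: "lam \<in> X_plus"
  shows "digraph_iso (with_proj (MBS \<delta> lam)) (with_proj (G_graph (shifted \<delta> lam)))"
  unfolding MBS_eq_hasse[OF lam] G_graph_eq_hasse
proof (rule digraph_iso_hasseI)
  have sub: "V_bal \<delta> lam \<subseteq> X_plus" by (auto simp: V_bal_def)
  have le: "boxes x \<subseteq> boxes y \<longleftrightarrow> seq_le (shifted \<delta> x) (shifted \<delta> y)"
    if "x \<in> V_bal \<delta> lam" "y \<in> V_bal \<delta> lam" for x y
    using seq_le_shifted_iff[of x y \<delta>] that sub by blast
  then show "boxes x \<subseteq> boxes y \<longleftrightarrow> seq_le (shifted \<delta> x) (shifted \<delta> y)"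
    if "x \<in> V_bal \<delta> lam" "y \<in> V_bal \<delta> lam" for x y using that .
  have "inj_on (shifted \<delta>) (V_bal \<delta> lam)"
  proof (rule inj_onI)
    fix x y assume xy: "x \<in> V_bal \<delta> lam" "y \<in> V_bal \<delta> lam" "shifted \<delta> x = shifted \<delta> y"
    then have "boxes x \<subseteq> boxes y" "boxes y \<subseteq> boxes x"
      using le[of x y] le[of y x] by (auto simp: seq_le_def)
    then show "x = y" using boxes_inject by blast
  qed
  moreover have "shifted \<delta> ` V_bal \<delta> lam = V (shifted \<delta> lam)"
    using shifted_surj[OF lam] unfolding V_bal_eq[OF lam] by blast
  ultimately show "bij_betw (shifted \<delta>) (V_bal \<delta> lam) (V (shifted \<delta> lam))"
    by (simp add: bij_betw_def)
qed

lemma MBS_iso_MBS: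
  assumes lam: "lam \<in> X_plus" and lam': "lam' \<in> X_plus"
  shows "digraph_iso (with_proj (MBS \<delta> lam)) (with_proj (MBS \<delta>' lam'))"
proof -
  obtain i j where neg: "shifted \<delta> lam i < 0" "shifted \<delta>' lam' j < 0"
    using shifted_neg lam lam' by metis
  note MBS_iso_G_graph[OF lam, of \<delta>]
  also have "digraph_iso (with_proj (G_graph (shifted \<delta> lam))) (with_proj (G_graph (shifted \<delta>' lam')))"
    using G_graph_iso[OF shifted_A_plus[OF lam] neg(1) shifted_A_plus[OF lam'] neg(2)] .
  also have "digraph_iso (with_proj (G_graph (shifted \<delta>' lam'))) (with_proj (MBS \<delta>' lam'))"
    using MBS_iso_G_graph[OF lam', of \<delta>'] unfolding MBS_eq_hasse[OF lam']
    by (rule digraph_iso_sym_hasse)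
  finally show ?thesis .
qed


section \<open>The orbit of the sequence of negated natural numbers\<close>

text \<open>The orbit of this sequence has distinct moduli \<open>0, 1, 2, \<dots>\<close>, and it meets each alcove in question
  in one point.\<close>

definition base :: rseq where
  "base i = - real i"

lemma base_A_plus: "base \<in> A_plus"
  by (rule A_plusI) (simp add: base_def)

lemma V_base_rank:
  assumes "x \<in> V base"
  obtains p where "bij p" "\<And>i. \<bar>x i\<bar> = real (p i)"
  using V_moduli_bij[OF assms] by (simp add: base_def) blast

lemma V_base_abs_eq_iff: "x \<in> V base \<Longrightarrow> \<bar>x i\<bar> = \<bar>x j\<bar> \<longleftrightarrow> i = j"
  by (rule V_base_rank, assumption) (auto simp: bij_def inj_eq)

lemma V_base_abs_surj: "x \<in> V base \<Longrightarrow> \<exists>i. \<bar>x i\<bar> = real k"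
  by (rule V_base_rank, assumption) (metis bij_pointE)

lemma V_base_zero: "x \<in> V base \<Longrightarrow> \<exists>i. x i = 0"
  using V_base_abs_surj[of x 0] by simp

lemma V_base_sum_nonzero:
  assumes "x \<in> V base" "i \<noteq> j"
  shows "x i + x j \<noteq> 0" "x i - x j \<noteq> 0"
  using V_base_abs_eq_iff[OF assms(1), of i j] assms(2) by (auto simp: abs_if split: if_splits)

lemma V_base_int:
  assumes "x \<in> V base"
  obtains f :: "nat \<Rightarrow> int" where "\<And>i. x i = of_int (f i)"
proof -
  obtain p where p: "\<And>i. \<bar>x i\<bar> = real (p i)" using V_base_rank[OF assms] by metis
  have "x i = of_int (if x i < 0 then - int (p i) else int (p i))" for i
    using p[of i] by (auto simp: abs_if split: if_splits)
  then show thesis by (rule that)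
qed

lemma V_base_gap: "x \<in> V base \<Longrightarrow> x i < x j \<Longrightarrow> x i + 1 \<le> x j"
proof -
  assume "x \<in> V base" and less: "x i < x j"
  then obtain f :: "nat \<Rightarrow> int" where f: "\<And>i. x i = of_int (f i)" using V_base_int by blast
  then have "f i + 1 \<le> f j" using less by simp
  then have "of_int (f i + 1) \<le> (of_int (f j) :: real)" by (simp only: of_int_le_iff)
  then show "x i + 1 \<le> x j" using f by simp
qed

lemma V_base_finite_ge:
  assumes "x \<in> V base"
  shows "finite {i. x i \<ge> t}"
proof -
  have "finite {i. base i \<ge> t}"
  proof (rule finite_subset)
    show "{i. base i \<ge> t} \<subseteq> {..nat \<lceil>- t\<rceil>}"
      by (auto simp: base_def) linarith
  qed simp
  then have "finite ({i. base i \<ge> t} \<union> {i. x i \<noteq> base i})"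
    using V_finite_diff[OF assms] by simp
  then show ?thesis by (rule finite_subset[rotated]) auto
qed

lemma refl_neg_in_V:
  assumes "x \<in> V v" "i \<noteq> j" "refl_neg i j x \<in> A_plus"
  shows "refl_neg i j x \<in> V v"
proof -
  have "refl_neg i j \<in> W_a"
    using assms(2) by (intro W_a.gen) (auto simp: reflections_def)
  then have "refl_neg i j x \<in> V x" using assms(3) by (auto simp: V_def)
  then show ?thesis using V_eq[OF assms(1)] by simp
qed

lemma refl_neg_swap: "refl_neg i j = refl_neg j i"
  by (auto simp: refl_neg_def fun_eq_iff)

lemma refl_neg_apply:
  "i \<noteq> j \<Longrightarrow> refl_neg i j x i = - x j" "i \<noteq> j \<Longrightarrow> refl_neg i j x j = - x i"
  "k \<noteq> i \<Longrightarrow> k \<noteq> j \<Longrightarrow> refl_neg i j x k = x k"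
  by (auto simp: refl_neg_def)

text \<open>Take the first index \<open>i\<close> at which \<open>x\<close> and \<open>y\<close> differ, and let \<open>k = x i\<close>. All larger entries of
  \<open>x\<close> are entries of \<open>y\<close>, which leaves room for \<open>k + 1\<close>; so \<open>- k - 1\<close> is an entry \<open>x j\<close>. The step
  raises \<open>x i\<close> and \<open>x j\<close> by one. That \<open>y j\<close> is large enough follows by counting: \<open>y\<close> has more
  entries above \<open>k\<close> than \<open>x\<close>, hence also more entries that are at least \<open>- k\<close>.\<close>

lemma ex_step_below:
  assumes x: "x \<in> V base" and y: "y \<in> V base" and le: "seq_le x y" and ne: "x \<noteq> y"
  shows "\<exists>i j. i \<noteq> j \<and> x i + x j = - 1 \<and> refl_neg i j x \<in> V base \<and> seq_le (refl_neg i j x) y"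
proof -
  have xA: "x \<in> A_plus" and yA: "y \<in> A_plus" using x y by (auto dest: V_A_plus)
  have le': "x l \<le> y l" for l using le by (simp add: seq_le_def)
  define i where "i = (LEAST l. x l \<noteq> y l)"
  have "\<exists>l. x l \<noteq> y l" using ne by auto
  then have i: "x i \<noteq> y i" unfolding i_def by (rule LeastI_ex)
  have before: "x l = y l" if "l < i" for l
    using that not_less_Least unfolding i_def by blast
  have xi: "x i < y i" using i le'[of i] by simp
  have x_int: "\<exists>f. \<forall>i. x i = of_int (f i)" and y_int: "\<exists>f. \<forall>i. y i = of_int (f i)"
    using V_base_int[OF x] V_base_int[OF y] by metis+
  have yi: "x i + 1 \<le> y i"
  proof -
    obtain f g where f: "\<forall>i. x i = of_int (f i)" and g: "\<forall>i. y i = of_int (g i)"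
      using x_int y_int by blast
    then have "f i + 1 \<le> g i" using xi by simp
    then have "of_int (f i + 1) \<le> (of_int (g i) :: real)" by (simp only: of_int_le_iff)
    then show ?thesis using f g by simp
  qed
  \<comment> \<open>Otherwise \<open>x\<close> and \<open>y\<close> have the same non-negative entries, and then the same negative ones.\<close>
  have nonneg: "0 \<le> x i"
  proof (rule ccontr)
    assume neg: "\<not> 0 \<le> x i"
    obtain m where m: "x m = 0" using V_base_zero[OF x] by blast
    have "x i < x m" using neg m by simp
    then have "m < i" using A_plus_less_iff[OF xA] by simp
    then have "y i < y m" "y m = 0" using A_plus_less_iff[OF yA, of i m] before[of m] m by auto
    then have yneg: "y i < 0" by simp
    obtain q where "\<bar>y i\<bar> = real q" using V_base_rank[OF y] by metis
    then obtain l where l: "\<bar>x l\<bar> = \<bar>y i\<bar>" using V_base_abs_surj[OF x, of q] by auto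
    show False
    proof (cases "l < i")
      case True
      then have "\<bar>y l\<bar> = \<bar>y i\<bar>" using l before by simp
      then show False using V_base_abs_eq_iff[OF y] True by simp
    next
      case False
      then have "x l \<le> x i" using A_plus_le_iff[OF xA] by simp
      then show False using l xi yneg by simp
    qed
  qed
  obtain k where k: "x i = real k"
    using V_base_rank[OF x] nonneg by (metis abs_of_nonneg)
  have no_succ: "x l \<noteq> real k + 1" for l
  proof
    assume l: "x l = real k + 1"
    then have "x i < x l" using k by simp
    then have "l < i" using A_plus_less_iff[OF xA] by simp
    then have "y i < y l" "y l = x l" using A_plus_less_iff[OF yA, of i l] before[of l] by auto
    then show False using yi l k by simp
  qed
  obtain j where "\<bar>x j\<bar> = real (Suc k)" using V_base_abs_surj[OF x] by blast
  then have j: "x j = - real k - 1" using no_succ[of j] by (auto simp: abs_if split: if_splits)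
  have "x j < x i" using k j by simp
  then have ij: "i < j" using A_plus_less_iff[OF xA] by simp
  let ?z = "refl_neg i j x"
  have zi: "?z i = real k + 1" and zj: "?z j = - real k"
    and zl: "\<And>l. l \<noteq> i \<Longrightarrow> l \<noteq> j \<Longrightarrow> ?z l = x l"
    using ij by (simp_all add: refl_neg_apply k j)
  have "?z \<in> A_plus"
  proof (rule A_plusI)
    fix a b :: nat assume ab: "a < b"
    then have xab: "x b < x a" using A_plus_less_iff[OF xA] by simp
    consider "a = i" "b = j" | "a = i" "b \<noteq> j" | "b = i" | "a = j" | "b = j" "a \<noteq> i" "a \<noteq> j"
      | "a \<noteq> i" "b \<noteq> i" "a \<noteq> j" "b \<noteq> j" by blast
    then show "?z b < ?z a"
    proof cases
      case 1
      then show ?thesis using zi zj by simp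
    next
      case 2
      then show ?thesis using zi zl[of b] ab xab k by simp
    next
      case 3
      then have "x i + 1 \<le> x a" using xab V_base_gap[OF x] by simp
      then have "real k + 1 < x a" using no_succ[of a] k by simp
      then show ?thesis using 3 zi zl[of a] ab ij by simp
    next
      case 4
      then show ?thesis using zj zl[of b] ab ij xab j by simp
    next
      case 5
      then have "x j + 1 \<le> x a" using xab V_base_gap[OF x] by simp
      moreover have "x a \<noteq> - real k" using V_base_abs_eq_iff[OF x, of a i] 5 k by auto
      ultimately show ?thesis using 5 zj zl[of a] j by simp
    next
      case 6
      then show ?thesis using zl xab by simp
    qed
  qed
  then have zV: "?z \<in> V base" using refl_neg_in_V[OF x] ij by simp
  have yj: "- real k \<le> y j"
  proof (rule ccontr)
    assume less: "\<not> - real k \<le> y j"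
    obtain f where f: "\<forall>i. y i = of_int (f i)" using y_int by blast
    then have "f j < - int k" using less by auto
    then have "f j + 1 \<le> - int k" by simp
    then have "of_int (f j + 1) \<le> (of_int (- int k) :: real)" by (simp only: of_int_le_iff)
    then have yj: "y j = x j" using f le'[of j] j by simp
    have same: "{l. z l \<ge> - real k} = {..<j}" if z: "z \<in> V base" "z j = - real k - 1" for z
    proof -
      have "z l \<ge> - real k \<longleftrightarrow> z j < z l" for l
        using z V_base_gap[OF z(1), of j l] by auto
      then show ?thesis using A_plus_less_iff[OF V_A_plus[OF z(1)]] by auto
    qed
    have "card {l. \<bar>x l\<bar> \<le> real k} = card {l. \<bar>y l\<bar> \<le> real k}"
      using V_card_moduli[OF x, of "\<lambda>t. t \<le> real k"] V_card_moduli[OF y, of "\<lambda>t. t \<le> real k"] by simp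
    then have eq: "card {l. x l > real k} = card {l. y l > real k}"
      using card_ge_neg[OF V_base_finite_ge[OF x, of "- real k"]]
        card_ge_neg[OF V_base_finite_ge[OF y, of "- real k"]] same[OF x j] same[OF y] yj j by simp
    have "{l. x l > real k} = {..<i}"
      using A_plus_less_iff[OF xA] k[symmetric] by auto
    moreover have "{..i} \<subseteq> {l. y l > real k}"
    proof
      fix l assume "l \<in> {..i}"
      then have "y i \<le> y l" using A_plus_le_iff[OF yA] by simp
      then show "l \<in> {l. y l > real k}" using xi k by simp
    qed
    then have "card {..i} \<le> card {l. y l > real k}"
    proof (rule card_mono[rotated])
      show "finite {l. y l > real k}"
        using V_base_finite_ge[OF y, of "real k"] by (rule finite_subset[rotated]) auto
    qed
    ultimately show False using eq by simp
  qed
  have "finite {l. y l - ?z l \<noteq> 0}"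
  proof (rule finite_subset)
    show "{l. y l - ?z l \<noteq> 0} \<subseteq> {i, j} \<union> {l. y l - x l \<noteq> 0}" using zl by auto
    show "finite ({i, j} \<union> {l. y l - x l \<noteq> 0})" using le by (simp add: seq_le_def)
  qed
  moreover have "?z l \<le> y l" for l
    using le'[of l] zl[of l] zi zj yi yj k by (cases "l = i"; cases "l = j") auto
  ultimately have "seq_le ?z y" by (simp add: seq_le_def)
  then show ?thesis using ij zV k j by (intro exI[of _ i] exI[of _ j]) auto
qed

lemma step_seq_less:
  assumes "i \<noteq> j" "x i + x j = - 1"
  shows "seq_le x (refl_neg i j x)" "x \<noteq> refl_neg i j x"
proof -
  let ?y = "refl_neg i j x"
  have "{l. ?y l - x l \<noteq> 0} \<subseteq> {i, j}" using refl_neg_apply(3)[of _ i j x] by auto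
  then have "finite {l. ?y l - x l \<noteq> 0}" using finite_subset by blast
  moreover have "0 \<le> ?y l - x l" for l
    using assms refl_neg_apply(1,2)[of i j x] refl_neg_apply(3)[of l i j x] by (cases "l = i"; cases "l = j") auto
  ultimately show "seq_le x ?y" by (simp add: seq_le_def)
  show "x \<noteq> ?y"
  proof
    assume "x = ?y"
    then have "x i = - x j" using refl_neg_apply(1)[OF assms(1), of x] by simp
    then show False using assms(2) by simp
  qed
qed

text \<open>Nothing fits in between: \<open>z\<close> could only raise one of the two entries, which would change the
  set of moduli.\<close>

lemma step_is_cover:
  assumes x: "x \<in> V base" and z: "z \<in> V base" and ij: "i \<noteq> j" and sum: "x i + x j = - 1"
    and xz: "seq_le x z" and zy: "seq_le z (refl_neg i j x)"
  shows "z = x \<or> z = refl_neg i j x"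
proof -
  have le: "x l \<le> z l" "z l \<le> refl_neg i j x l" for l using xz zy by (simp_all add: seq_le_def)
  have out: "z l = x l" if "l \<noteq> i" "l \<noteq> j" for l
    using le[of l] refl_neg_apply(3)[OF that, of x] by simp
  have zi: "x i \<le> z i" "z i \<le> x i + 1" and zj: "x j \<le> z j" "z j \<le> x j + 1"
    using le[of i] le[of j] refl_neg_apply(1,2)[OF ij, of x] sum by auto
  have abs: "\<bar>z l\<bar> = \<bar>x i\<bar> \<or> \<bar>z l\<bar> = \<bar>x j\<bar>" if l: "l = i \<or> l = j" for l
  proof -
    obtain q where "\<bar>z l\<bar> = real q" using V_base_rank[OF z] by metis
    then obtain m where m: "\<bar>x m\<bar> = \<bar>z l\<bar>" using V_base_abs_surj[OF x, of q] by auto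
    have "m = i \<or> m = j"
    proof (rule ccontr)
      assume neither: "\<not> (m = i \<or> m = j)"
      then have "\<bar>z m\<bar> = \<bar>z l\<bar>" using out m by simp
      then show False using V_base_abs_eq_iff[OF z] l neither by auto
    qed
    then show ?thesis using m by auto
  qed
  obtain f where f: "\<And>l. x l = of_int (f l)" using V_base_int[OF x] by blast
  obtain g where g: "\<And>l. z l = of_int (g l)" using V_base_int[OF z] by blast
  have fg: "g i = f i \<or> g i = f i + 1" "g j = f j \<or> g j = f j + 1" "f i + f j = - 1"
    using zi zj sum unfolding f g by linarith+
  have abs': "\<bar>g i\<bar> = \<bar>f i\<bar> \<or> \<bar>g i\<bar> = \<bar>f j\<bar>" "\<bar>g j\<bar> = \<bar>f i\<bar> \<or> \<bar>g j\<bar> = \<bar>f j\<bar>" "\<bar>g i\<bar> \<noteq> \<bar>g j\<bar>"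
    using abs[of i] abs[of j] V_base_abs_eq_iff[OF z, of i j] ij
    by (simp_all add: f g flip: of_int_abs)
  have "(g i = f i \<and> g j = f j) \<or> (g i = - f j \<and> g j = - f i)"
    using fg abs' by (smt (verit))
  then show ?thesis
  proof
    assume *: "g i = f i \<and> g j = f j"
    have "z = x"
    proof
      fix l show "z l = x l" using * f g out[of l] by (cases "l = i"; cases "l = j") auto
    qed
    then show ?thesis ..
  next
    assume *: "g i = - f j \<and> g j = - f i"
    have "z = refl_neg i j x"
    proof
      fix l show "z l = refl_neg i j x l"
        using * f g out[of l] refl_neg_apply(1,2)[OF ij, of x] refl_neg_apply(3)[of l i j x]
        by (cases "l = i"; cases "l = j") auto
    qed
    then show ?thesis ..
  qed
qed

lemma G_graph_base_arc_iff:
  assumes x: "x \<in> V base" and y: "y \<in> V base"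
  shows "(x, y) \<in> parcs (G_graph base) \<longleftrightarrow> (\<exists>i j. i \<noteq> j \<and> x i + x j = - 1 \<and> y = refl_neg i j x)"
proof
  assume arc: "(x, y) \<in> parcs (G_graph base)"
  then obtain i j where ij: "i \<noteq> j" "x i + x j = - 1"
    and z: "refl_neg i j x \<in> V base" "seq_le (refl_neg i j x) y"
    using ex_step_below[OF x y] by (auto simp: G_graph_def seq_less_def)
  have "refl_neg i j x = y"
  proof (rule ccontr)
    assume "refl_neg i j x \<noteq> y"
    then have "seq_less x (refl_neg i j x)" "seq_less (refl_neg i j x) y"
      using step_seq_less[of i j x] ij z by (auto simp: seq_less_def)
    then show False using arc z by (auto simp: G_graph_def)
  qed
  then show "\<exists>i j. i \<noteq> j \<and> x i + x j = - 1 \<and> y = refl_neg i j x" using ij by blast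
next
  assume "\<exists>i j. i \<noteq> j \<and> x i + x j = - 1 \<and> y = refl_neg i j x"
  then obtain i j where ij: "i \<noteq> j" "x i + x j = - 1" and y': "y = refl_neg i j x" by blast
  have "\<not> (\<exists>z\<in>V base. seq_less x z \<and> seq_less z y)"
    using step_is_cover[OF x _ ij] unfolding seq_less_def y' by blast
  then show "(x, y) \<in> parcs (G_graph base)"
    using x y step_seq_less[of i j x] ij by (auto simp: G_graph_def seq_less_def y')
qed


section \<open>Chambers as sign vectors\<close>

text \<open>Chambers are described by the signs of all sums and differences of two entries. In this form the
  action of the group is plain, and so is convexity.\<close>

definition same_side :: "rseq \<Rightarrow> rseq \<Rightarrow> bool" where
  "same_side x u \<longleftrightarrow>
     (\<forall>i j. i \<noteq> j \<longrightarrow> sgn (u i - u j) = sgn (x i - x j) \<and> sgn (u i + u j) = sgn (x i + x j))"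

definition chamber :: "rseq \<Rightarrow> rseq set" where
  "chamber x = {u. same_side x u}"

definition closed_chamber :: "rseq \<Rightarrow> rseq set" where
  "closed_chamber x =
     {u. \<forall>i j. i \<noteq> j \<longrightarrow> 0 \<le> sgn (x i - x j) * (u i - u j) \<and> 0 \<le> sgn (x i + x j) * (u i + u j)}"

definition generic :: "rseq \<Rightarrow> bool" where
  "generic x \<longleftrightarrow> (\<forall>i j. i \<noteq> j \<longrightarrow> x i - x j \<noteq> 0 \<and> x i + x j \<noteq> 0)"

lemma mem_chamber_self: "x \<in> chamber x"
  by (simp add: chamber_def same_side_def)

lemma V_base_generic: "x \<in> V base \<Longrightarrow> generic x"
  using V_base_sum_nonzero unfolding generic_def by blast

lemma generic_iff: "generic x \<longleftrightarrow> x \<in> - \<Union> hyperplanes"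
proof -
  have pos: "refl_pos i j x = x \<longleftrightarrow> x i - x j = 0" if "i \<noteq> j" for i j
    using that by (auto simp: refl_pos_def fun_eq_iff)
  have neg: "refl_neg i j x = x \<longleftrightarrow> x i + x j = 0" if "i \<noteq> j" for i j
    using that by (auto simp: refl_neg_def fun_eq_iff)
  have "x \<in> \<Union> hyperplanes \<longleftrightarrow> (\<exists>s\<in>reflections. s x = x)"
    by (auto simp: hyperplanes_def)
  also have "\<dots> \<longleftrightarrow> (\<exists>i j. i \<noteq> j \<and> (refl_pos i j x = x \<or> refl_neg i j x = x))"
    by (auto simp: reflections_def)
  also have "\<dots> \<longleftrightarrow> \<not> generic x"
    using pos neg unfolding generic_def by blast
  finally show ?thesis by simp
qed

lemma chamber_generic:
  assumes "generic x" "u \<in> chamber x"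
  shows "generic u"
  using assms unfolding generic_def chamber_def same_side_def mem_Collect_eq by (metis sgn_0_0)

lemma chamber_A_plus:
  assumes "x \<in> A_plus"
  shows "chamber x \<subseteq> A_plus"
proof
  fix u assume u: "u \<in> chamber x"
  show "u \<in> A_plus"
  proof (rule A_plusI)
    fix i j :: nat assume "i < j"
    then have "x j < x i" "sgn (u i - u j) = sgn (x i - x j)"
      using assms u by (auto simp: A_plus_less_iff chamber_def same_side_def)
    then show "u j < u i" by (simp add: sgn_1_pos)
  qed
qed

lemma signed_perm_same_side:
  assumes "inj p" and u: "same_side x u"
  shows "same_side (signed_perm p F x) (signed_perm p F u)"
  unfolding same_side_def
proof (intro allI impI)
  fix i j :: nat assume "i \<noteq> j"
  then have "p i \<noteq> p j" using assms(1) by (simp add: inj_eq)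
  then have s: "sgn (u (p i) - u (p j)) = sgn (x (p i) - x (p j))"
    "sgn (u (p i) + u (p j)) = sgn (x (p i) + x (p j))"
    using u by (simp_all add: same_side_def)
  have neg: "- a - b = - (a + b)" "- a + b = - (a - b)" "- a - - b = - (a - b)" "a - - b = a + b"
    for a b :: real by simp_all
  show "sgn (signed_perm p F u i - signed_perm p F u j) = sgn (signed_perm p F x i - signed_perm p F x j) \<and>
    sgn (signed_perm p F u i + signed_perm p F u j) = sgn (signed_perm p F x i + signed_perm p F x j)"
    by (cases "i \<in> F"; cases "j \<in> F") (simp_all add: signed_perm_def neg s sgn_minus del: minus_diff_eq minus_add_distrib uminus_add_conv_diff)
qed

lemma signed_perm_closed_chamber:
  assumes "inj p" and u: "u \<in> closed_chamber x"
  shows "signed_perm p F u \<in> closed_chamber (signed_perm p F x)"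
  unfolding closed_chamber_def mem_Collect_eq
proof (intro allI impI)
  fix i j :: nat assume "i \<noteq> j"
  then have "p i \<noteq> p j" using assms(1) by (simp add: inj_eq)
  then have s: "0 \<le> sgn (x (p i) - x (p j)) * (u (p i) - u (p j))"
    "0 \<le> sgn (x (p i) + x (p j)) * (u (p i) + u (p j))"
    using u by (simp_all add: closed_chamber_def)
  have neg: "- a - b = - (a + b)" "- a + b = - (a - b)" "- a - - b = - (a - b)" "a - - b = a + b"
    for a b :: real by simp_all
  show "0 \<le> sgn (signed_perm p F x i - signed_perm p F x j) * (signed_perm p F u i - signed_perm p F u j) \<and>
    0 \<le> sgn (signed_perm p F x i + signed_perm p F x j) * (signed_perm p F u i + signed_perm p F u j)"
    using s by (cases "i \<in> F"; cases "j \<in> F") (simp_all add: signed_perm_def neg sgn_minus del: minus_diff_eq minus_add_distrib uminus_add_conv_diff)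
qed

lemma W_a_same_side:
  assumes "w \<in> W_a" "same_side x u"
  shows "same_side (w x) (w u)"
proof -
  obtain p F N where "w = signed_perm p F" "p permutes {..<N::nat}"
    using assms(1) by (blast elim: W_a_cases)
  then show ?thesis using signed_perm_same_side[OF permutes_inj assms(2)] by blast
qed

lemma W_a_closed_chamber:
  assumes "w \<in> W_a" "u \<in> closed_chamber x"
  shows "w u \<in> closed_chamber (w x)"
proof -
  obtain p F N where "w = signed_perm p F" "p permutes {..<N::nat}"
    using assms(1) by (blast elim: W_a_cases)
  then show ?thesis using signed_perm_closed_chamber[OF permutes_inj assms(2)] by blast
qed

lemma W_a_image_chamber:
  assumes w: "w \<in> W_a"
  shows "w ` chamber x = chamber (w x)"
proof
  show "w ` chamber x \<subseteq> chamber (w x)"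
    using W_a_same_side[OF w] by (auto simp: chamber_def)
  show "chamber (w x) \<subseteq> w ` chamber x"
  proof
    fix u assume u: "u \<in> chamber (w x)"
    have bij: "bij w" using w by (rule W_a_bij)
    have "same_side (inv w (w x)) (inv w u)"
      using W_a_same_side[OF W_a.inverse[OF w]] u by (simp add: chamber_def)
    then have "inv w u \<in> chamber x" using bij by (simp add: chamber_def bij_is_inj)
    moreover have "u = w (inv w u)" using bij by (simp add: bij_is_surj surj_f_inv_f)
    ultimately show "u \<in> w ` chamber x" by blast
  qed
qed

text \<open>The conditions that define \<^const>\<open>A0\<close> say that all differences \<open>u i - u j\<close> with \<open>i < j\<close> are
  positive and all sums \<open>u i + u j\<close> negative.\<close>

lemma A0_eq_chamber: "A0 = chamber base"
proof -
  have base: "sgn (base i - base j) = (if i < j then 1 else - 1)" "sgn (base i + base j) = - 1"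
    if "i \<noteq> j" for i j
    using that by (auto simp: base_def sgn_1_pos sgn_1_neg sgn_if)
  have chamber_iff: "u \<in> chamber base \<longleftrightarrow> (\<forall>i j. i < j \<longrightarrow> u j < u i \<and> u i + u j < 0)" for u
  proof
    assume u: "u \<in> chamber base"
    show "\<forall>i j. i < j \<longrightarrow> u j < u i \<and> u i + u j < 0"
    proof (intro allI impI)
      fix i j :: nat assume ij: "i < j"
      then have "sgn (u i - u j) = 1" "sgn (u i + u j) = - 1"
        using u base[of i j] by (simp_all add: chamber_def same_side_def)
      then show "u j < u i \<and> u i + u j < 0" by (simp add: sgn_1_pos sgn_1_neg)
    qed
  next
    assume *: "\<forall>i j. i < j \<longrightarrow> u j < u i \<and> u i + u j < 0"
    show "u \<in> chamber base"
      unfolding chamber_def same_side_def mem_Collect_eq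
    proof (intro allI impI)
      fix i j :: nat assume ij: "i \<noteq> j"
      then consider "i < j" | "j < i" by linarith
      then show "sgn (u i - u j) = sgn (base i - base j) \<and> sgn (u i + u j) = sgn (base i + base j)"
      proof cases
        case 1
        then have "u j < u i" "u i + u j < 0" using * by auto
        then show ?thesis unfolding base[OF ij] using 1 by simp
      next
        case 2
        then have "u i < u j" "u j + u i < 0" using * by auto
        then show ?thesis unfolding base[OF ij] using 2 by simp
      qed
    qed
  qed
  show ?thesis
  proof (intro set_eqI iffI)
    fix u assume u: "u \<in> A0"
    then have A: "u \<in> A_plus" and u01: "\<bar>u 0\<bar> < \<bar>u 1\<bar>" "u 1 < 0" by (auto simp: A0_def)
    show "u \<in> chamber base"
      unfolding chamber_iff
    proof (intro allI impI conjI)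
      fix i j :: nat assume ij: "i < j"
      then show "u j < u i" using A_plus_less_iff[OF A] by simp
      have "u j \<le> u 1" "i = 0 \<or> u i \<le> u 1" using A_plus_le_iff[OF A] ij by auto
      then show "u i + u j < 0" using u01 by auto
    qed
  next
    fix u assume "u \<in> chamber base"
    then have *: "\<forall>i j. i < j \<longrightarrow> u j < u i \<and> u i + u j < 0" by (simp only: chamber_iff)
    then have "u 1 < u 0" "u 0 + u 1 < 0" by auto
    moreover have "u \<in> A_plus" using * by (auto intro: A_plusI)
    ultimately show "u \<in> A0" by (auto simp: A0_def)
  qed
qed


section \<open>Connectedness and the components of the complement\<close>

text \<open>The function space with its product topology is not a normed space, so connectedness of convex
  sets is derived from the continuity of the segments in each coordinate.\<close>

lemma connected_if_segments:
  fixes T :: "rseq set"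
  assumes "\<And>a b t. a \<in> T \<Longrightarrow> b \<in> T \<Longrightarrow> 0 \<le> t \<Longrightarrow> t \<le> 1 \<Longrightarrow> (\<lambda>i. (1 - t) * a i + t * b i) \<in> T"
  shows "topological_space_class.connected T"
  unfolding connected_iff_connected_component
proof (intro ballI)
  fix a b assume ab: "a \<in> T" "b \<in> T"
  define f where "f t = (\<lambda>i. (1 - t) * a i + t * b i)" for t :: real
  have "continuous_on {0..1} f"
    unfolding f_def by (intro continuous_intros)
  then have "topological_space_class.connected (f ` {0..1})"
    by (intro connected_continuous_image) auto
  moreover have "f ` {0..1} \<subseteq> T" using assms[OF ab] by (auto simp: f_def)
  moreover have "f 0 = a" "f 1 = b" by (auto simp: f_def)
  then have "a \<in> f ` {0..1}" "b \<in> f ` {0..1}" by force+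
  ultimately show "connected_component T a b"
    unfolding connected_component_def by blast
qed

lemma sgn_convex_combination:
  fixes a b t :: real
  assumes "sgn a = s" "sgn b = s" "0 \<le> t" "t \<le> 1"
  shows "sgn ((1 - t) * a + t * b) = s"
proof -
  have pos: "0 < (1 - t) * c + t * d" if "0 < c" "0 < d" for c d :: real
    using assms(3,4) that by (cases "t = 0") (auto intro!: add_nonneg_pos)
  consider "s = 0" | "s = 1" | "s = - 1" using assms(1) by (auto simp: sgn_if split: if_splits)
  then show ?thesis
  proof cases
    case 1
    then show ?thesis using assms by (simp add: sgn_0_0)
  next
    case 2
    then have ab: "0 < a" "0 < b" using assms by (auto simp: sgn_1_pos)
    then have "0 < (1 - t) * a + t * b" by (rule pos)
    then show ?thesis using 2 by (simp add: sgn_1_pos)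
  next
    case 3
    then have ab: "0 < - a" "0 < - b" using assms by (auto simp: sgn_1_neg)
    then have "0 < (1 - t) * (- a) + t * (- b)" by (rule pos)
    moreover have "(1 - t) * (- a) + t * (- b) = - ((1 - t) * a + t * b)" by (simp add: algebra_simps)
    ultimately have "(1 - t) * a + t * b < 0" by linarith
    then show ?thesis using 3 by (simp add: sgn_1_neg)
  qed
qed

lemma connected_chamber: "topological_space_class.connected (chamber x)"
proof (rule connected_if_segments)
  fix a b :: rseq and t :: real
  assume ab: "a \<in> chamber x" "b \<in> chamber x" and t: "0 \<le> t" "t \<le> 1"
  let ?c = "\<lambda>i. (1 - t) * a i + t * b i"
  show "?c \<in> chamber x"
    unfolding chamber_def same_side_def mem_Collect_eq
  proof (intro allI impI conjI)
    fix i j :: nat assume ij: "i \<noteq> j"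
    have "?c i - ?c j = (1 - t) * (a i - a j) + t * (b i - b j)" by (simp add: algebra_simps)
    then show "sgn (?c i - ?c j) = sgn (x i - x j)"
      using sgn_convex_combination[OF _ _ t] ab ij by (simp add: chamber_def same_side_def)
    have "?c i + ?c j = (1 - t) * (a i + a j) + t * (b i + b j)" by (simp add: algebra_simps)
    then show "sgn (?c i + ?c j) = sgn (x i + x j)"
      using sgn_convex_combination[OF _ _ t] ab ij by (simp add: chamber_def same_side_def)
  qed
qed

lemma continuous_on_coord: "continuous_on T (\<lambda>u::rseq. u i)"
  by (rule continuous_on_subset[OF continuous_on_product_coordinates]) simp

lemma sgn_const_on_connected:
  fixes f :: "rseq \<Rightarrow> real"
  assumes "topological_space_class.connected T" "continuous_on T f" and nz: "\<And>u. u \<in> T \<Longrightarrow> f u \<noteq> 0"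
    and "a \<in> T" "b \<in> T"
  shows "sgn (f a) = sgn (f b)"
proof (rule ccontr)
  assume ne: "sgn (f a) \<noteq> sgn (f b)"
  have conn: "topological_space_class.connected (f ` T)" using assms by (intro connected_continuous_image)
  have "f a < 0 \<and> 0 < f b \<or> f b < 0 \<and> 0 < f a"
    using ne nz[OF assms(4)] nz[OF assms(5)] by (auto simp: sgn_if split: if_splits)
  then have "0 \<in> f ` T"
    using connectedD_interval[OF conn, of "f a" "f b" 0] connectedD_interval[OF conn, of "f b" "f a" 0]
      assms(4,5) by auto
  then show False using nz by auto
qed

text \<open>A chamber is convex, hence connected; and on a connected set that avoids the hyperplanes, the
  signs of the sums and differences cannot change.\<close>

lemma chamber_in_alcoves:
  assumes "generic x"
  shows "chamber x \<in> alcoves"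
  unfolding alcoves_def in_components_maximal
proof (intro conjI allI impI)
  show "chamber x \<noteq> {}" using mem_chamber_self by blast
  show "chamber x \<subseteq> - \<Union> hyperplanes"
    using chamber_generic[OF assms] generic_iff by blast
  show "topological_space_class.connected (chamber x)" by (rule connected_chamber)
  fix D assume D: "D \<noteq> {} \<and> chamber x \<subseteq> D \<and> D \<subseteq> - \<Union> hyperplanes \<and> topological_space_class.connected D"
  have "D \<subseteq> chamber x"
  proof
    fix u assume u: "u \<in> D"
    have xD: "x \<in> D" using D mem_chamber_self by blast
    have gen: "generic z" if "z \<in> D" for z using D that generic_iff by blast
    show "u \<in> chamber x"
      unfolding chamber_def same_side_def mem_Collect_eq
    proof (intro allI impI conjI)
      fix i j :: nat assume ij: "i \<noteq> j"
      show "sgn (u i - u j) = sgn (x i - x j)"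
        by (rule sgn_const_on_connected[where T = D and f = "\<lambda>z. z i - z j"])
          (use D u xD gen ij in \<open>auto simp: generic_def intro!: continuous_intros continuous_on_coord\<close>)
      show "sgn (u i + u j) = sgn (x i + x j)"
        by (rule sgn_const_on_connected[where T = D and f = "\<lambda>z. z i + z j"])
          (use D u xD gen ij in \<open>auto simp: generic_def intro!: continuous_intros continuous_on_coord\<close>)
    qed
  qed
  then show "D = chamber x" using D by blast
qed

lemma Alc_verts_eq: "Alc_verts = chamber ` V base"
proof
  show "Alc_verts \<subseteq> chamber ` V base"
  proof
    fix A assume "A \<in> Alc_verts"
    then obtain w where w: "w \<in> W_a" "A = w ` A0" "A \<subseteq> A_plus"
      by (auto simp: Alc_verts_def)
    then have A: "A = chamber (w base)" by (simp add: A0_eq_chamber W_a_image_chamber)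
    then have "w base \<in> A_plus" using w(3) mem_chamber_self by blast
    then have "w base \<in> V base" using w(1) by (auto simp: V_def)
    then show "A \<in> chamber ` V base" using A by blast
  qed
  show "chamber ` V base \<subseteq> Alc_verts"
  proof
    fix A assume "A \<in> chamber ` V base"
    then obtain x where x: "x \<in> V base" "A = chamber x" by blast
    then obtain w where "w \<in> W_a" "x = w base" by (auto simp: V_def)
    then have "\<exists>w\<in>W_a. A = w ` A0" using x by (auto simp: A0_eq_chamber W_a_image_chamber)
    then show "A \<in> Alc_verts"
      using x chamber_in_alcoves[OF V_base_generic] chamber_A_plus[OF V_A_plus]
      by (auto simp: Alc_verts_def)
  qed
qed

text \<open>A point \<open>u\<close> of the closed chamber is approached by the points \<open>u + t x\<close> of the chamber, as \<open>t\<close>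
  tends to zero from above.\<close>

lemma closure_chamber:
  assumes "generic x"
  shows "closure (chamber x) = closed_chamber x"
proof
  have "closed_chamber x =
    (\<Inter>(i, j)\<in>{(i, j). i \<noteq> j}.
       {u. 0 \<le> sgn (x i - x j) * (u i - u j)} \<inter> {u. 0 \<le> sgn (x i + x j) * (u i + u j)})"
    by (auto simp: closed_chamber_def)
  also have "closed \<dots>"
    by (auto intro!: closed_INT closed_Int closed_Collect_le continuous_intros continuous_on_coord)
  finally have "closed (closed_chamber x)" .
  moreover have "chamber x \<subseteq> closed_chamber x"
  proof
    fix u assume "u \<in> chamber x"
    then have "i \<noteq> j \<Longrightarrow> sgn (x i - x j) = sgn (u i - u j) \<and> sgn (x i + x j) = sgn (u i + u j)" for i j
      by (simp add: chamber_def same_side_def)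
    then show "u \<in> closed_chamber x" by (simp add: closed_chamber_def sgn_mult_self_eq mult.commute abs_sgn[symmetric])
  qed
  ultimately show "closure (chamber x) \<subseteq> closed_chamber x" by (rule closure_minimal[rotated])
  show "closed_chamber x \<subseteq> closure (chamber x)"
  proof
    fix u assume u: "u \<in> closed_chamber x"
    define f where "f t = (\<lambda>i. u i + t * x i)" for t :: real
    have push: "sgn (a + t * b) = sgn b" if "b \<noteq> 0" "0 \<le> sgn b * a" "0 < t" for a b t :: real
    proof (cases "0 < b")
      case True
      then have "0 < a + t * b" using that by (intro add_nonneg_pos) auto
      then show ?thesis using True by simp
    next
      case False
      then have "b < 0" using that(1) by simp
      then have "a \<le> 0" "t * b < 0" using that by (auto simp: mult_pos_neg)
      then have "a + t * b < 0" by simp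
      then show ?thesis using \<open>b < 0\<close> by simp
    qed
    have "f t \<in> chamber x" if t: "0 < t" for t
      unfolding chamber_def same_side_def mem_Collect_eq
    proof (intro allI impI conjI)
      fix i j :: nat assume ij: "i \<noteq> j"
      have "f t i - f t j = (u i - u j) + t * (x i - x j)" by (simp add: f_def algebra_simps)
      then show "sgn (f t i - f t j) = sgn (x i - x j)"
        using push[OF _ _ t] u assms ij by (simp add: closed_chamber_def generic_def)
      have "f t i + f t j = (u i + u j) + t * (x i + x j)" by (simp add: f_def algebra_simps)
      then show "sgn (f t i + f t j) = sgn (x i + x j)"
        using push[OF _ _ t] u assms ij by (simp add: closed_chamber_def generic_def)
    qed
    then have "f ` {0<..} \<subseteq> closure (chamber x)" using closure_subset by blast
    moreover have "continuous_on (closure {0<..}) f"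
      unfolding f_def by (intro continuous_intros)
    ultimately have "f ` closure {0<..} \<subseteq> closure (chamber x)"
      by (intro image_closure_subset) auto
    moreover have "f 0 = u" by (simp add: f_def)
    ultimately show "u \<in> closure (chamber x)" by (auto simp: image_subset_iff)
  qed
qed


section \<open>Walls of chambers\<close>

text \<open>For \<open>s = - 1\<close> and \<open>s = 1\<close> these are the fixed spaces of \<open>(ij)\<close> and \<open>(ij)\<^sub>-\<close>.\<close>

definition wall :: "nat \<Rightarrow> nat \<Rightarrow> real \<Rightarrow> rseq set" where
  "wall i j s = {u. u i + s * u j = 0}"

lemma hyperplanes_eq: "hyperplanes = {wall i j s | i j s. i \<noteq> j \<and> (s = 1 \<or> s = - 1)}"
proof -
  have pos: "{v. refl_pos i j v = v} = wall i j (- 1)" if "i \<noteq> j" for i j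
    using that by (auto simp: refl_pos_def wall_def fun_eq_iff)
  have neg: "{v. refl_neg i j v = v} = wall i j 1" if "i \<noteq> j" for i j
    using that by (auto simp: refl_neg_def wall_def fun_eq_iff)
  show ?thesis
    unfolding hyperplanes_def reflections_def using pos neg by (auto; metis)
qed

lemma subspace_wall: "rseq.subspace (wall i j s)"
  by (auto simp: rseq.subspace_def wall_def algebra_simps) (simp add: distrib_left[symmetric] mult.left_commute)

lemma wall_subset_imp:
  assumes ij: "i \<noteq> j" and ab: "a \<noteq> b" and s: "s = 1 \<or> s = - 1" and t: "t = 1 \<or> t = - 1"
    and sub: "wall i j s \<subseteq> wall a b t"
  shows "{a, b} = {i, j} \<and> t = s"
proof -
  have "{a, b} = {i, j}"
  proof (rule ccontr)
    assume "{a, b} \<noteq> {i, j}"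
    then consider "a \<noteq> i" "a \<noteq> j" | "b \<noteq> i" "b \<noteq> j" using ab by blast
    then show False
    proof cases
      case 1
      then have "(\<lambda>k. of_bool (k = a)) \<in> wall i j s" by (auto simp: wall_def)
      then have "(\<lambda>k. of_bool (k = a)) \<in> wall a b t" using sub by blast
      then show False using ab by (auto simp: wall_def)
    next
      case 2
      then have "(\<lambda>k. of_bool (k = b)) \<in> wall i j s" by (auto simp: wall_def)
      then have "(\<lambda>k. of_bool (k = b)) \<in> wall a b t" using sub by blast
      then show False using ab t by (auto simp: wall_def)
    qed
  qed
  moreover have "(\<lambda>k. if k = i then 1 else if k = j then - s else 0) \<in> wall i j s"
    using ij s by (auto simp: wall_def)
  then have "(\<lambda>k. if k = i then 1 else if k = j then - s else 0) \<in> wall a b t"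
    using sub by blast
  ultimately show ?thesis
    using ij s t by (auto simp: wall_def doubleton_eq_iff)
qed

lemma connected_negative_side: "topological_space_class.connected {u::rseq. u i + u j < 0}"
proof (rule connected_if_segments)
  fix a b :: rseq and t :: real
  assume ab: "a \<in> {u. u i + u j < 0}" "b \<in> {u. u i + u j < 0}" and t: "0 \<le> t" "t \<le> 1"
  have "((1 - t) * a i + t * b i) + ((1 - t) * a j + t * b j) = (1 - t) * (a i + a j) + t * (b i + b j)"
    by (simp add: algebra_simps)
  then have "sgn (((1 - t) * a i + t * b i) + ((1 - t) * a j + t * b j)) = - 1"
    using sgn_convex_combination[of "a i + a j" "- 1" "b i + b j" t] ab t by simp
  then show "(\<lambda>i. (1 - t) * a i + t * b i) \<in> {u. u i + u j < 0}"
    by (simp add: sgn_1_neg)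
qed

lemma separatesI:
  assumes X: "X \<subseteq> {u. u i + u j < 0}" "topological_space_class.connected X" "X \<noteq> {}"
    and Y: "Y \<subseteq> {u. 0 < u i + u j}" "topological_space_class.connected Y" "Y \<noteq> {}"
  shows "separates (wall i j 1) X Y"
proof -
  have sub: "X \<subseteq> - wall i j 1" "Y \<subseteq> - wall i j 1"
    using X(1) Y(1) by (auto simp: wall_def)
  obtain C where C: "C \<in> components (- wall i j 1)" "X \<subseteq> C"
    using exists_component_superset[OF sub(1) _ X(2)] X(3) sub by blast
  obtain D where D: "D \<in> components (- wall i j 1)" "Y \<subseteq> D"
    using exists_component_superset[OF sub(2) _ Y(2)] Y(3) sub by blast
  obtain x y where xy: "x \<in> X" "y \<in> Y" using X(3) Y(3) by blast
  \<comment> \<open>Otherwise the sum of the two entries would change its sign on a connected set without zero.\<close>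
  have "C \<noteq> D"
  proof
    assume "C = D"
    have "sgn (x i + x j) = sgn (y i + y j)"
    proof (rule sgn_const_on_connected[where T = C and f = "\<lambda>u. u i + u j"])
      show "topological_space_class.connected C" using C(1) by (rule in_components_connected)
      show "continuous_on C (\<lambda>u. u i + u j)"
        by (intro continuous_intros continuous_on_coord)
      show "u i + u j \<noteq> 0" if "u \<in> C" for u
        using in_components_subset[OF C(1)] that by (auto simp: wall_def)
    qed (use xy C D \<open>C = D\<close> in auto)
    moreover have "x i + x j < 0" "0 < y i + y j" using xy X(1) Y(1) by auto
    ultimately show False by simp
  qed
  then show ?thesis unfolding separates_def using C D by blast
qed

lemma separatesD:
  assumes sep: "separates (wall i j 1) X Y" and X: "X \<subseteq> {u. u i + u j < 0}" "X \<noteq> {}"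
    and Y: "Y \<subseteq> {u. u i + u j < 0}" "Y \<noteq> {}"
  shows False
proof -
  let ?T = "{u::rseq. u i + u j < 0}"
  obtain C D where C: "C \<in> components (- wall i j 1)" "X \<subseteq> C"
    and D: "D \<in> components (- wall i j 1)" "Y \<subseteq> D" and ne: "C \<noteq> D"
    using sep unfolding separates_def by blast
  have T: "?T \<subseteq> - wall i j 1" by (auto simp: wall_def)
  have "?T \<subseteq> C" "?T \<subseteq> D"
    using components_maximal[OF C(1) connected_negative_side T]
      components_maximal[OF D(1) connected_negative_side T] C D X Y by blast+
  then have "C \<inter> D \<noteq> {}" using X by blast
  then show False using components_nonoverlap[OF C(1) D(1)] ne by blast
qed


section \<open>Common facets come from steps\<close>

lemma abs_less_iff_prod: "\<bar>b\<bar> < \<bar>a\<bar> \<longleftrightarrow> 0 < (a - b) * (a + b)" for a b :: real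
proof -
  have "(a - b) * (a + b) = \<bar>a\<bar>\<^sup>2 - \<bar>b\<bar>\<^sup>2" by (simp add: power2_eq_square algebra_simps)
  moreover have "\<bar>b\<bar> < \<bar>a\<bar> \<longleftrightarrow> \<bar>b\<bar>\<^sup>2 < \<bar>a\<bar>\<^sup>2"
    by (metis abs_ge_zero linorder_not_less power2_le_imp_le power_strict_mono zero_less_numeral abs_le_square_iff abs_abs)
  ultimately show ?thesis by simp
qed

text \<open>The moduli are \<open>0, 1, 2, \<dots>\<close> without repetition, so each is the number of smaller ones. As
  \<open>\<bar>b\<bar> < \<bar>a\<bar>\<close> is decided by the signs of \<open>a - b\<close> and \<open>a + b\<close>, the moduli can be read off
  the sign vector.\<close>

lemma V_base_abs_rank:
  assumes "x \<in> V base"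
  shows "\<bar>x a\<bar> = real (card {b. \<bar>x b\<bar> < \<bar>x a\<bar>})" "finite {b. \<bar>x b\<bar> < \<bar>x a\<bar>}"
proof -
  obtain p where p: "bij p" "\<And>i. \<bar>x i\<bar> = real (p i)" using V_base_rank[OF assms] by metis
  have "{b. \<bar>x b\<bar> < \<bar>x a\<bar>} = p -` {..<p a}" by (auto simp: p(2))
  moreover have "card (p -` {..<p a}) = p a"
    using p(1) by (subst card_vimage_inj) (auto simp: bij_def)
  ultimately show "\<bar>x a\<bar> = real (card {b. \<bar>x b\<bar> < \<bar>x a\<bar>})" by (simp add: p(2))
  show "finite {b. \<bar>x b\<bar> < \<bar>x a\<bar>}"
    unfolding \<open>{b. \<bar>x b\<bar> < \<bar>x a\<bar>} = p -` {..<p a}\<close>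
    using p(1) by (intro finite_vimageI) (auto simp: bij_def)
qed

lemma A_plus_sgn_diff:
  assumes "x \<in> A_plus" "y \<in> A_plus"
  shows "sgn (x a - x b) = sgn (y a - y b)"
proof -
  have "sgn (z a - z b) = (if a < b then 1 else if a = b then 0 else - 1)" if z: "z \<in> A_plus" for z
  proof -
    consider "a < b" | "a = b" | "b < a" by linarith
    then show ?thesis
    proof cases
      case 1
      then have "z b < z a" using A_plus_less_iff[OF z] by simp
      then show ?thesis using 1 by simp
    next
      case 2
      then show ?thesis by simp
    next
      case 3
      then have "z a < z b" using A_plus_less_iff[OF z] by simp
      then show ?thesis using 3 by simp
    qed
  qed
  then show ?thesis using assms by simp
qed

lemma abs_less_transfer:
  assumes x: "x \<in> A_plus" and y: "y \<in> A_plus"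
    and "a \<noteq> b" and s: "sgn (x a + x b) = sgn (y a + y b)"
  shows "\<bar>x b\<bar> < \<bar>x a\<bar> \<longleftrightarrow> \<bar>y b\<bar> < \<bar>y a\<bar>"
proof -
  have "sgn (x a - x b) = sgn (y a - y b)" using x y by (rule A_plus_sgn_diff)
  then have "sgn ((x a - x b) * (x a + x b)) = sgn ((y a - y b) * (y a + y b))"
    using s by (simp add: sgn_mult)
  then show ?thesis unfolding abs_less_iff_prod by (metis sgn_1_pos)
qed

lemma same_side_V_base_eq:
  assumes x: "x \<in> V base" and y: "y \<in> V base" and same: "same_side x y"
  shows "x = y"
proof
  fix a
  have xA: "x \<in> A_plus" and yA: "y \<in> A_plus" using x y by (auto dest: V_A_plus)
  have abs: "\<bar>x a\<bar> = \<bar>y a\<bar>" for a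
  proof -
    have "\<bar>x b\<bar> < \<bar>x a\<bar> \<longleftrightarrow> \<bar>y b\<bar> < \<bar>y a\<bar>" for b
      using abs_less_transfer[OF xA yA, of a b] same by (cases "a = b") (auto simp: same_side_def)
    then show ?thesis using V_base_abs_rank(1)[OF x, of a] V_base_abs_rank(1)[OF y, of a] by simp
  qed
  obtain m where m: "x m = 0" using V_base_zero[OF x] by blast
  then have m': "y m = 0" using abs[of m] by simp
  have "x a < x m \<longleftrightarrow> y a < y m" using A_plus_less_iff[OF xA] A_plus_less_iff[OF yA] by simp
  then show "x a = y a" using abs[of a] m m' by (auto simp: abs_if split: if_splits)
qed

text \<open>Only the comparison of \<open>\<bar>x i\<bar>\<close> with \<open>\<bar>x j\<bar>\<close> is reversed between \<open>x\<close> and \<open>y\<close>. So all other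
  ranks of moduli stay, that of \<open>i\<close> grows by one and that of \<open>j\<close> drops by one; hence these two moduli
  are consecutive and exchanged. The signs of the entries are seen by comparison with the entry \<open>0\<close>.\<close>

lemma step_if_single_sign_change:
  assumes x: "x \<in> V base" and y: "y \<in> V base" and ij: "i < j"
    and same: "\<And>a b. a \<noteq> b \<Longrightarrow> {a, b} \<noteq> {i, j} \<Longrightarrow> sgn (x a + x b) = sgn (y a + y b)"
    and neg: "x i + x j < 0" and pos: "0 < y i + y j"
  shows "x i + x j = - 1 \<and> y = refl_neg i j x"
proof -
  have xA: "x \<in> A_plus" and yA: "y \<in> A_plus" using x y by (auto dest: V_A_plus)
  have xij: "x j < x i" using ij A_plus_less_iff[OF xA] by simp
  have yij: "y j < y i" using ij A_plus_less_iff[OF yA] by simp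
  have less: "\<bar>x b\<bar> < \<bar>x a\<bar> \<longleftrightarrow> \<bar>y b\<bar> < \<bar>y a\<bar>" if "{a, b} \<noteq> {i, j}" for a b
    using abs_less_transfer[OF xA yA, of a b] same that by (cases "a = b") auto
  have xless: "\<bar>x i\<bar> < \<bar>x j\<bar>" and yless: "\<bar>y j\<bar> < \<bar>y i\<bar>" using neg pos xij yij by auto
  have abs: "\<bar>x a\<bar> = \<bar>y a\<bar>" if "a \<noteq> i" "a \<noteq> j" for a
  proof -
    have "\<bar>x b\<bar> < \<bar>x a\<bar> \<longleftrightarrow> \<bar>y b\<bar> < \<bar>y a\<bar>" for b using less[of a b] that by auto
    then show ?thesis using V_base_abs_rank(1)[OF x, of a] V_base_abs_rank(1)[OF y, of a] by simp
  qed
  have "{b. \<bar>y b\<bar> < \<bar>y i\<bar>} = insert j {b. \<bar>x b\<bar> < \<bar>x i\<bar>}"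
  proof (rule set_eqI)
    fix b
    show "b \<in> {b. \<bar>y b\<bar> < \<bar>y i\<bar>} \<longleftrightarrow> b \<in> insert j {b. \<bar>x b\<bar> < \<bar>x i\<bar>}"
      using less[of i b] yless ij by (cases "b = j") (auto simp: doubleton_eq_iff)
  qed
  moreover have "j \<notin> {b. \<bar>x b\<bar> < \<bar>x i\<bar>}" using xless by simp
  ultimately have yi: "\<bar>y i\<bar> = \<bar>x i\<bar> + 1"
    using V_base_abs_rank[OF x, of i] V_base_abs_rank(1)[OF y, of i] by simp
  have "{b. \<bar>x b\<bar> < \<bar>x j\<bar>} = insert i {b. \<bar>y b\<bar> < \<bar>y j\<bar>}"
  proof (rule set_eqI)
    fix b
    show "b \<in> {b. \<bar>x b\<bar> < \<bar>x j\<bar>} \<longleftrightarrow> b \<in> insert i {b. \<bar>y b\<bar> < \<bar>y j\<bar>}"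
      using less[of j b] xless ij by (cases "b = i") (auto simp: doubleton_eq_iff)
  qed
  moreover have "i \<notin> {b. \<bar>y b\<bar> < \<bar>y j\<bar>}" using yless by simp
  ultimately have xj: "\<bar>x j\<bar> = \<bar>y j\<bar> + 1"
    using V_base_abs_rank(1)[OF x, of j] V_base_abs_rank[OF y, of j] by simp
  obtain q where q: "\<bar>x i\<bar> = real q" using V_base_rank[OF x] by metis
  obtain c where c: "\<bar>x c\<bar> = real (Suc q)" using V_base_abs_surj[OF x] by blast
  \<comment> \<open>No other entry can have the modulus that \<open>y i\<close> takes.\<close>
  have "c = j"
  proof (rule ccontr)
    assume "c \<noteq> j"
    moreover have "c \<noteq> i" using c q by auto
    ultimately have "\<bar>y c\<bar> = \<bar>y i\<bar>" using abs[of c] c q yi by simp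
    then show False using V_base_abs_eq_iff[OF y] \<open>c \<noteq> i\<close> by simp
  qed
  then have gap: "\<bar>x j\<bar> = \<bar>x i\<bar> + 1" using c q by simp
  have xjneg: "x j < 0" and yipos: "0 < y i" using neg pos xij yij by auto
  obtain m where m: "x m = 0" using V_base_zero[OF x] by blast
  have "m \<noteq> j" using m xjneg by auto
  have xi: "0 \<le> x i"
  proof (rule ccontr)
    assume less: "\<not> 0 \<le> x i"
    then have "m \<noteq> i" using m by auto
    then have "y m = 0" using abs[of m] m \<open>m \<noteq> j\<close> by simp
    moreover have "m < i" using A_plus_less_iff[OF xA, of i m] less m by simp
    ultimately show False using A_plus_less_iff[OF yA, of i m] yipos by simp
  qed
  have yj: "y j \<le> 0"
  proof (rule ccontr)
    assume less: "\<not> y j \<le> 0"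
    have "m \<noteq> i" using m less xj gap by auto
    then have "y m = 0" using abs[of m] m \<open>m \<noteq> j\<close> by simp
    then have "j < m" using A_plus_less_iff[OF yA, of m j] less by simp
    then show False using A_plus_less_iff[OF xA, of m j] m xjneg by simp
  qed
  have eq: "x j = - x i - 1" "y i = - x j" "y j = - x i"
    using gap xi xjneg yi yipos xj yj by auto
  have other: "y a = x a" if "a \<noteq> i" "a \<noteq> j" for a
  proof (cases "x a = 0")
    case True
    then show ?thesis using abs[OF that] by simp
  next
    case nz: False
    have k: "a < i \<longleftrightarrow> x i < x a" "a < i \<longleftrightarrow> y i < y a" "a < j \<longleftrightarrow> x j < x a" "a < j \<longleftrightarrow> y j < y a"
      by (simp_all add: A_plus_less_iff[OF xA] A_plus_less_iff[OF yA])
    have ne: "\<bar>x a\<bar> \<noteq> \<bar>x j\<bar>" using V_base_abs_eq_iff[OF x] that by auto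
    show ?thesis
    proof (cases "m = i")
      case True
      then have "\<bar>x a\<bar> \<noteq> 1" using ne eq m by simp
      moreover obtain l where "\<bar>x a\<bar> = real l" using V_base_rank[OF x] by metis
      ultimately have "1 < \<bar>x a\<bar>" using nz by (cases l) auto
      then show ?thesis using k abs[OF that] eq m True by (auto simp: abs_if split: if_splits)
    next
      case False
      then have "y m = 0" using abs[of m] m \<open>m \<noteq> j\<close> by simp
      moreover have "x a < x m \<longleftrightarrow> y a < y m" using A_plus_less_iff[OF xA] A_plus_less_iff[OF yA] by simp
      ultimately show ?thesis using m abs[OF that] by (auto simp: abs_if split: if_splits)
    qed
  qed
  have "y = refl_neg i j x"
  proof
    fix a
    show "y a = refl_neg i j x a"
      using eq other[of a] ij refl_neg_apply(1,2)[of i j x] refl_neg_apply(3)[of a i j x]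
      by (cases "a = i"; cases "a = j") auto
  qed
  then show ?thesis using eq by simp
qed

text \<open>If \<open>x\<close> and \<open>y\<close> are on different sides of a hyperplane, then both closed chambers meet only inside
  it. As their intersection spans \<open>H\<close>, no hyperplane other than \<open>H\<close> separates \<open>x\<close> from \<open>y\<close>. But \<open>H\<close>
  does, since otherwise \<open>x = y\<close> would itself lie in the span; and it is of the form
  \<open>x i + x j = 0\<close>, because both sequences are decreasing. Separation from \<^const>\<open>A0\<close>
  gives the direction.\<close>

lemma arc_imp_step:
  assumes x: "x \<in> V base" and y: "y \<in> V base" and H: "H \<in> hyperplanes"
    and span: "rseq.span (closed_chamber x \<inter> closed_chamber y) = H"
    and sep: "separates H A0 (chamber y)"
  shows "\<exists>i j. i \<noteq> j \<and> x i + x j = - 1 \<and> y = refl_neg i j x"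
proof -
  have xA: "x \<in> A_plus" and yA: "y \<in> A_plus" using x y by (auto dest: V_A_plus)
  obtain i j s where ij: "i \<noteq> j" and s: "s = 1 \<or> s = - 1" and Hw: "H = wall i j s"
    using H unfolding hyperplanes_eq by blast
  have sub: "{a, b} = {i, j} \<and> s = 1" if ab: "a \<noteq> b" and ne: "sgn (x a + x b) \<noteq> sgn (y a + y b)" for a b
  proof -
    have "closed_chamber x \<inter> closed_chamber y \<subseteq> wall a b 1"
    proof
      fix u assume u: "u \<in> closed_chamber x \<inter> closed_chamber y"
      then have *: "0 \<le> sgn (x a + x b) * (u a + u b)" "0 \<le> sgn (y a + y b) * (u a + u b)"
        using ab by (auto simp: closed_chamber_def)
      have "x a + x b \<noteq> 0" "y a + y b \<noteq> 0" using V_base_sum_nonzero x y ab by auto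
      then have "u a + u b = 0" using ne * by (auto simp: sgn_if split: if_splits)
      then show "u \<in> wall a b 1" by (simp add: wall_def)
    qed
    then have "wall i j s \<subseteq> wall a b 1"
      using rseq.span_minimal[OF _ subspace_wall] span Hw by blast
    then show ?thesis using wall_subset_imp[OF ij ab s, of 1] by blast
  qed
  have "\<exists>a b. a \<noteq> b \<and> sgn (x a + x b) \<noteq> sgn (y a + y b)"
  proof (rule ccontr)
    assume "\<not> ?thesis"
    then have "same_side x y"
      using A_plus_sgn_diff[OF yA xA] unfolding same_side_def by metis
    then have "x = y" by (rule same_side_V_base_eq[OF x y])
    then have "x \<in> H"
      using span mem_chamber_self[of x] closure_subset[of "chamber x"]
        closure_chamber[OF V_base_generic[OF x]] rseq.span_base[of x] by auto
    then have "x i + s * x j = 0" by (simp add: Hw wall_def)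
    then show False using V_base_sum_nonzero[OF x ij] s by auto
  qed
  then obtain a b where ab: "a \<noteq> b" "sgn (x a + x b) \<noteq> sgn (y a + y b)" by blast
  then have s1: "s = 1" and abij: "{a, b} = {i, j}" using sub by auto
  have ne: "sgn (x i + x j) \<noteq> sgn (y i + y j)"
    using ab abij by (auto simp: doubleton_eq_iff add.commute)
  have A0neg: "A0 \<subseteq> {u. u i + u j < 0}"
  proof
    fix u assume "u \<in> A0"
    then have "sgn (u i + u j) = sgn (base i + base j)"
      using ij by (simp add: A0_eq_chamber chamber_def same_side_def)
    also have "\<dots> = - 1" using ij by (simp add: base_def sgn_1_neg)
    finally show "u \<in> {u. u i + u j < 0}" by (simp add: sgn_1_neg)
  qed
  have "0 < y i + y j"
  proof (rule ccontr)
    assume "\<not> ?thesis"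
    then have neg: "y i + y j < 0" using V_base_sum_nonzero(1)[OF y ij] by simp
    have "chamber y \<subseteq> {u. u i + u j < 0}"
    proof
      fix u assume "u \<in> chamber y"
      then have "sgn (u i + u j) = - 1" using ij neg by (simp add: chamber_def same_side_def)
      then show "u \<in> {u. u i + u j < 0}" by (simp add: sgn_1_neg)
    qed
    then show False
      using separatesD[of i j A0 "chamber y"] sep A0neg mem_chamber_self[of y] mem_chamber_self[of base]
      unfolding Hw s1 A0_eq_chamber by blast
  qed
  moreover have "x i + x j < 0"
    using ne calculation V_base_sum_nonzero(1)[OF x ij] by (auto simp: sgn_if split: if_splits)
  moreover have same: "sgn (x a + x b) = sgn (y a + y b)" if "a \<noteq> b" "{a, b} \<noteq> {i, j}" for a b
    using sub[OF that(1)] that(2) by blast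
  ultimately show ?thesis
  proof (cases "i < j")
    case True
    then show ?thesis
      using step_if_single_sign_change[OF x y True same] \<open>0 < y i + y j\<close> \<open>x i + x j < 0\<close> ij by blast
  next
    case False
    then have ji: "j < i" using ij by simp
    have "x j + x i < 0" "0 < y j + y i" using \<open>0 < y i + y j\<close> \<open>x i + x j < 0\<close> by auto
    then show ?thesis
      using step_if_single_sign_change[OF x y ji, of] same ij by (metis insert_commute)
  qed
qed


section \<open>Steps give common facets\<close>

text \<open>The facet contains points as deep as desired. Let \<open>z\<close> be the sequence \<open>x\<close> with \<open>x i\<close> raised by
  one, so that \<open>z i = - z j\<close> and all other moduli are distinct. Scale each entry of \<open>z\<close> with a weight
  \<open>2 M l\<close>, where \<open>M l\<close> is the sum of \<open>\<bar>h k\<bar>\<close> over all \<open>k\<close> with \<open>\<bar>z k\<bar> \<le> \<bar>z l\<bar>\<close>. Moduli of \<open>z\<close>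
  differ by at least one, so the gap between the scaled entries at \<open>a\<close> and \<open>b\<close> with
  \<open>\<bar>z b\<bar> < \<bar>z a\<bar>\<close> is at least \<open>2 M a \<ge> \<bar>h a\<bar> + \<bar>h b\<bar>\<close>. A perturbation within the hyperplane that is
  bounded by \<open>h\<close> therefore does not leave the closed chamber.\<close>

lemma wall_point_domination:
  fixes z h :: rseq
  assumes z: "z = x(i := x i + 1)" and x: "x \<in> V base" and ij: "i \<noteq> j"
    and xi: "0 \<le> x i" and sum: "x i + x j = - 1"
    and g: "\<And>l. \<bar>g l\<bar> \<le> \<bar>h l\<bar>" and gij: "g i + g j = 0"
  shows "(\<lambda>l. 2 * z l * (\<Sum>k | \<bar>z k\<bar> \<le> \<bar>z l\<bar>. \<bar>h k\<bar>) + g l) \<in> closed_chamber x \<inter> wall i j 1"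
proof -
  define M where "M l = (\<Sum>k | \<bar>z k\<bar> \<le> \<bar>z l\<bar>. \<bar>h k\<bar>)" for l
  define c where "c l = 2 * z l * M l + g l" for l
  have zi: "z i = x i + 1" and zj: "z j = - (x i + 1)" and zo: "\<And>l. l \<noteq> i \<Longrightarrow> z l = x l"
    using ij sum by (auto simp: z)
  have fin: "finite {k. \<bar>z k\<bar> \<le> t}" for t
  proof (rule finite_subset)
    show "{k. \<bar>z k\<bar> \<le> t} \<subseteq> insert i {k. x k \<ge> - t}"
    proof
      fix k assume "k \<in> {k. \<bar>z k\<bar> \<le> t}"
      then show "k \<in> insert i {k. x k \<ge> - t}" using zo[of k] by (cases "k = i") auto
    qed
    show "finite (insert i {k. x k \<ge> - t})" using V_base_finite_ge[OF x] by simp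
  qed
  have M_ge: "\<bar>g k\<bar> \<le> M l" if "\<bar>z k\<bar> \<le> \<bar>z l\<bar>" for k l
  proof -
    have "\<bar>h k\<bar> \<le> M l"
      unfolding M_def using that fin by (intro member_le_sum) auto
    then show ?thesis using g[of k] by simp
  qed
  have M_mono: "M k \<le> M l" if "\<bar>z k\<bar> \<le> \<bar>z l\<bar>" for k l
    unfolding M_def using that fin by (intro sum_mono2) auto
  have M_nonneg: "0 \<le> M l" for l unfolding M_def by (simp add: sum_nonneg)
  obtain f where f: "\<And>l. x l = of_int (f l)" using V_base_int[OF x] by blast
  have gap: "\<bar>z k\<bar> + 1 \<le> \<bar>z l\<bar>" if "\<bar>z k\<bar> < \<bar>z l\<bar>" for k l
  proof -
    define e where "e l = (if l = i then f i + 1 else f l)" for l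
    have e: "z l = of_int (e l)" for l
      using zi zo[of l] f by (simp add: e_def)
    then have "\<bar>e k\<bar> + 1 \<le> \<bar>e l\<bar>" using that by (simp flip: of_int_abs)
    then have "of_int (\<bar>e k\<bar> + 1) \<le> (of_int \<bar>e l\<bar> :: real)" by (simp only: of_int_le_iff)
    then show ?thesis using e by simp
  qed
  \<comment> \<open>The entry of larger modulus in \<open>z\<close> dictates the signs of sum and difference.\<close>
  have dom: "\<bar>c b\<bar> \<le> sgn (z a) * c a" if less: "\<bar>z b\<bar> < \<bar>z a\<bar>" for a b
  proof -
    have "\<bar>c b\<bar> \<le> 2 * \<bar>z b\<bar> * M b + \<bar>g b\<bar>"
      unfolding c_def using abs_triangle_ineq[of "2 * z b * M b" "g b"] M_nonneg[of b] by (simp add: abs_mult)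
    also have "2 * \<bar>z b\<bar> * M b \<le> 2 * (\<bar>z a\<bar> - 1) * M a"
      using gap[OF less] M_mono[of b a] less M_nonneg[of b] by (intro mult_mono) auto
    also have "\<bar>g b\<bar> \<le> M a" using M_ge[of b a] less by simp
    finally have "\<bar>c b\<bar> \<le> 2 * \<bar>z a\<bar> * M a - M a" by (simp add: algebra_simps)
    also have "M a \<ge> \<bar>g a\<bar>" using M_ge[of a a] by simp
    then have "2 * \<bar>z a\<bar> * M a - M a \<le> 2 * \<bar>z a\<bar> * M a - \<bar>g a\<bar>" by simp
    also have "\<dots> \<le> sgn (z a) * c a"
    proof -
      have "sgn (z a) * c a = 2 * \<bar>z a\<bar> * M a + sgn (z a) * g a"
        by (simp add: c_def abs_sgn algebra_simps)
      moreover have "- \<bar>g a\<bar> \<le> sgn (z a) * g a"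
        using less by (auto simp: sgn_if)
      ultimately show ?thesis by linarith
    qed
    finally show ?thesis .
  qed
  have sgnx: "sgn (x a - x b) = sgn (z a) \<and> sgn (x a + x b) = sgn (z a)"
    if less: "\<bar>z b\<bar> < \<bar>z a\<bar>" and ab: "a \<noteq> b" for a b
  proof -
    consider "a = i" | "b = i" | "a \<noteq> i" "b \<noteq> i" by blast
    then show ?thesis
    proof cases
      case 1
      then have "\<bar>x b\<bar> < x i + 1" using less zi zo[of b] xi ab by simp
      moreover have "\<bar>x b\<bar> \<noteq> x i" using V_base_abs_eq_iff[OF x, of b i] 1 ab xi by simp
      moreover have "\<bar>x b\<bar> \<le> x i"
      proof -
        have "real_of_int \<bar>f b\<bar> < real_of_int (f i + 1)" using \<open>\<bar>x b\<bar> < x i + 1\<close> by (simp add: f)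
        then have "\<bar>f b\<bar> < f i + 1" by (simp only: of_int_less_iff)
        then have "\<bar>f b\<bar> \<le> f i" by simp
        then have "of_int \<bar>f b\<bar> \<le> (of_int (f i) :: real)" by (simp only: of_int_le_iff)
        then show ?thesis using f by simp
      qed
      ultimately show ?thesis using 1 zi xi by (auto simp: sgn_1_pos)
    next
      case 2
      then have "x i + 1 < \<bar>x a\<bar>" using less zi zo[of a] xi ab by simp
      then show ?thesis using 2 xi zo[of a] ab by (auto simp: sgn_if)
    next
      case 3
      then show ?thesis using less zo[of a] zo[of b] by (auto simp: sgn_if)
    qed
  qed
  have eq_abs: "{a, b} = {i, j}" if "\<bar>z a\<bar> = \<bar>z b\<bar>" "a \<noteq> b" for a b
  proof -
    have one: "b = j" if "\<bar>z i\<bar> = \<bar>z b\<bar>" "b \<noteq> i" for b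
    proof -
      have "\<bar>x b\<bar> = \<bar>x j\<bar>" using that zi zo[of b] xi sum by auto
      then show ?thesis using V_base_abs_eq_iff[OF x] by simp
    qed
    consider "a = i" | "b = i" | "a \<noteq> i" "b \<noteq> i" by blast
    then show ?thesis
    proof cases
      case 3
      then show ?thesis using that zo V_base_abs_eq_iff[OF x, of a b] by simp
    qed (use one[of a] one[of b] that in auto)
  qed
  have "\<bar>z j\<bar> = \<bar>z i\<bar>" unfolding zi zj by (rule abs_minus_cancel)
  then have Mij: "M j = M i" by (simp only: M_def)
  have cij: "c i + c j = 0" using gij by (simp add: c_def zi zj Mij algebra_simps)
  have ci: "0 \<le> c i"
  proof -
    have "\<bar>g i\<bar> \<le> M i" using M_ge by simp
    moreover have "M i \<le> 2 * (x i + 1) * M i"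
      using xi M_nonneg[of i] by (simp add: algebra_simps)
    ultimately show ?thesis by (simp add: c_def zi)
  qed
  have "c \<in> closed_chamber x"
    unfolding closed_chamber_def mem_Collect_eq
  proof (intro allI impI)
    fix a b :: nat assume ab: "a \<noteq> b"
    consider "\<bar>z b\<bar> < \<bar>z a\<bar>" | "\<bar>z a\<bar> < \<bar>z b\<bar>" | "\<bar>z a\<bar> = \<bar>z b\<bar>" by linarith
    then show "0 \<le> sgn (x a - x b) * (c a - c b) \<and> 0 \<le> sgn (x a + x b) * (c a + c b)"
    proof cases
      case 1
      have "sgn (z a) = 1 \<or> sgn (z a) = - 1" using 1 by (auto simp: sgn_if)
      then show ?thesis using sgnx[OF 1 ab] dom[OF 1] by auto
    next
      case 2
      have s: "sgn (x b - x a) = sgn (z b)" "sgn (x a + x b) = sgn (z b)"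
        using sgnx[OF 2] ab by (auto simp: add.commute)
      then have s': "sgn (x a - x b) = - sgn (z b)" by (metis minus_diff_eq sgn_minus)
      have "sgn (z b) = 1 \<or> sgn (z b) = - 1" using 2 by (auto simp: sgn_if)
      then show ?thesis using s s' dom[OF 2] by auto
    next
      case 3
      then have "a = i \<and> b = j \<or> a = j \<and> b = i" using eq_abs ab by (auto simp: doubleton_eq_iff)
      moreover have "sgn (x i - x j) = 1" using xi sum by (simp add: sgn_1_pos)
      moreover have "sgn (x j - x i) = - 1" using xi sum by (simp add: sgn_1_neg)
      ultimately show ?thesis using cij ci by (auto simp: add.commute)
    qed
  qed
  moreover have "c \<in> wall i j 1" using cij by (simp add: wall_def)
  ultimately show ?thesis unfolding c_def M_def by blast
qed

text \<open>A vector \<open>h\<close> of the hyperplane is the difference of the facet points \<open>m + h\<close> and \<open>m\<close>, for a point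
  \<open>m\<close> of the facet that is deep enough for \<open>h\<close>.\<close>

lemma step_imp_span:
  assumes x: "x \<in> V base" and y: "y \<in> V base" and ij: "i \<noteq> j" and sum: "x i + x j = - 1"
    and y': "y = refl_neg i j x" and xi: "0 \<le> x i"
  shows "rseq.span (closed_chamber x \<inter> closed_chamber y) = wall i j 1"
proof
  have ysum: "y i + y j = 1" using refl_neg_apply(1,2)[OF ij, of x] sum by (simp add: y')
  have "closed_chamber x \<inter> closed_chamber y \<subseteq> wall i j 1"
  proof
    fix u assume "u \<in> closed_chamber x \<inter> closed_chamber y"
    then have "0 \<le> sgn (x i + x j) * (u i + u j)" "0 \<le> sgn (y i + y j) * (u i + u j)"
      using ij by (auto simp: closed_chamber_def)
    then show "u \<in> wall i j 1" by (simp add: sum ysum wall_def)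
  qed
  then show "rseq.span (closed_chamber x \<inter> closed_chamber y) \<subseteq> wall i j 1"
    by (rule rseq.span_minimal[OF _ subspace_wall])
  \<comment> \<open>The reflection fixes the hyperplane and exchanges the two chambers.\<close>
  have both: "u \<in> closed_chamber x \<inter> closed_chamber y" if "u \<in> closed_chamber x \<inter> wall i j 1" for u
  proof -
    have "refl_neg i j \<in> W_a" using ij by (intro W_a.gen) (auto simp: reflections_def)
    then have "refl_neg i j u \<in> closed_chamber y" using that W_a_closed_chamber y' by blast
    moreover have "refl_neg i j u = u"
      using that ij by (auto simp: wall_def refl_neg_def fun_eq_iff)
    ultimately show ?thesis using that by simp
  qed
  show "wall i j 1 \<subseteq> rseq.span (closed_chamber x \<inter> closed_chamber y)"
  proof
    fix h assume h: "h \<in> wall i j 1"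
    define z where "z = x(i := x i + 1)"
    define m where "m l = 2 * z l * (\<Sum>k | \<bar>z k\<bar> \<le> \<bar>z l\<bar>. \<bar>h k\<bar>)" for l
    have "(\<lambda>l. m l + h l) \<in> closed_chamber x \<inter> wall i j 1"
      unfolding m_def
      by (rule wall_point_domination[OF z_def x ij xi sum]) (use h in \<open>auto simp: wall_def\<close>)
    moreover have "(\<lambda>l. m l + 0) \<in> closed_chamber x \<inter> wall i j 1"
      unfolding m_def
      by (rule wall_point_domination[OF z_def x ij xi sum]) auto
    ultimately have "(\<lambda>l. m l + h l) - (\<lambda>l. m l + 0) \<in> rseq.span (closed_chamber x \<inter> closed_chamber y)"
      using both by (intro rseq.span_diff rseq.span_base) auto
    moreover have "(\<lambda>l. m l + h l) - (\<lambda>l. m l + 0) = h" by (auto simp: fun_eq_iff)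
    ultimately show "h \<in> rseq.span (closed_chamber x \<inter> closed_chamber y)" by simp
  qed
qed

lemma step_imp_arc:
  assumes x: "x \<in> V base" and y: "y \<in> V base" and ij: "i \<noteq> j" and sum: "x i + x j = - 1"
    and y': "y = refl_neg i j x"
  shows "\<exists>H\<in>hyperplanes. rseq.span (closed_chamber x \<inter> closed_chamber y) = H \<and>
    separates H A0 (chamber y)"
proof -
  obtain a b where ab: "a \<noteq> b" "x a + x b = - 1" "y = refl_neg a b x" "0 \<le> x a"
  proof (cases "0 \<le> x i")
    case True
    then show thesis using that ij sum y' by blast
  next
    case False
    obtain f where f: "\<And>l. x l = of_int (f l)" using V_base_int[OF x] by blast
    have "f i < 0" using False by (simp add: f)
    moreover have "f i + f j = - 1" using sum unfolding f by linarith
    ultimately have "0 \<le> x j" by (simp add: f)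
    then show thesis using that[of j i] ij sum y' refl_neg_swap by (metis add.commute)
  qed
  have "separates (wall a b 1) A0 (chamber y)"
  proof (rule separatesI)
    show "A0 \<subseteq> {u. u a + u b < 0}"
    proof
      fix u assume "u \<in> A0"
      then have "sgn (u a + u b) = sgn (base a + base b)"
        using ab by (simp add: A0_eq_chamber chamber_def same_side_def)
      also have "\<dots> = - 1" using ab by (simp add: base_def sgn_1_neg)
      finally show "u \<in> {u. u a + u b < 0}" by (simp add: sgn_1_neg)
    qed
    show "chamber y \<subseteq> {u. 0 < u a + u b}"
    proof
      fix u assume "u \<in> chamber y"
      then have "sgn (u a + u b) = sgn (y a + y b)"
        using ab(1) by (simp add: chamber_def same_side_def)
      also have "y a + y b = 1" using refl_neg_apply(1,2)[OF ab(1), of x] ab by simp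
      finally show "u \<in> {u. 0 < u a + u b}" by (simp add: sgn_1_pos)
    qed
  qed (unfold A0_eq_chamber, (use connected_chamber mem_chamber_self in blast)+)
  moreover have "wall a b 1 \<in> hyperplanes" using ab(1) unfolding hyperplanes_eq by blast
  ultimately show ?thesis
    using step_imp_span[OF x y ab(1,2,3,4)] by blast
qed

lemma G_graph_base_iso_Alc: "digraph_iso (with_proj (G_graph base)) (with_proj Alc)"
proof (rule digraph_iso_pairI)
  have inj: "inj_on chamber (V base)"
  proof (rule inj_onI)
    fix x y assume xy: "x \<in> V base" "y \<in> V base" "chamber x = chamber y"
    then have "same_side x y" using mem_chamber_self[of y] by (auto simp: chamber_def)
    then show "x = y" using same_side_V_base_eq xy by blast
  qed
  then show "bij_betw chamber (pverts (G_graph base)) (pverts Alc)"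
    by (simp add: bij_betw_def G_graph_def Alc_def Alc_verts_eq)
  fix x y assume "x \<in> pverts (G_graph base)" "y \<in> pverts (G_graph base)"
  then have x: "x \<in> V base" and y: "y \<in> V base" by (simp_all add: G_graph_def)
  have "(chamber x, chamber y) \<in> parcs Alc \<longleftrightarrow>
      (\<exists>H\<in>hyperplanes. rseq.span (closed_chamber x \<inter> closed_chamber y) = H \<and> separates H A0 (chamber y))"
    using x y by (simp add: Alc_def Alc_verts_eq closure_chamber[OF V_base_generic])
  also have "\<dots> \<longleftrightarrow> (\<exists>i j. i \<noteq> j \<and> x i + x j = - 1 \<and> y = refl_neg i j x)"
    using arc_imp_step[OF x y] step_imp_arc[OF x y] by blast
  finally show "(x, y) \<in> parcs (G_graph base) \<longleftrightarrow> (chamber x, chamber y) \<in> parcs Alc"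
    using G_graph_base_arc_iff[OF x y] by simp
qed (auto simp: G_graph_def Alc_def)


section \<open>The isomorphisms\<close>

theorem corollary7p3:
  shows "(\<forall>v\<in>A_plus. (\<exists>i. v i < 0) \<longrightarrow>
            digraph_iso (with_proj (G_graph v)) (with_proj Alc)) \<and>
         (\<forall>\<delta> \<delta>' :: int. \<forall>lam\<in>X_plus. \<forall>lam'\<in>X_plus.
            digraph_iso (with_proj (MBS \<delta> lam)) (with_proj (MBS \<delta>' lam')))"
proof (intro conjI ballI allI impI)
  fix v assume v: "v \<in> A_plus" and "\<exists>i. v i < 0"
  then obtain i where "v i < 0" by blast
  moreover have "base 1 < 0" by (simp add: base_def)
  ultimately have "digraph_iso (with_proj (G_graph v)) (with_proj (G_graph base))"
    using G_graph_iso v base_A_plus by blast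
  then show "digraph_iso (with_proj (G_graph v)) (with_proj Alc)"
    using G_graph_base_iso_Alc by (rule digraph_iso_trans)
next
  fix \<delta> \<delta>' :: int and lam lam' :: "nat \<Rightarrow> nat"
  assume "lam \<in> X_plus" "lam' \<in> X_plus"
  then show "digraph_iso (with_proj (MBS \<delta> lam)) (with_proj (MBS \<delta>' lam'))"
    by (rule MBS_iso_MBS)
qed

end
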